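(* Let $J\subseteq\Delta^d_n$ be an M-convex set and let $0<q<\infty$. Let $\mathrm{B}\subseteq V_J/\mathbb{R}\mathbf{1}$ be the closed unit ball with respect to some norm, and let $X=\mathrm{B}\setminus(\mathrm{Dr}_J\cap\partial\mathrm{B})$. Then the spaces $\mathrm{Gr}_J(\mathbb{T}_q)$ and $\mathrm{Gr}^{\mathrm w}_J(\mathbb{T}_q)$ are both homeomorphic to $X$. In particular, these spaces are topological manifolds with boundary which can be compactified to a closed ball of dimension $\tau(J)$.
   Context: $\Delta^d_n=\{\alpha\in\mathbb{Z}_{\ge0}^n:\alpha_1+\dots+\alpha_n=d\}$. A subset $J\subseteq\Delta^d_n$ is M-convex if $J\neq\emptyset$ and for all $\alpha,\beta\in J$ and $i\in[n]$ with $\alpha_i<\beta_i$ there is $j\in[n]$ with $\alpha_j>\beta_j$ such that $\alpha+e_i-e_j\in J$ and $\beta-e_i+e_j\in J$. Let $\delta^-_J,\delta^+_J\in\mathbb{Z}^n$ be the coordinatewise minimum and maximum over elements of $J$. A finite list $b_1,\dots,b_k\in\mathbb{R}_{\ge0}$ is called $q$-null ($0<q<\infty$) if $b_i^{1/q}\le\sum_{j\ne i}b_j^{1/q}$ for all $i$; $0$-null if all $b_i=0$ or the maximum is attained at least twice; $\infty$-null if all $b_i=0$, or the maximum is attained at least twice, or at least three $b_i$ are nonzero. For $q\in[0,\infty]$, a strong $\mathbb{T}_q$-representation of $J$ is a function $\rho\colon\Delta^d_n\to\mathbb{R}_{\ge0}$ with support exactly $J$ such that for all $2\le s\le d$, all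 $\alpha\in\Delta^{d-s}_n$ with $\delta^-_J\le\alpha$, all $1\le i_0\le\dots\le i_s\le n$ and $1\le j_2\le\dots\le j_s\le n$ with $\alpha+e_{i_0}+\dots+e_{i_s}+e_{j_2}+\dots+e_{j_s}\le\delta^+_J$ (coordinatewise), the $s+1$ numbers $\rho(\alpha+\sum_{m\ne k}e_{i_m})\cdot\rho(\alpha+e_{i_k}+e_{j_2}+\dots+e_{j_s})$, $k=0,\dots,s$, form a $q$-null list. A weak $\mathbb{T}_q$-representation is defined the same way but requiring the condition only for $s=2$. Let $\mathrm{R}_J(\mathbb{T}_q)$, $\mathrm{R}^{\mathrm w}_J(\mathbb{T}_q)$ be the sets of strong, resp. weak, representations, regarded as subsets of $\mathbb{R}_{>0}^J$ with the Euclidean topology; $\mathrm{Gr}_J(\mathbb{T}_q)=\mathrm{R}_J(\mathbb{T}_q)/\mathbb{R}_{>0}$ and $\mathrm{Gr}^{\mathrm w}_J(\mathbb{T}_q)=\mathrm{R}^{\mathrm w}_J(\mathbb{T}_q)/\mathbb{R}_{>0}$ (quotients by scalar multiplication, with quotient topology). $V_J=\{(\log\rho(\alpha))_{\alpha\in J}:\rho\in\mathrm{R}_J(\mathbb{T}_\infty)\}\subseteq\mathbb{R}^J$; this is a linear subspace containing the all-ones vector $\mathbf{1}$. The Dressian $\mathrm{Dr}_J\subseteq V_J/\mathbb{R}\mathbf{1}$ is the image of $\mathrm{R}_J(\mathbb{T}_0)$ under coordinatewise logarithm followed by the quotient map. The Tutte rank is $\tau(J)=\dim(V_J/\mathbb{R}\mathbf{1})$.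 *)

theory Defs
  imports
    "HOL-Analysis.Analysis"
    "HOL-Library.Function_Algebras"
    "HOL-Algebra.AbelCoset"
    "Jordan_Normal_Form.VS_Connect"
begin

subsection \<open>M-convex sets\<close>

text \<open>A vector of length \<open>n\<close> is a function on \<open>nat\<close> vanishing outside the index set
  \<open>{1..n}\<close>; sums, differences and \<open>\<le>\<close> of such vectors are pointwise.\<close>

definition discrete_simplex :: "nat \<Rightarrow> nat \<Rightarrow> (nat \<Rightarrow> nat) set" where
  "discrete_simplex n d = {\<alpha>. (\<forall>k. k \<notin> {1..n} \<longrightarrow> \<alpha> k = 0) \<and> (\<Sum>k\<in>{1..n}. \<alpha> k) = d}"

definition std_unit :: "nat \<Rightarrow> nat \<Rightarrow> nat" where
  "std_unit i = (\<lambda>k. if k = i then 1 else 0)"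

text \<open>The subtractions on \<open>nat\<close> below never truncate, since \<open>\<alpha> j > 0\<close> and \<open>\<beta> i > 0\<close>.\<close>

definition M_convex :: "nat \<Rightarrow> (nat \<Rightarrow> nat) set \<Rightarrow> bool" where
  "M_convex n J \<longleftrightarrow> J \<noteq> {} \<and>
     (\<forall>\<alpha>\<in>J. \<forall>\<beta>\<in>J. \<forall>i\<in>{1..n}. \<alpha> i < \<beta> i \<longrightarrow>
        (\<exists>j\<in>{1..n}. \<alpha> j > \<beta> j \<and>
           \<alpha> + std_unit i - std_unit j \<in> J \<and> \<beta> - std_unit i + std_unit j \<in> J))"

definition delta_min :: "(nat \<Rightarrow> nat) set \<Rightarrow> nat \<Rightarrow> nat" where
  "delta_min J = (\<lambda>k. Min ((\<lambda>\<alpha>. \<alpha> k) ` J))"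

definition delta_max :: "(nat \<Rightarrow> nat) set \<Rightarrow> nat \<Rightarrow> nat" where
  "delta_max J = (\<lambda>k. Max ((\<lambda>\<alpha>. \<alpha> k) ` J))"

subsection \<open>Representations over the triangular hyperfields\<close>

definition q_null :: "ennreal \<Rightarrow> real list \<Rightarrow> bool" where
  "q_null q b \<longleftrightarrow>
     (let I = {..<length b};
          all_zero = (\<forall>i\<in>I. b ! i = 0);
          max_twice = (2 \<le> card {i\<in>I. b ! i = Max (set b)})
      in if q = 0 then all_zero \<or> max_twice
         else if q = \<infinity> then all_zero \<or> max_twice \<or> 3 \<le> card {i\<in>I. b ! i \<noteq> 0}
         else (\<forall>i\<in>I. (b ! i) powr (1 / enn2real q) \<le> (\<Sum>j\<in>I - {i}. (b ! j) powr (1 / enn2real q))))"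

definition pluecker_relations ::
  "ennreal \<Rightarrow> nat \<Rightarrow> nat \<Rightarrow> (nat \<Rightarrow> nat) set \<Rightarrow> nat \<Rightarrow> ((nat \<Rightarrow> nat) \<Rightarrow> real) \<Rightarrow> bool" where
  "pluecker_relations q n d J s \<rho> \<longleftrightarrow>
     (\<forall>\<alpha>\<in>discrete_simplex n (d - s). \<forall>i j :: nat \<Rightarrow> nat.
        delta_min J \<le> \<alpha> \<longrightarrow>
        i ` {0..s} \<subseteq> {1..n} \<longrightarrow> mono_on {0..s} i \<longrightarrow>
        j ` {2..s} \<subseteq> {1..n} \<longrightarrow> mono_on {2..s} j \<longrightarrow>
        \<alpha> + (\<Sum>m\<in>{0..s}. std_unit (i m)) + (\<Sum>m\<in>{2..s}. std_unit (j m)) \<le> delta_max J \<longrightarrow>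
        q_null q
          (map (\<lambda>k. \<rho> (\<alpha> + (\<Sum>m\<in>{0..s} - {k}. std_unit (i m)))
                  * \<rho> (\<alpha> + std_unit (i k) + (\<Sum>m\<in>{2..s}. std_unit (j m))))
             [0..<s + 1]))"

definition strong_reps ::
  "ennreal \<Rightarrow> nat \<Rightarrow> nat \<Rightarrow> (nat \<Rightarrow> nat) set \<Rightarrow> ((nat \<Rightarrow> nat) \<Rightarrow> real) set" where
  "strong_reps q n d J =
     {\<rho> \<in> discrete_simplex n d \<rightarrow>\<^sub>E {0..}.
        {\<alpha> \<in> discrete_simplex n d. \<rho> \<alpha> \<noteq> 0} = J \<and>
        (\<forall>s. 2 \<le> s \<and> s \<le> d \<longrightarrow> pluecker_relations q n d J s \<rho>)}"

definition weak_reps ::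
  "ennreal \<Rightarrow> nat \<Rightarrow> nat \<Rightarrow> (nat \<Rightarrow> nat) set \<Rightarrow> ((nat \<Rightarrow> nat) \<Rightarrow> real) set" where
  "weak_reps q n d J =
     {\<rho> \<in> discrete_simplex n d \<rightarrow>\<^sub>E {0..}.
        {\<alpha> \<in> discrete_simplex n d. \<rho> \<alpha> \<noteq> 0} = J \<and>
        (2 \<le> d \<longrightarrow> pluecker_relations q n d J 2 \<rho>)}"

subsection \<open>Grassmannians\<close>

definition quotient_topology :: "'a topology \<Rightarrow> ('a \<Rightarrow> 'b) \<Rightarrow> 'b topology" where
  "quotient_topology X f =
     topology (\<lambda>U. U \<subseteq> f ` topspace X \<and> openin X {x \<in> topspace X. f x \<in> U})"

lemma openin_quotient_topology:
  "openin (quotient_topology X f) U \<longleftrightarrow>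
     U \<subseteq> f ` topspace X \<and> openin X {x \<in> topspace X. f x \<in> U}"
proof -
  define P where "P = (\<lambda>U. {x \<in> topspace X. f x \<in> U})"
  have inter: "P (S \<inter> T) = P S \<inter> P T" for S T
    by (auto simp: P_def)
  have union: "P (\<Union>\<K>) = \<Union>(P ` \<K>)" for \<K>
    by (auto simp: P_def)
  have "istopology (\<lambda>U. U \<subseteq> f ` topspace X \<and> openin X (P U))"
    unfolding istopology_def
  proof (intro conjI allI impI)
    fix S T
    assume "S \<subseteq> f ` topspace X \<and> openin X (P S)" "T \<subseteq> f ` topspace X \<and> openin X (P T)"
    then show "S \<inter> T \<subseteq> f ` topspace X" "openin X (P (S \<inter> T))"
      by (simp_all only: inter openin_Int le_infI1)
  next
    fix \<K>
    assume *: "\<forall>K\<in>\<K>. K \<subseteq> f ` topspace X \<and> openin X (P K)"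
    then show "\<Union>\<K> \<subseteq> f ` topspace X"
      by (simp only: Union_least)
    show "openin X (P (\<Union>\<K>))"
      unfolding union using * by (intro openin_Union) (elim imageE, simp only:)
  qed
  then show ?thesis
    unfolding quotient_topology_def P_def by (simp only: topology_inverse')
qed

lemma topspace_quotient_topology: "topspace (quotient_topology X f) = f ` topspace X"
proof (rule subset_antisym)
  have "openin (quotient_topology X f) (topspace (quotient_topology X f))"
    by (rule openin_topspace)
  then show "topspace (quotient_topology X f) \<subseteq> f ` topspace X"
    by (simp only: openin_quotient_topology)
  have "{x \<in> topspace X. f x \<in> f ` topspace X} = topspace X"
    by (rule subset_antisym) (simp_all add: subset_iff)
  then have "openin (quotient_topology X f) (f ` topspace X)"
    by (simp only: openin_quotient_topology openin_topspace subset_refl simp_thms)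
  then show "f ` topspace X \<subseteq> topspace (quotient_topology X f)"
    by (rule openin_subset)
qed

lemma quotient_map_quotient_topology: "quotient_map X (quotient_topology X f) f"
  by (simp only: quotient_map_def topspace_quotient_topology openin_quotient_topology
      simp_thms cong: imp_cong)

text \<open>\<open>\<real>\<^sup>J\<close> is the set of extensional functions on \<open>J\<close>, the carrier of \<open>powertop_real J\<close>.\<close>

definition rep_space ::
  "(nat \<Rightarrow> nat) set \<Rightarrow> ((nat \<Rightarrow> nat) \<Rightarrow> real) set \<Rightarrow> ((nat \<Rightarrow> nat) \<Rightarrow> real) topology" where
  "rep_space J R = subtopology (powertop_real J) ((\<lambda>\<rho>. restrict \<rho> J) ` R)"

definition scaling_orbit :: "'i set \<Rightarrow> ('i \<Rightarrow> real) \<Rightarrow> ('i \<Rightarrow> real) set" where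
  "scaling_orbit J \<rho> = {(\<lambda>\<alpha>\<in>J. c * \<rho> \<alpha>) | c. 0 < c}"

definition Gr ::
  "ennreal \<Rightarrow> nat \<Rightarrow> nat \<Rightarrow> (nat \<Rightarrow> nat) set \<Rightarrow> ((nat \<Rightarrow> nat) \<Rightarrow> real) set topology" where
  "Gr q n d J = quotient_topology (rep_space J (strong_reps q n d J)) (scaling_orbit J)"

definition Gr_weak ::
  "ennreal \<Rightarrow> nat \<Rightarrow> nat \<Rightarrow> (nat \<Rightarrow> nat) set \<Rightarrow> ((nat \<Rightarrow> nat) \<Rightarrow> real) set topology" where
  "Gr_weak q n d J = quotient_topology (rep_space J (weak_reps q n d J)) (scaling_orbit J)"

subsection \<open>The vector space \<open>V\<^sub>J / \<real>1\<close> and the Dressian\<close>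

definition real_power :: "'i set \<Rightarrow> (real, 'i \<Rightarrow> real) module" where
  "real_power J =
     \<lparr>carrier = J \<rightarrow>\<^sub>E UNIV, mult = undefined, one = undefined,
      zero = (\<lambda>\<alpha>\<in>J. 0), add = (\<lambda>u v. \<lambda>\<alpha>\<in>J. u \<alpha> + v \<alpha>),
      smult = (\<lambda>r v. \<lambda>\<alpha>\<in>J. r * v \<alpha>)\<rparr>"

definition log_vec :: "'i set \<Rightarrow> ('i \<Rightarrow> real) \<Rightarrow> 'i \<Rightarrow> real" where
  "log_vec J \<rho> = (\<lambda>\<alpha>\<in>J. ln (\<rho> \<alpha>))"

definition V_space :: "nat \<Rightarrow> nat \<Rightarrow> (nat \<Rightarrow> nat) set \<Rightarrow> ((nat \<Rightarrow> nat) \<Rightarrow> real) set" where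
  "V_space n d J = log_vec J ` strong_reps \<infinity> n d J"

definition ones_line :: "'i set \<Rightarrow> ('i \<Rightarrow> real) set" where
  "ones_line J = {(\<lambda>\<alpha>\<in>J. c) | c. True}"

definition ones_coset :: "'i set \<Rightarrow> ('i \<Rightarrow> real) \<Rightarrow> ('i \<Rightarrow> real) set" where
  "ones_coset J v = ones_line J +>\<^bsub>real_power J\<^esub> v"

text \<open>In the scalar multiplication, adding \<open>ones_line J\<close> makes the product a full coset also
  for the scalar \<open>0\<close>. The multiplicative fields of the record play no role.\<close>

definition VQ :: "nat \<Rightarrow> nat \<Rightarrow> (nat \<Rightarrow> nat) set \<Rightarrow> (real, ((nat \<Rightarrow> nat) \<Rightarrow> real) set) module" where
  "VQ n d J =
     \<lparr>carrier = ones_coset J ` V_space n d J, mult = undefined, one = undefined,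
      zero = ones_line J, add = (\<lambda>A B. A <+>\<^bsub>real_power J\<^esub> B),
      smult = (\<lambda>r A. ones_line J <+>\<^bsub>real_power J\<^esub> ((\<lambda>v. r \<odot>\<^bsub>real_power J\<^esub> v) ` A))\<rparr>"

definition VQ_top ::
  "nat \<Rightarrow> nat \<Rightarrow> (nat \<Rightarrow> nat) set \<Rightarrow> ((nat \<Rightarrow> nat) \<Rightarrow> real) set topology" where
  "VQ_top n d J = quotient_topology (subtopology (powertop_real J) (V_space n d J)) (ones_coset J)"

definition tutte_rank :: "nat \<Rightarrow> nat \<Rightarrow> (nat \<Rightarrow> nat) set \<Rightarrow> nat" where
  "tutte_rank n d J = vectorspace.dim class_ring (VQ n d J)"

definition Dressian ::
  "nat \<Rightarrow> nat \<Rightarrow> (nat \<Rightarrow> nat) set \<Rightarrow> ((nat \<Rightarrow> nat) \<Rightarrow> real) set set" where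
  "Dressian n d J = ones_coset J ` log_vec J ` strong_reps 0 n d J"

definition is_norm :: "(real, 'v) module \<Rightarrow> ('v \<Rightarrow> real) \<Rightarrow> bool" where
  "is_norm M N \<longleftrightarrow>
     (\<forall>x\<in>carrier M. 0 \<le> N x \<and> (N x = 0 \<longleftrightarrow> x = \<zero>\<^bsub>M\<^esub>)) \<and>
     (\<forall>r. \<forall>x\<in>carrier M. N (r \<odot>\<^bsub>M\<^esub> x) = \<bar>r\<bar> * N x) \<and>
     (\<forall>x\<in>carrier M. \<forall>y\<in>carrier M. N (x \<oplus>\<^bsub>M\<^esub> y) \<le> N x + N y)"

definition unit_cball :: "(real, 'v) module \<Rightarrow> ('v \<Rightarrow> real) \<Rightarrow> 'v set" where
  "unit_cball M N = {x \<in> carrier M. N x \<le> 1}"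

definition ball_minus_Dressian ::
  "nat \<Rightarrow> nat \<Rightarrow> (nat \<Rightarrow> nat) set \<Rightarrow> (((nat \<Rightarrow> nat) \<Rightarrow> real) set \<Rightarrow> real)
     \<Rightarrow> ((nat \<Rightarrow> nat) \<Rightarrow> real) set topology" where
  "ball_minus_Dressian n d J N =
     (let B = unit_cball (VQ n d J) N
      in subtopology (VQ_top n d J) (B - (Dressian n d J \<inter> (VQ_top n d J frontier_of B))))"

subsection \<open>Manifolds with boundary and compactifications\<close>

text \<open>In dimension \<open>0\<close> the condition \<open>0 \<le> x 0\<close> is vacuous and the half-space is a point.\<close>

definition half_space :: "nat \<Rightarrow> (nat \<Rightarrow> real) topology" where
  "half_space m = subtopology (Euclidean_space m) {x. 0 \<le> x 0}"

definition manifold_with_boundary :: "nat \<Rightarrow> 'a topology \<Rightarrow> bool" where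
  "manifold_with_boundary m X \<longleftrightarrow>
     Hausdorff_space X \<and> second_countable X \<and>
     (\<forall>x\<in>topspace X. \<exists>U W. openin X U \<and> x \<in> U \<and> openin (half_space m) W \<and>
        subtopology X U homeomorphic_space subtopology (half_space m) W)"

definition Euclidean_cball :: "nat \<Rightarrow> (nat \<Rightarrow> real) topology" where
  "Euclidean_cball m = subtopology (Euclidean_space m) {x. (\<Sum>i<m. (x i)\<^sup>2) \<le> 1}"

definition compactification :: "'a topology \<Rightarrow> 'b topology \<Rightarrow> ('a \<Rightarrow> 'b) \<Rightarrow> bool" where
  "compactification X K f \<longleftrightarrow>
     compact_space K \<and> embedding_map X K f \<and> K closure_of (f ` topspace X) = topspace K"

end

theory Submission
  imports Defs
begin

text \<open>In logarithmic coordinates, a representation over \<open>T\<^sub>q\<close> becomes one over \<open>T\<^bsub>t q\<^esub>\<close> under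
  multiplication by \<open>t\<close>. Since \<open>q\<close>-nullity gets weaker as \<open>q\<close> grows, and strictly so for lists with
  at least three nonzero entries, the set \<open>C\<close> of logarithmic representations is star-shaped about \<open>0\<close>
  in \<open>V\<^sub>J / \<real>1\<close>, and \<open>t C\<close> lies in the interior of \<open>C\<close> for \<open>t < 1\<close>. Hence its gauge \<open>g\<close> is continuous,
  \<open>C = {g \<le> 1}\<close>, and \<open>g\<close> vanishes exactly on the limit case \<open>q = 0\<close>, the Dressian. For any norm \<open>N\<close>,
  the map \<open>v \<mapsto> v / (1 + N v - g v)\<close> is a homeomorphism from \<open>{g \<le> 1}\<close> onto the unit ball of \<open>N\<close>
  without the points where \<open>N = 1\<close> and \<open>g = 0\<close>. The weak Grassmannian has the same ambient space and
  the same zero set of the gauge because weak and strong representations agree for \<open>q = 0\<close>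
  (local exchange implies exchange for valuations) and for \<open>q = \<infinity>\<close>.\<close>

subsection \<open>Exchange properties of M-convex sets\<close>

text \<open>Shrinking is not strict for a relation with exactly two nonzero terms: for every
  \<open>q\<close> it is an equality of logarithms. These equalities are what cuts out V_J, and
  M-convexity excludes relations with a single nonzero term. So interiors are taken inside V_J,
  where only relations with at least three nonzero terms remain. For the weak Grassmannian to live
  in the same V_J, the three-term relations must imply the two-term equalities of every length; this
  is the combinatorial obstacle at \<open>q = \<infinity>\<close>. The denominator
  \<open>1 + N v - g v\<close> stays positive on \<open>{g \<le> 1}\<close>, compresses such rays to
  half-open segments, and leads to the inverse \<open>v / (1 - N v + g v)\<close>; both maps are
  continuous without a case distinction. For the manifold and the compactification the Euclidean
  norm can serve as \<open>N\<close>, whatever norm the first claim speaks of. The removed points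
  then lie on the sphere and form a closed set.\<close>

abbreviation \<epsilon> :: "nat \<Rightarrow> nat \<Rightarrow> nat" where "\<epsilon> \<equiv> std_unit"

lemma discrete_simplex_support:
  "x \<in> discrete_simplex n d \<Longrightarrow> x k \<noteq> 0 \<Longrightarrow> k \<in> {1..n}"
  by (rule ccontr) (simp add: discrete_simplex_def)

lemma discrete_simplex_le_imp_eq:
  \<comment> \<open>Equal coordinate sums leave no room for a strict inequality. This settles the
    base cases of both exchange inductions below.\<close>
  assumes "x \<in> discrete_simplex n d" "y \<in> discrete_simplex n d" "x \<le> y"
  shows "x = y"
proof (rule ccontr)
  assume "x \<noteq> y"
  then obtain k where k: "x k \<noteq> y k" by (auto simp: fun_eq_iff)
  then have "k \<in> {1..n}"
    using assms(1,2) discrete_simplex_support by (metis)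
  moreover have "x k < y k" using k assms(3) by (simp add: le_fun_def less_le)
  ultimately have "(\<Sum>k\<in>{1..n}. x k) < (\<Sum>k\<in>{1..n}. y k)"
    using assms(3) by (intro sum_strict_mono_ex1) (auto simp: le_fun_def)
  then show False using assms by (simp add: discrete_simplex_def)
qed

lemma finite_discrete_simplex: "finite (discrete_simplex n d)"
proof -
  have "discrete_simplex n d \<subseteq> (\<lambda>f k. if k \<in> {1..n} then f k else 0) ` ({1..n} \<rightarrow>\<^sub>E {..d})"
  proof
    fix x assume x: "x \<in> discrete_simplex n d"
    have "x k \<le> d" if "k \<in> {1..n}" for k
      using x member_le_sum[of k "{1..n}" x] that by (auto simp: discrete_simplex_def)
    then have "restrict x {1..n} \<in> {1..n} \<rightarrow>\<^sub>E {..d}" by auto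
    moreover have "x = (\<lambda>k. if k \<in> {1..n} then restrict x {1..n} k else 0)"
      using x by (auto simp: discrete_simplex_def fun_eq_iff)
    ultimately show "x \<in> (\<lambda>f k. if k \<in> {1..n} then f k else 0) ` ({1..n} \<rightarrow>\<^sub>E {..d})"
      by (intro image_eqI)
  qed
  then show ?thesis
    by (rule finite_subset) (intro finite_imageI finite_PiE; simp)
qed

lemma finite_has_max:
  fixes f :: "'a \<Rightarrow> real"
  assumes "finite S" "S \<noteq> {}"
  obtains m where "m \<in> S" "\<And>x. x \<in> S \<Longrightarrow> f x \<le> f m"
proof -
  have "Max (f ` S) \<in> f ` S" using assms by simp
  then obtain m where "m \<in> S" "f m = Max (f ` S)" by auto
  then show ?thesis using that[of m] assms by simp
qed

locale M_convex_set =
  fixes n d :: nat and J :: "(nat \<Rightarrow> nat) set"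
  assumes subset: "J \<subseteq> discrete_simplex n d"
    and convex: "M_convex n J"
begin

lemma exchange:
  assumes "x \<in> J" "y \<in> J" "x i < y i"
  obtains j where "y j < x j" "x + \<epsilon> i - \<epsilon> j \<in> J" "y - \<epsilon> i + \<epsilon> j \<in> J"
proof -
  have "i \<in> {1..n}" using assms subset discrete_simplex_support by (metis less_nat_zero_code subsetD)
  then show ?thesis using convex assms that unfolding M_convex_def by blast
qed

lemma finite_J: "finite J"
  using finite_discrete_simplex subset by (rule finite_subset[rotated])

lemma delta_bounds:
  assumes "x \<in> J" shows "delta_min J \<le> x" "x \<le> delta_max J"
  using assms finite_J by (auto simp: le_fun_def delta_min_def delta_max_def)

text \<open>Murota's argument that the local exchange property of a valuation implies the global one:
  for a pair \<open>x, y\<close> at minimal distance violating the exchange property at \<open>u\<close>, the potential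
  \<open>p\<close> makes every exchange at \<open>y\<close> strictly decrease \<open>r\<close> while leaving \<open>r\<close> unchanged at \<open>x\<close>;
  replacing \<open>y\<close> by a best exchange \<open>y + \<epsilon> u\<^sub>0 - \<epsilon> v\<^sub>0\<close> gives a violating pair at smaller distance.\<close>

lemma valuated_exchange:
  fixes r :: "(nat \<Rightarrow> nat) \<Rightarrow> real"
  assumes loc: "\<And>t a b c e. \<lbrakk>delta_min J \<le> t; t + \<epsilon> a + \<epsilon> b + \<epsilon> c + \<epsilon> e \<le> delta_max J;
        t + \<epsilon> a + \<epsilon> b \<in> J; t + \<epsilon> c + \<epsilon> e \<in> J\<rbrakk> \<Longrightarrow>
        t + \<epsilon> a + \<epsilon> c \<in> J \<and> t + \<epsilon> b + \<epsilon> e \<in> J \<and>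
          r (t + \<epsilon> a + \<epsilon> b) + r (t + \<epsilon> c + \<epsilon> e) \<le> r (t + \<epsilon> a + \<epsilon> c) + r (t + \<epsilon> b + \<epsilon> e) \<or>
        t + \<epsilon> a + \<epsilon> e \<in> J \<and> t + \<epsilon> b + \<epsilon> c \<in> J \<and>
          r (t + \<epsilon> a + \<epsilon> b) + r (t + \<epsilon> c + \<epsilon> e) \<le> r (t + \<epsilon> a + \<epsilon> e) + r (t + \<epsilon> b + \<epsilon> c)"
    and "x \<in> J" "y \<in> J" "y u < x u"
  shows "\<exists>v. x v < y v \<and> x - \<epsilon> u + \<epsilon> v \<in> J \<and> y + \<epsilon> u - \<epsilon> v \<in> J \<and>
           r x + r y \<le> r (x - \<epsilon> u + \<epsilon> v) + r (y + \<epsilon> u - \<epsilon> v)"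
  using assms(2-4)
proof (induction "\<Sum>k\<in>{1..n}. x k - y k" arbitrary: y rule: less_induct)
  \<comment> \<open>Subtraction on \<open>nat\<close> truncates, so the induction measure sums the
    positive parts of \<open>x - y\<close>; as both have degree \<open>d\<close>, this is half their
    l1 distance.\<close>
  case less
  note xJ = less.prems(1) and yJ = less.prems(2) and u = less.prems(3)
  show ?case
  proof (cases "\<exists>u\<^sub>0. y u\<^sub>0 < x u\<^sub>0 \<and> (u\<^sub>0 = u \<longrightarrow> y u + 2 \<le> x u)")
    \<comment> \<open>Here \<open>x\<close> exceeds \<open>y\<close> only at \<open>u\<close>, and
      by one unit. After the exchange it lies below \<open>y\<close>, hence equals \<open>y\<close>,
      and the exchange just swaps the two elements.\<close>
    case False
    obtain v where v: "x v < y v" "y + \<epsilon> u - \<epsilon> v \<in> J" "x - \<epsilon> u + \<epsilon> v \<in> J"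
      by (rule exchange[OF yJ xJ u])
    have "x - \<epsilon> u + \<epsilon> v \<le> y"
      proof (rule le_funI)
      fix k
      have "k = u \<and> x k < y k + 2" if "y k < x k"
        using False that by (metis not_le)
      then show "(x - \<epsilon> u + \<epsilon> v) k \<le> y k"
        using v(1) by (cases "y k < x k") (auto simp: std_unit_def)
    qed
    then have eq: "x - \<epsilon> u + \<epsilon> v = y"
      using discrete_simplex_le_imp_eq v(3) yJ subset by blast
    moreover have "y + \<epsilon> u - \<epsilon> v = x"
      unfolding eq[symmetric] using u by (auto simp: fun_eq_iff std_unit_def)
    ultimately show ?thesis using v by auto
  next
    case True
    then obtain u\<^sub>0 where u0: "y u\<^sub>0 < x u\<^sub>0" "u\<^sub>0 = u \<Longrightarrow> y u + 2 \<le> x u" by blast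
    show ?thesis
    proof (rule ccontr)
      assume "\<not> ?thesis"
      then have viol: "r (x - \<epsilon> u + \<epsilon> v) + r (y + \<epsilon> u - \<epsilon> v) < r x + r y"
        if "x v < y v" "x - \<epsilon> u + \<epsilon> v \<in> J" "y + \<epsilon> u - \<epsilon> v \<in> J" for v
        using that by (meson not_less)
      \<comment> \<open>The first branch makes \<open>r + p\<close> indifferent between
        \<open>x\<close> and its exchanges at \<open>u\<close>. In the second branch no such
        condition arises, and the summand 1 is a positive margin that forces the strict decrease at
        \<open>y\<close>.\<close>
      define p where "p v = (if x - \<epsilon> u + \<epsilon> v \<in> J then r x - r (x - \<epsilon> u + \<epsilon> v)
                             else r (y + \<epsilon> u - \<epsilon> v) - r y + 1)" for v
      have decr: "r (y + \<epsilon> u - \<epsilon> v) - p v < r y" if "x v < y v" "y + \<epsilon> u - \<epsilon> v \<in> J" for v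
        using viol[of v] that by (auto simp: p_def)
      define S where "S = {v. x v < y v \<and> y + \<epsilon> u\<^sub>0 - \<epsilon> v \<in> J}"
      have "S \<subseteq> {1..n}"
        using yJ subset discrete_simplex_support[of y n d]
        by (force simp: S_def simp del: atLeastAtMost_iff)
      then have "finite S" by (rule finite_subset) simp
      moreover have "S \<noteq> {}"
        by (rule exchange[OF yJ xJ u0(1)]) (auto simp: S_def)
      ultimately obtain v\<^sub>0 where v0: "v\<^sub>0 \<in> S"
        and best: "\<And>v. v \<in> S \<Longrightarrow> r (y + \<epsilon> u\<^sub>0 - \<epsilon> v) - p v \<le> r (y + \<epsilon> u\<^sub>0 - \<epsilon> v\<^sub>0) - p v\<^sub>0"
        using finite_has_max[of S "\<lambda>v. r (y + \<epsilon> u\<^sub>0 - \<epsilon> v) - p v"] by metis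
      define y0 where "y0 = y + \<epsilon> u\<^sub>0 - \<epsilon> v\<^sub>0"
      have v0': "x v\<^sub>0 < y v\<^sub>0" "y0 \<in> J" using v0 by (auto simp: S_def y0_def)
      have ne: "u\<^sub>0 \<noteq> v\<^sub>0" "u \<noteq> v\<^sub>0" using v0' u0 u by auto
      have y0_k: "y0 k = (if k = u\<^sub>0 then y k + 1 else if k = v\<^sub>0 then y k - 1 else y k)" for k
        using ne by (auto simp: y0_def std_unit_def)
      have "u\<^sub>0 \<in> {1..n}" using xJ u0 subset discrete_simplex_support[of x n d u\<^sub>0] by auto
      have "(\<Sum>k\<in>{1..n}. x k - y0 k) < (\<Sum>k\<in>{1..n}. x k - y k)"
      proof (rule sum_strict_mono_ex1)
        show "\<forall>k\<in>{1..n}. x k - y0 k \<le> x k - y k" using v0'(1) by (auto simp: y0_k)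
        show "\<exists>k\<in>{1..n}. x k - y0 k < x k - y k"
          using u0(1) \<open>u\<^sub>0 \<in> {1..n}\<close> by (intro bexI[of _ u\<^sub>0]) (auto simp: y0_k)
      qed simp
      moreover have "y0 u < x u" using u u0 ne by (auto simp: y0_k)
      ultimately obtain v where v: "x v < y0 v" "x - \<epsilon> u + \<epsilon> v \<in> J" "y0 + \<epsilon> u - \<epsilon> v \<in> J"
          "r x + r y0 \<le> r (x - \<epsilon> u + \<epsilon> v) + r (y0 + \<epsilon> u - \<epsilon> v)"
        using less.hyps[of y0] xJ v0'(2) by (elim meta_impE exE conjE) (simp only:)+
      have vy: "x v < y v" "v = v\<^sub>0 \<Longrightarrow> x v + 2 \<le> y v" using v(1) u0(1) by (auto simp: y0_k split: if_splits)
      have ne': "u\<^sub>0 \<noteq> v" "u \<noteq> v" using vy u0 u by auto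
      have ineq: "r y0 + p v \<le> r (y0 + \<epsilon> u - \<epsilon> v)" using v by (simp add: p_def)
      \<comment> \<open>\<open>y\<close> and \<open>y0 + \<epsilon> u - \<epsilon> v\<close> share
        the part \<open>t\<close> of degree \<open>d - 2\<close> and carry the pairs
        \<open>v\<^sub>0, v\<close> and \<open>u\<^sub>0, u\<close>; so \<open>loc\<close> compares
        them with the two other ways to pair these four indices.\<close>
      define t where "t = y - \<epsilon> v\<^sub>0 - \<epsilon> v"
      have t: "t + \<epsilon> v\<^sub>0 + \<epsilon> v = y" "t + \<epsilon> u\<^sub>0 + \<epsilon> u = y0 + \<epsilon> u - \<epsilon> v" "t + \<epsilon> v\<^sub>0 + \<epsilon> u\<^sub>0 = y + \<epsilon> u\<^sub>0 - \<epsilon> v"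
        "t + \<epsilon> v + \<epsilon> u = y + \<epsilon> u - \<epsilon> v\<^sub>0" "t + \<epsilon> v\<^sub>0 + \<epsilon> u = y + \<epsilon> u - \<epsilon> v" "t + \<epsilon> v + \<epsilon> u\<^sub>0 = y0"
        using vy v0'(1) ne ne' by (simp_all add: t_def fun_eq_iff std_unit_def y0_k) (auto simp: Suc_diff_Suc)

      have lo: "delta_min J \<le> t"
      proof (rule le_funI)
        fix k
        have "delta_min J k \<le> (t + \<epsilon> v\<^sub>0 + \<epsilon> v) k" "delta_min J k \<le> (t + \<epsilon> u\<^sub>0 + \<epsilon> u) k"
          using delta_bounds(1)[OF yJ] delta_bounds(1)[OF v(3)] unfolding t by (auto simp: le_fun_def)
        then show "delta_min J k \<le> t k" using ne ne' by (auto simp: std_unit_def split: if_splits)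
      qed
      have hi: "t + \<epsilon> v\<^sub>0 + \<epsilon> v + \<epsilon> u\<^sub>0 + \<epsilon> u \<le> delta_max J"
      proof (rule le_funI)
        fix k
        have "(t + \<epsilon> v\<^sub>0 + \<epsilon> v) k \<le> delta_max J k" "(t + \<epsilon> u\<^sub>0 + \<epsilon> u) k \<le> delta_max J k"
          using delta_bounds(2)[OF yJ] delta_bounds(2)[OF v(3)] unfolding t by (auto simp: le_fun_def)
        then show "(t + \<epsilon> v\<^sub>0 + \<epsilon> v + \<epsilon> u\<^sub>0 + \<epsilon> u) k \<le> delta_max J k"
          using ne ne' by (auto simp: std_unit_def split: if_splits)
      qed
      consider "y + \<epsilon> u\<^sub>0 - \<epsilon> v \<in> J" "y + \<epsilon> u - \<epsilon> v\<^sub>0 \<in> J"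
          "r y + r (y0 + \<epsilon> u - \<epsilon> v) \<le> r (y + \<epsilon> u\<^sub>0 - \<epsilon> v) + r (y + \<epsilon> u - \<epsilon> v\<^sub>0)"
        | "y + \<epsilon> u - \<epsilon> v \<in> J" "r y + r (y0 + \<epsilon> u - \<epsilon> v) \<le> r (y + \<epsilon> u - \<epsilon> v) + r y0"
        using loc[OF lo hi, unfolded t, OF yJ v(3)] by (elim disjE conjE)
      then show False
      proof cases
        \<comment> \<open>\<open>best\<close> bounds the exchange of \<open>v\<close> against
          \<open>u\<^sub>0\<close>, and \<open>decr\<close> that of \<open>v\<^sub>0\<close> against
          \<open>u\<close>; in the sum \<open>p v\<^sub>0\<close> cancels, which contradicts
          \<open>ineq\<close>.\<close>
        case 1
        then show False
          using best[of v] decr[of v\<^sub>0] v0'(1) vy(1) ineq by (simp add: S_def y0_def)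
      next
        case 2
        then show False using decr[of v] vy(1) ineq by simp
      qed
    qed
  qed
qed


text \<open>A Pluecker relation with exactly two nonvanishing terms, at \<open>i\<close> and \<open>j\<close>, follows from
  three-term relations: for any further \<open>x\<close> in \<open>\<iota>\<close>, one of the two families of exchanges at \<open>x\<close>
  vanishes, and exchanging \<open>x\<close> against an element of \<open>\<kappa>\<close> in \<open>\<alpha> + \<iota>\<close> or in \<open>\<alpha> + \<kappa>\<close> preserves the
  hypotheses and shortens the relation. This replaces the orthogonality of a circuit and a cocircuit
  meeting in two elements.\<close>

lemma two_term_relation:
  fixes r :: "(nat \<Rightarrow> nat) \<Rightarrow> real"
  assumes loc: "\<And>t a b c e. \<lbrakk>delta_min J \<le> t; t + \<epsilon> a + \<epsilon> b + \<epsilon> c + \<epsilon> e \<le> delta_max J;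
        t + \<epsilon> a + \<epsilon> b \<in> J; t + \<epsilon> c + \<epsilon> e \<in> J; t + \<epsilon> a + \<epsilon> c \<in> J; t + \<epsilon> b + \<epsilon> e \<in> J;
        \<not> (t + \<epsilon> a + \<epsilon> e \<in> J \<and> t + \<epsilon> b + \<epsilon> c \<in> J)\<rbrakk> \<Longrightarrow>
        r (t + \<epsilon> a + \<epsilon> b) + r (t + \<epsilon> c + \<epsilon> e) = r (t + \<epsilon> a + \<epsilon> c) + r (t + \<epsilon> b + \<epsilon> e)"
    and "delta_min J \<le> \<alpha>" "\<alpha> + \<iota> + \<kappa> \<le> delta_max J" "\<iota> i = 1" "\<iota> j = 1" "i \<noteq> j"
      "\<alpha> + \<iota> - \<epsilon> i \<in> J" "\<alpha> + \<kappa> + \<epsilon> i \<in> J" "\<alpha> + \<iota> - \<epsilon> j \<in> J" "\<alpha> + \<kappa> + \<epsilon> j \<in> J"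
      "\<And>x. \<lbrakk>x \<noteq> i; x \<noteq> j; \<iota> x > 0\<rbrakk> \<Longrightarrow> \<not> (\<alpha> + \<iota> - \<epsilon> x \<in> J \<and> \<alpha> + \<kappa> + \<epsilon> x \<in> J)"
  shows "r (\<alpha> + \<iota> - \<epsilon> i) + r (\<alpha> + \<kappa> + \<epsilon> i) = r (\<alpha> + \<iota> - \<epsilon> j) + r (\<alpha> + \<kappa> + \<epsilon> j)"
  using assms(2-)
proof (induction "\<Sum>k\<in>{1..n}. \<iota> k" arbitrary: \<alpha> \<iota> \<kappa> rule: less_induct)
  case less
  note lo = less.prems(1) and hi = less.prems(2) and ii = less.prems(3) and ij = less.prems(4)
    and ne = less.prems(5) and J1 = less.prems(6) and J2 = less.prems(7) and J3 = less.prems(8)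
    and J4 = less.prems(9) and two = less.prems(10)
  \<comment> \<open>\<open>A\<close> has degree \<open>d + 1\<close> and \<open>B\<close> has degree
    \<open>d - 1\<close>: a term removes an index from \<open>A\<close> and adds it to
    \<open>B\<close>.\<close>
  define A where "A = \<alpha> + \<iota>"
  define B where "B = \<alpha> + \<kappa>"
  note AB = J1[folded A_def] J2[folded B_def] J3[folded A_def] J4[folded B_def]
  have Aij: "A i > 0" "A j > 0" using ii ij by (simp_all add: A_def)
  show ?case
  proof (cases "\<exists>x. x \<noteq> i \<and> x \<noteq> j \<and> \<iota> x > 0")
    \<comment> \<open>With only \<open>i\<close> and \<open>j\<close> left in
      \<open>\<iota>\<close>, comparing degrees forces \<open>\<kappa> = 0\<close>; both sides are
      then the same sum with its summands swapped.\<close>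
    case False
    then have \<iota>: "\<iota> = \<epsilon> i + \<epsilon> j" using ii ij ne by (auto simp: fun_eq_iff std_unit_def)
    have 1: "\<alpha> + \<iota> - \<epsilon> i = \<alpha> + \<epsilon> j" "\<alpha> + \<iota> - \<epsilon> j = \<alpha> + \<epsilon> i"
      unfolding \<iota> by (auto simp: fun_eq_iff)
    have "\<alpha> + \<epsilon> i \<le> \<alpha> + \<kappa> + \<epsilon> i" "\<alpha> + \<epsilon> j \<le> \<alpha> + \<kappa> + \<epsilon> j" by (simp_all add: le_fun_def)
    then have "\<alpha> + \<epsilon> i = \<alpha> + \<kappa> + \<epsilon> i" "\<alpha> + \<epsilon> j = \<alpha> + \<kappa> + \<epsilon> j"
      using discrete_simplex_le_imp_eq J1 J2 J3 J4 subset unfolding 1 by blast+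
    then show ?thesis unfolding 1 by simp
  next
    case True
    then obtain x where x: "x \<noteq> i" "x \<noteq> j" "\<iota> x > 0" by blast
    have Ax: "A x > 0" using x by (simp add: A_def)
    define \<iota>' where "\<iota>' = \<iota> - \<epsilon> x"
    have "(\<alpha> + \<iota> - \<epsilon> i) x \<noteq> 0" using x by (simp add: std_unit_def)
    then have "x \<in> {1..n}" using J1 subset discrete_simplex_support by blast
    have smaller: "(\<Sum>k\<in>{1..n}. \<iota>' k) < (\<Sum>k\<in>{1..n}. \<iota> k)"
    proof (rule sum_strict_mono_ex1)
      show "\<exists>k\<in>{1..n}. \<iota>' k < \<iota> k"
        using \<open>x \<in> {1..n}\<close> x by (intro bexI[of _ x]) (auto simp: \<iota>'_def std_unit_def)
    qed (auto simp: \<iota>'_def)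
    have \<iota>': "\<iota>' i = 1" "\<iota>' j = 1" "\<And>y. \<iota>' y > 0 \<Longrightarrow> \<iota> y > 0"
      using x ii ij by (auto simp: \<iota>'_def std_unit_def)
    \<comment> \<open>The element that moves to \<open>\<alpha>\<close> comes from \<open>\<kappa>\<close> if \<open>A\<close> changes and is \<open>x\<close> if \<open>B\<close> changes.\<close>
    have IH: "r (A' - \<epsilon> i) + r (B' + \<epsilon> i) = r (A' - \<epsilon> j) + r (B' + \<epsilon> j)"
      if "b = c \<or> b = x" "\<kappa> c > 0" "A' = \<alpha> + \<epsilon> b + \<iota>'" "B' = \<alpha> + \<epsilon> b + (\<kappa> - \<epsilon> c)"
        "A' - \<epsilon> i \<in> J" "B' + \<epsilon> i \<in> J" "A' - \<epsilon> j \<in> J" "B' + \<epsilon> j \<in> J"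
        "\<And>y. \<lbrakk>y \<noteq> i; y \<noteq> j; \<iota> y > 0\<rbrakk> \<Longrightarrow> \<not> (A' - \<epsilon> y \<in> J \<and> B' + \<epsilon> y \<in> J)" for A' B' b c
    proof -
      have "delta_min J \<le> \<alpha> + \<epsilon> b" using lo by (auto simp: le_fun_def intro: trans_le_add1)
      moreover have "\<alpha> + \<epsilon> b + \<iota>' + (\<kappa> - \<epsilon> c) \<le> delta_max J"
      proof (rule le_funI)
        fix k show "(\<alpha> + \<epsilon> b + \<iota>' + (\<kappa> - \<epsilon> c)) k \<le> delta_max J k"
          using le_funD[OF hi, of k] that(1,2) x(3)
          by (auto simp: \<iota>'_def std_unit_def split: if_splits)
      qed
      ultimately show ?thesis
        using less.hyps[OF smaller, of "\<alpha> + \<epsilon> b" "\<kappa> - \<epsilon> c"] \<iota>' ne that(5-9) unfolding that(3,4) by blast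
    qed
    \<comment> \<open>If \<open>\<kappa>\<close> also contains \<open>x\<close>, then
      \<open>x\<close> simply moves to \<open>\<alpha>\<close>. Otherwise one of the two families
      vanishes at \<open>x\<close>: if it is the one at \<open>B\<close>, then \<open>B\<close>
      gains \<open>x\<close> in place of some \<open>b\<close>; if it is the one at
      \<open>A\<close>, then \<open>A\<close> loses \<open>x\<close> in favour of some
      \<open>b\<close>. In both cases \<open>b\<close> comes from \<open>\<kappa>\<close>.\<close>
    consider "\<kappa> x > 0" | "\<kappa> x = 0" "A - \<epsilon> x \<in> J" | "\<kappa> x = 0" "A - \<epsilon> x \<notin> J" by blast
    then show ?thesis
    proof cases
      case 1
      have eqs: "A = \<alpha> + \<epsilon> x + \<iota>'" "B = \<alpha> + \<epsilon> x + (\<kappa> - \<epsilon> x)"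
        using 1 x(3) by (auto simp: A_def B_def \<iota>'_def fun_eq_iff std_unit_def)
      show ?thesis
        using IH[OF disjI2[OF refl] 1 eqs AB] two unfolding A_def B_def by blast
    next
      case 2
      then have Bx: "B + \<epsilon> x \<notin> J" using two[OF x] by (auto simp: A_def B_def)
      have "(B + \<epsilon> i) x < (A - \<epsilon> i) x" using x 2 by (simp add: A_def B_def std_unit_def)
      then obtain b where b: "(A - \<epsilon> i) b < (B + \<epsilon> i) b" "B + \<epsilon> i + \<epsilon> x - \<epsilon> b \<in> J"
        by (rule exchange[OF AB(2,1)])
      have "B + \<epsilon> i + \<epsilon> x - \<epsilon> i = B + \<epsilon> x" by (auto simp: fun_eq_iff)
      then have "b \<noteq> i" using b(2) Bx by metis
      then have \<kappa>b: "\<kappa> b > 0" using b(1) by (simp add: A_def B_def std_unit_def)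
      have "b \<noteq> x" using \<kappa>b 2 by auto
      have Bb: "B b > 0" using \<kappa>b by (simp add: B_def)
      define B' where "B' = B + \<epsilon> x - \<epsilon> b"
      have B'_k: "B' k = (if k = x then B k + 1 else if k = b then B k - 1 else B k)" for k
        using \<open>b \<noteq> x\<close> by (auto simp: B'_def std_unit_def)
      have "B' + \<epsilon> i = B + \<epsilon> i + \<epsilon> x - \<epsilon> b"
        using Bb by (auto simp: fun_eq_iff B'_k std_unit_def \<open>b \<noteq> x\<close>)
      then have B'i: "B' + \<epsilon> i \<in> J" using b(2) by metis
      have B'j: "B' + \<epsilon> j \<in> J"
      proof -
        \<comment> \<open>\<open>B' + \<epsilon> i\<close> can exceed
          \<open>B + \<epsilon> j\<close> only at \<open>x\<close> and \<open>i\<close>, and an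
          exchange against \<open>x\<close> would put \<open>B + \<epsilon> x\<close> into
          \<open>J\<close>.\<close>
        have "(B' + \<epsilon> i) j < (B + \<epsilon> j) j" using x ne by (simp add: B'_k std_unit_def less_Suc_eq_le)
        then obtain y where y: "(B + \<epsilon> j) y < (B' + \<epsilon> i) y" "B' + \<epsilon> i + \<epsilon> j - \<epsilon> y \<in> J"
          "B + \<epsilon> j - \<epsilon> j + \<epsilon> y \<in> J"
          by (rule exchange[OF B'i AB(4)])
        have "B + \<epsilon> j - \<epsilon> j + \<epsilon> x = B + \<epsilon> x" by (auto simp: fun_eq_iff)
        then have "y \<noteq> x" using y(3) Bx by metis
        then have "y = i" using y(1) by (auto simp: B'_k std_unit_def split: if_splits)
        moreover have "B' + \<epsilon> i + \<epsilon> j - \<epsilon> i = B' + \<epsilon> j" by (auto simp: fun_eq_iff)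
        ultimately show ?thesis using y(2) by metis
      qed
      have two': "\<not> (A - \<epsilon> y \<in> J \<and> B' + \<epsilon> y \<in> J)" if y: "y \<noteq> i" "y \<noteq> j" "\<iota> y > 0" for y
      proof
        \<comment> \<open>Exchanging \<open>B' + \<epsilon> y\<close> against
          \<open>B + \<epsilon> i\<close> at \<open>i\<close> would return
          \<open>B + \<epsilon> x\<close> or \<open>B + \<epsilon> y\<close>, and neither lies in
          \<open>J\<close>; so no index becomes newly active.\<close>
        assume *: "A - \<epsilon> y \<in> J \<and> B' + \<epsilon> y \<in> J"
        then have By: "B + \<epsilon> y \<notin> J" using two[OF y] by (auto simp: A_def B_def)
        have "(B' + \<epsilon> y) i < (B + \<epsilon> i) i" using x y by (simp add: B'_k std_unit_def less_Suc_eq_le)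
        then obtain z where z: "(B + \<epsilon> i) z < (B' + \<epsilon> y) z" "B + \<epsilon> i - \<epsilon> i + \<epsilon> z \<in> J"
          by (rule exchange[OF conjunct2[OF *] AB(2)])
        have "z = x \<or> z = y" using z(1) by (auto simp: B'_k std_unit_def split: if_splits)
        moreover have "B + \<epsilon> i - \<epsilon> i + \<epsilon> z = B + \<epsilon> z" by (auto simp: fun_eq_iff)
        ultimately show False using z(2) Bx By by metis
      qed
      have eqs: "A = \<alpha> + \<epsilon> x + \<iota>'" "B' = \<alpha> + \<epsilon> x + (\<kappa> - \<epsilon> b)"
        using \<kappa>b x(3) 2 by (auto simp: A_def B'_def B_def \<iota>'_def fun_eq_iff std_unit_def)
      have short: "r (A - \<epsilon> i) + r (B' + \<epsilon> i) = r (A - \<epsilon> j) + r (B' + \<epsilon> j)"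
        using IH[OF disjI2[OF refl] \<kappa>b eqs AB(1) B'i AB(3) B'j two'] .
      \<comment> \<open>The pairs from \<open>b, i, j, x\<close> over \<open>t\<close> form a
        three-term relation whose term containing \<open>B + \<epsilon> x\<close> vanishes. The
        equality of its other two terms turns the shortened relation for \<open>B'\<close> into the
        one for \<open>B\<close>.\<close>
      define t where "t = B - \<epsilon> b"
      have t: "t + \<epsilon> b + \<epsilon> i = B + \<epsilon> i" "t + \<epsilon> j + \<epsilon> x = B' + \<epsilon> j" "t + \<epsilon> b + \<epsilon> j = B + \<epsilon> j"
        "t + \<epsilon> i + \<epsilon> x = B' + \<epsilon> i" "t + \<epsilon> b + \<epsilon> x = B + \<epsilon> x"
        using Bb \<open>b \<noteq> x\<close> by (auto simp: t_def fun_eq_iff B'_k std_unit_def)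
      have lo': "delta_min J \<le> t"
      proof (rule le_funI)
        fix k show "delta_min J k \<le> t k"
          using le_funD[OF lo, of k] \<kappa>b by (auto simp: t_def B_def std_unit_def)
      qed
      have hi': "t + \<epsilon> b + \<epsilon> i + \<epsilon> j + \<epsilon> x \<le> delta_max J"
      proof (rule le_funI)
        fix k show "(t + \<epsilon> b + \<epsilon> i + \<epsilon> j + \<epsilon> x) k \<le> delta_max J k"
          using le_funD[OF hi, of k] x ii ij ne unfolding t(1)
          by (auto simp: B_def std_unit_def)
      qed
      have "r (B + \<epsilon> i) + r (B' + \<epsilon> j) = r (B + \<epsilon> j) + r (B' + \<epsilon> i)"
        using loc[OF lo' hi'] AB B'i B'j Bx unfolding t by blast
      then show ?thesis using short unfolding A_def B_def by simp
    next
      case 3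
      have "(B + \<epsilon> j) x < (A - \<epsilon> i) x" using x 3 by (simp add: A_def B_def std_unit_def)
      then obtain b where b: "(A - \<epsilon> i) b < (B + \<epsilon> j) b" "A - \<epsilon> i - \<epsilon> x + \<epsilon> b \<in> J"
        by (rule exchange[OF AB(4,1)])
      have \<kappa>b: "\<kappa> b > 0"
        using b(1) ii ij ne by (auto simp: A_def B_def std_unit_def split: if_splits)
      have "b \<noteq> x" using \<kappa>b 3 by auto
      define A' where "A' = A - \<epsilon> x + \<epsilon> b"
      have A'_k: "A' k = (if k = x then A k - 1 else if k = b then A k + 1 else A k)" for k
        using \<open>b \<noteq> x\<close> by (auto simp: A'_def std_unit_def)
      have "A' - \<epsilon> i = A - \<epsilon> i - \<epsilon> x + \<epsilon> b"
        using Aij Ax x \<open>b \<noteq> x\<close> by (auto simp: fun_eq_iff A'_k std_unit_def)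
      then have A'i: "A' - \<epsilon> i \<in> J" using b(2) by metis
      have A'j: "A' - \<epsilon> j \<in> J"
      proof -
        have "(A - \<epsilon> j) j < (A' - \<epsilon> i) j" using x ne Aij by (simp add: A'_k std_unit_def less_Suc_eq_le)
        then obtain y where y: "(A' - \<epsilon> i) y < (A - \<epsilon> j) y" "A - \<epsilon> j + \<epsilon> j - \<epsilon> y \<in> J"
          "A' - \<epsilon> i - \<epsilon> j + \<epsilon> y \<in> J"
          by (rule exchange[OF AB(3) A'i])
        have "A - \<epsilon> j + \<epsilon> j - \<epsilon> x = A - \<epsilon> x" using Aij by (auto simp: fun_eq_iff std_unit_def)
        then have "y \<noteq> x" using y(2) 3 by metis
        then have "y = i" using y(1) by (auto simp: A'_k std_unit_def split: if_splits)
        moreover have "A' - \<epsilon> i - \<epsilon> j + \<epsilon> i = A' - \<epsilon> j"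
          using Aij x ne by (auto simp: fun_eq_iff A'_k std_unit_def)
        ultimately show ?thesis using y(3) by metis
      qed
      have two': "\<not> (A' - \<epsilon> y \<in> J \<and> B + \<epsilon> y \<in> J)" if y: "y \<noteq> i" "y \<noteq> j" "\<iota> y > 0" for y
      proof
        assume *: "A' - \<epsilon> y \<in> J \<and> B + \<epsilon> y \<in> J"
        then have Ay: "A - \<epsilon> y \<notin> J" using two[OF y] by (auto simp: A_def B_def)
        have "(A - \<epsilon> i) i < (A' - \<epsilon> y) i" using x y Aij by (simp add: A'_k std_unit_def less_Suc_eq_le)
        then obtain z where z: "(A' - \<epsilon> y) z < (A - \<epsilon> i) z" "A - \<epsilon> i + \<epsilon> i - \<epsilon> z \<in> J"
          by (rule exchange[OF AB(1) conjunct1[OF *]])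
        have "z = x \<or> z = y" using z(1) by (auto simp: A'_k std_unit_def split: if_splits)
        moreover have "A - \<epsilon> i + \<epsilon> i - \<epsilon> z = A - \<epsilon> z"
          using Aij by (auto simp: fun_eq_iff std_unit_def)
        ultimately show False using z(2) 3 Ay by metis
      qed
      have eqs: "A' = \<alpha> + \<epsilon> b + \<iota>'" "B = \<alpha> + \<epsilon> b + (\<kappa> - \<epsilon> b)"
        using \<kappa>b x(3) by (auto simp: A'_def A_def B_def \<iota>'_def fun_eq_iff std_unit_def)
      have short: "r (A' - \<epsilon> i) + r (B + \<epsilon> i) = r (A' - \<epsilon> j) + r (B + \<epsilon> j)"
        using IH[OF disjI1[OF refl] \<kappa>b eqs A'i AB(2) A'j AB(4) two'] .
      \<comment> \<open>Dually to the previous case, the pair \<open>i, j\<close> over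
        \<open>t\<close> yields \<open>A - \<epsilon> x\<close>, which is not in \<open>J\<close>;
        again two terms remain and must agree.\<close>
      define t where "t = A - \<epsilon> i - \<epsilon> j - \<epsilon> x"
      have t_k: "t k = (if k \<in> {i, j, x} then A k - 1 else A k)" for k
        using ne x by (auto simp: t_def std_unit_def)
      have t: "t + \<epsilon> x + \<epsilon> j = A - \<epsilon> i" "t + \<epsilon> i + \<epsilon> b = A' - \<epsilon> j" "t + \<epsilon> x + \<epsilon> i = A - \<epsilon> j"
        "t + \<epsilon> j + \<epsilon> b = A' - \<epsilon> i" "t + \<epsilon> j + \<epsilon> i = A - \<epsilon> x"
        using Aij Ax ne x \<open>b \<noteq> x\<close> by (auto simp: t_k fun_eq_iff A'_k std_unit_def)
      have lo': "delta_min J \<le> t"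
      proof (rule le_funI)
        fix k show "delta_min J k \<le> t k"
          using le_funD[OF lo, of k] ii ij x(3) by (auto simp: t_k A_def)
      qed
      have hi': "t + \<epsilon> x + \<epsilon> j + \<epsilon> i + \<epsilon> b \<le> delta_max J"
      proof (rule le_funI)
        fix k show "(t + \<epsilon> x + \<epsilon> j + \<epsilon> i + \<epsilon> b) k \<le> delta_max J k"
          using le_funD[OF hi, of k] \<kappa>b Aij unfolding t(1)
          by (auto simp: A_def std_unit_def split: if_splits)
      qed
      have "r (A - \<epsilon> i) + r (A' - \<epsilon> j) = r (A - \<epsilon> j) + r (A' - \<epsilon> i)"
        using loc[OF lo' hi'] AB A'i A'j 3(2) unfolding t by blast
      then show ?thesis using short unfolding A_def B_def by simp
    qed
  qed
qed

end

subsection \<open>Pluecker relations in logarithmic coordinates\<close>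

lemma sum_fun_apply: "(\<Sum>m\<in>S. f m) k = (\<Sum>m\<in>S. f m k :: nat)" for f :: "'a \<Rightarrow> 'b \<Rightarrow> nat"
  by (induction S rule: infinite_finite_induct) auto

lemma discrete_simplex_add:
  "x \<in> discrete_simplex n a \<Longrightarrow> y \<in> discrete_simplex n b \<Longrightarrow> x + y \<in> discrete_simplex n (a + b)"
  by (auto simp: discrete_simplex_def sum.distrib)

lemma std_unit_in_discrete_simplex: "i \<in> {1..n} \<Longrightarrow> \<epsilon> i \<in> discrete_simplex n 1"
  by (auto simp: discrete_simplex_def std_unit_def)

lemma sum_std_unit_in_discrete_simplex:
  assumes "i ` S \<subseteq> {1..n}" "finite S"
  shows "(\<Sum>m\<in>S. \<epsilon> (i m)) \<in> discrete_simplex n (card S)"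
  using assms(2,1)
proof (induction S rule: finite_induct)
  case empty
  then show ?case by (simp add: discrete_simplex_def)
next
  case (insert x F)
  then have "\<epsilon> (i x) \<in> discrete_simplex n 1" by (intro std_unit_in_discrete_simplex) auto
  moreover have "(\<Sum>m\<in>F. \<epsilon> (i m)) \<in> discrete_simplex n (card F)" using insert by simp
  ultimately have "\<epsilon> (i x) + (\<Sum>m\<in>F. \<epsilon> (i m)) \<in> discrete_simplex n (1 + card F)"
    by (rule discrete_simplex_add)
  then show ?case by (simp only: sum.insert[OF insert.hyps] card_insert_disjoint[OF insert.hyps] plus_1_eq_Suc)
qed

text \<open>Attaining the maximum twice means that every nonzero entry has a rival at least as
  large, a condition on one entry at a time. With at most two nonzero entries this is an equality of
  exponents; from three on nothing is required at \<open>\<infinity>\<close>, and this makes V_J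
  linear.\<close>

lemma q_null_extreme_exp:
  assumes K: "K \<subseteq> {..<length b}"
    and b: "\<And>k. k < length b \<Longrightarrow> b ! k = (if k \<in> K then exp (y k) else 0)"
  shows "q_null 0 b \<longleftrightarrow> (\<forall>k\<in>K. \<exists>l\<in>K - {k}. y k \<le> y l)"
    and "q_null \<infinity> b \<longleftrightarrow> (\<forall>k\<in>K. 3 \<le> card K \<or> (\<exists>l\<in>K - {k}. y l = y k))"
proof -
  have K': "{i \<in> {..<length b}. b ! i \<noteq> 0} = K" using K b by (auto split: if_splits)
  have zero: "(\<forall>i\<in>{..<length b}. b ! i = 0) \<longleftrightarrow> K = {}" using K b by (auto split: if_splits)
  have finK: "finite K" using K by (rule finite_subset) simp
  define S where "S = {i \<in> {..<length b}. b ! i = Max (set b)}"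
  have finS: "finite S" by (simp add: S_def)
  have le_Max: "b ! k \<le> Max (set b)" if "k < length b" for k using that by simp
  have SK: "S \<subseteq> K" "\<And>m k. m \<in> S \<Longrightarrow> k \<in> K \<Longrightarrow> y k \<le> y m" if "K \<noteq> {}"
  proof -
    obtain k0 where "k0 \<in> K" using \<open>K \<noteq> {}\<close> by blast
    then have "k0 < length b" "0 < b ! k0" using K b by auto
    then have "0 < Max (set b)" using le_Max[of k0] by linarith
    show sub: "S \<subseteq> K"
    proof
      fix m assume "m \<in> S"
      then show "m \<in> K" using b[of m] \<open>0 < Max (set b)\<close> by (auto simp: S_def split: if_splits)
    qed
    fix m k assume "m \<in> S" "k \<in> K"
    then show "y k \<le> y m"
      using le_Max[of k] b[of k] b[of m] K sub unfolding S_def by (auto split: if_splits)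
  qed
  have max_mem: "\<exists>m. m \<in> S" if "K \<noteq> {}"
  proof -
    have "b \<noteq> []" using that K by auto
    then have "Max (set b) \<in> set b" by simp
    then show ?thesis unfolding S_def by (metis (mono_tags, lifting) in_set_conv_nth lessThan_iff mem_Collect_eq)
  qed
  have mem_S: "l \<in> S" if "m \<in> S" "l \<in> K" "m \<in> K" "y m \<le> y l" for l m
  proof -
    have "l < length b" "m < length b" using that K by auto
    moreover from this have "b ! m \<le> b ! l" using that b[of m] b[of l] by simp
    ultimately have "Max (set b) \<le> b ! l" using that(1) by (simp add: S_def)
    then have "b ! l = Max (set b)" using le_Max[OF \<open>l < length b\<close>] by (rule antisym[rotated])
    then show ?thesis using \<open>l < length b\<close> by (simp add: S_def)
  qed
  have two: "2 \<le> card S \<longleftrightarrow> (\<exists>m\<in>S. \<exists>l\<in>S. m \<noteq> l)"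
  proof
    assume "2 \<le> card S"
    then obtain T where "T \<subseteq> S" "card T = 2" using finS by (metis obtain_subset_with_card_n)
    then show "\<exists>m\<in>S. \<exists>l\<in>S. m \<noteq> l" by (auto simp: card_2_iff)
  next
    assume "\<exists>m\<in>S. \<exists>l\<in>S. m \<noteq> l"
    then obtain m l where "m \<in> S" "l \<in> S" "m \<noteq> l" by blast
    then have "card {m, l} \<le> card S" by (intro card_mono finS) auto
    then show "2 \<le> card S" using \<open>m \<noteq> l\<close> by simp
  qed
  have q0: "q_null 0 b \<longleftrightarrow> K = {} \<or> 2 \<le> card S"
    unfolding q_null_def Let_def zero S_def by simp
  have qinf: "q_null \<infinity> b \<longleftrightarrow> K = {} \<or> 2 \<le> card S \<or> 3 \<le> card K"
    unfolding q_null_def Let_def zero S_def K' by simp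
  show "q_null 0 b \<longleftrightarrow> (\<forall>k\<in>K. \<exists>l\<in>K - {k}. y k \<le> y l)"
  proof (cases "K = {}")
    case False
    show ?thesis unfolding q0 two
    proof
      assume "K = {} \<or> (\<exists>m\<in>S. \<exists>l\<in>S. m \<noteq> l)"
      then show "\<forall>k\<in>K. \<exists>l\<in>K - {k}. y k \<le> y l"
        using False SK[OF False] by (metis Diff_iff singletonD subsetD)
    next
      assume *: "\<forall>k\<in>K. \<exists>l\<in>K - {k}. y k \<le> y l"
      obtain m where m: "m \<in> S" using max_mem[OF False] by blast
      then have "m \<in> K" using SK(1)[OF False] by blast
      then obtain l where "l \<in> K - {m}" "y m \<le> y l" using * by blast
      then show "K = {} \<or> (\<exists>m\<in>S. \<exists>l\<in>S. m \<noteq> l)" using mem_S m \<open>m \<in> K\<close> by blast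
    qed
  qed (simp add: q0)
  show "q_null \<infinity> b \<longleftrightarrow> (\<forall>k\<in>K. 3 \<le> card K \<or> (\<exists>l\<in>K - {k}. y l = y k))"
  proof (cases "K = {} \<or> 3 \<le> card K")
    case False
    show ?thesis unfolding qinf two
    proof
      assume "K = {} \<or> (\<exists>m\<in>S. \<exists>l\<in>S. m \<noteq> l) \<or> 3 \<le> card K"
      then obtain m l where ml: "m \<in> S" "l \<in> S" "m \<noteq> l" using False by blast
      have "{m, l} \<subseteq> K" using ml SK False by blast
      moreover have "card K \<le> card {m, l}" using False ml by simp
      ultimately have "{m, l} = K" by (intro card_seteq finK)
      moreover have "y m = y l" using ml SK False by (meson order_antisym subsetD)
      ultimately show "\<forall>k\<in>K. 3 \<le> card K \<or> (\<exists>l\<in>K - {k}. y l = y k)" using ml(3) by auto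
    next
      assume *: "\<forall>k\<in>K. 3 \<le> card K \<or> (\<exists>l\<in>K - {k}. y l = y k)"
      obtain m where m: "m \<in> S" using max_mem False by blast
      then have "m \<in> K" using SK(1) False by blast
      then obtain l where "l \<in> K - {m}" "y l = y m" using * False by blast
      then show "K = {} \<or> (\<exists>m\<in>S. \<exists>l\<in>S. m \<noteq> l) \<or> 3 \<le> card K"
        using mem_S[OF m, of l] m \<open>m \<in> K\<close> by auto
    qed
  next
    case True
    then show ?thesis unfolding qinf by auto
  qed
qed

text \<open>Since \<open>0 powr p = 0\<close>, vanishing entries drop out of the sums, and a root
  only divides the exponents by \<open>q\<close>; changing \<open>q\<close> is thus a dilation of
  \<open>y\<close>.\<close>

lemma q_null_finite_exp:
  assumes K: "K \<subseteq> {..<length b}"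
    and b: "\<And>k. k < length b \<Longrightarrow> b ! k = (if k \<in> K then exp (y k) else 0)"
    and q: "0 < q" "q < \<infinity>"
  shows "q_null q b \<longleftrightarrow>
    (\<forall>k\<in>K. exp (1 / enn2real q * y k) \<le> (\<Sum>l\<in>K - {k}. exp (1 / enn2real q * y l)))"
proof -
  let ?p = "1 / enn2real q"
  have pw: "(b ! k) powr ?p = (if k \<in> K then exp (?p * y k) else 0)" if "k < length b" for k
    using b[OF that] by (simp add: powr_def)
  have sums: "(\<Sum>j\<in>{..<length b} - {i}. (b ! j) powr ?p) = (\<Sum>l\<in>K - {i}. exp (?p * y l))" for i
  proof -
    have "(\<Sum>j\<in>{..<length b} - {i}. (b ! j) powr ?p) =
          (\<Sum>j\<in>{..<length b} - {i}. if j \<in> K then exp (?p * y j) else 0)"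
      by (intro sum.cong refl pw) auto
    also have "\<dots> = (\<Sum>l\<in>K - {i}. exp (?p * y l))"
      using K by (intro sum.mono_neutral_cong_right) auto
    finally show ?thesis .
  qed
  have "q_null q b \<longleftrightarrow> (\<forall>i\<in>{..<length b}. (b ! i) powr ?p \<le> (\<Sum>l\<in>K - {i}. exp (?p * y l)))"
    using q unfolding q_null_def Let_def sums by (auto simp: less_top)
  also have "\<dots> \<longleftrightarrow> (\<forall>k\<in>K. exp (?p * y k) \<le> (\<Sum>l\<in>K - {k}. exp (?p * y l)))"
  proof (intro iffI ballI)
    fix i assume *: "\<forall>k\<in>K. exp (?p * y k) \<le> (\<Sum>l\<in>K - {k}. exp (?p * y l))" "i \<in> {..<length b}"
    then show "(b ! i) powr ?p \<le> (\<Sum>l\<in>K - {i}. exp (?p * y l))"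
      using pw[of i] by (auto simp: sum_nonneg)
  next
    fix k assume *: "\<forall>i\<in>{..<length b}. (b ! i) powr ?p \<le> (\<Sum>l\<in>K - {i}. exp (?p * y l))" "k \<in> K"
    then show "exp (?p * y k) \<le> (\<Sum>l\<in>K - {k}. exp (?p * y l))"
      using pw[of k] K by force
  qed
  finally show ?thesis .
qed

text \<open>A Pluecker relation is encoded by the list of the pairs of arguments of its terms. Its term at
  \<open>k\<close> is nonzero iff \<open>k\<close> is an active index, and then its logarithm is the corresponding term value.\<close>

definition pluecker_terms ::
  "nat \<Rightarrow> nat \<Rightarrow> (nat \<Rightarrow> nat) set \<Rightarrow> nat \<Rightarrow> ((nat \<Rightarrow> nat) \<times> (nat \<Rightarrow> nat)) list set" where
  "pluecker_terms n d J s =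
     {map (\<lambda>k. (\<alpha> + (\<Sum>m\<in>{0..s} - {k}. \<epsilon> (i m)), \<alpha> + \<epsilon> (i k) + (\<Sum>m\<in>{2..s}. \<epsilon> (j m))))
        [0..<s + 1] | \<alpha> i j.
        \<alpha> \<in> discrete_simplex n (d - s) \<and> delta_min J \<le> \<alpha> \<and>
        i ` {0..s} \<subseteq> {1..n} \<and> mono_on {0..s} i \<and>
        j ` {2..s} \<subseteq> {1..n} \<and> mono_on {2..s} j \<and>
        \<alpha> + (\<Sum>m\<in>{0..s}. \<epsilon> (i m)) + (\<Sum>m\<in>{2..s}. \<epsilon> (j m)) \<le> delta_max J}"

definition active :: "'a set \<Rightarrow> ('a \<times> 'a) list \<Rightarrow> nat set" where
  "active J L = {k. k < length L \<and> fst (L ! k) \<in> J \<and> snd (L ! k) \<in> J}"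

definition term_value :: "('a \<Rightarrow> real) \<Rightarrow> ('a \<times> 'a) list \<Rightarrow> nat \<Rightarrow> real" where
  "term_value v L k = v (fst (L ! k)) + v (snd (L ! k))"

text \<open>All three regimes quantify over active indices and read \<open>v\<close> on
  \<open>J\<close> only, so the zeros of a representation never need a logarithm.\<close>

definition log_null :: "ennreal \<Rightarrow> 'a set \<Rightarrow> ('a \<Rightarrow> real) \<Rightarrow> ('a \<times> 'a) list \<Rightarrow> bool" where
  "log_null q J v L \<longleftrightarrow>
     (\<forall>k\<in>active J L.
        if q = 0 then \<exists>l\<in>active J L - {k}. term_value v L k \<le> term_value v L l
        else if q = \<infinity> then 3 \<le> card (active J L) \<or>
               (\<exists>l\<in>active J L - {k}. term_value v L l = term_value v L k)
        else exp (1 / enn2real q * term_value v L k) \<le>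
               (\<Sum>l\<in>active J L - {k}. exp (1 / enn2real q * term_value v L l)))"

lemma finite_active: "finite (active J L)"
  by (simp add: active_def)

lemma pluecker_relations_iff:
  "pluecker_relations q n d J s \<rho> \<longleftrightarrow>
     (\<forall>L\<in>pluecker_terms n d J s. q_null q (map (\<lambda>(\<beta>, \<gamma>). \<rho> \<beta> * \<rho> \<gamma>) L))" (is "?l \<longleftrightarrow> ?r")
proof
  assume ?l
  then show ?r
    unfolding pluecker_relations_def pluecker_terms_def by (auto simp: comp_def)
next
  assume r: ?r
  show ?l unfolding pluecker_relations_def
  proof (intro ballI allI impI)
    fix \<alpha> i j
    assume "\<alpha> \<in> discrete_simplex n (d - s)" "delta_min J \<le> \<alpha>"
        "i ` {0..s} \<subseteq> {1..n}" "mono_on {0..s} i"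
        "j ` {2..s} \<subseteq> {1..n}" "mono_on {2..s} j"
        "\<alpha> + (\<Sum>m\<in>{0..s}. \<epsilon> (i m)) + (\<Sum>m\<in>{2..s}. \<epsilon> (j m)) \<le> delta_max J"
    then have "map (\<lambda>k. (\<alpha> + (\<Sum>m\<in>{0..s} - {k}. \<epsilon> (i m)), \<alpha> + \<epsilon> (i k) + (\<Sum>m\<in>{2..s}. \<epsilon> (j m))))
        [0..<s + 1] \<in> pluecker_terms n d J s"
      unfolding pluecker_terms_def by blast
    from bspec[OF r this]
    show "q_null q (map (\<lambda>k. \<rho> (\<alpha> + (\<Sum>m\<in>{0..s} - {k}. \<epsilon> (i m)))
            * \<rho> (\<alpha> + \<epsilon> (i k) + (\<Sum>m\<in>{2..s}. \<epsilon> (j m)))) [0..<s + 1])"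
      by (simp only: map_map comp_def case_prod_conv)
  qed
qed

lemma pluecker_terms_in_simplex:
  assumes "2 \<le> s" "s \<le> d" "L \<in> pluecker_terms n d J s"
  shows "set L \<subseteq> discrete_simplex n d \<times> discrete_simplex n d" "length L = s + 1"
proof -
  obtain \<alpha> i j where L: "L = map (\<lambda>k. (\<alpha> + (\<Sum>m\<in>{0..s} - {k}. \<epsilon> (i m)),
      \<alpha> + \<epsilon> (i k) + (\<Sum>m\<in>{2..s}. \<epsilon> (j m)))) [0..<s + 1]"
    and \<alpha>: "\<alpha> \<in> discrete_simplex n (d - s)" and i: "i ` {0..s} \<subseteq> {1..n}" and j: "j ` {2..s} \<subseteq> {1..n}"
    using assms(3) unfolding pluecker_terms_def by blast
  have 1: "\<alpha> + (\<Sum>m\<in>{0..s} - {k}. \<epsilon> (i m)) \<in> discrete_simplex n d" if "k \<le> s" for k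
  proof -
    have "(\<Sum>m\<in>{0..s} - {k}. \<epsilon> (i m)) \<in> discrete_simplex n (card ({0..s} - {k}))"
      using i by (intro sum_std_unit_in_discrete_simplex) auto
    from discrete_simplex_add[OF \<alpha> this] show ?thesis using that assms(2) by simp
  qed
  have 2: "\<alpha> + \<epsilon> (i k) + (\<Sum>m\<in>{2..s}. \<epsilon> (j m)) \<in> discrete_simplex n d" if "k \<le> s" for k
  proof -
    have "(\<Sum>m\<in>{2..s}. \<epsilon> (j m)) \<in> discrete_simplex n (card {2..s})"
      using j by (intro sum_std_unit_in_discrete_simplex) auto
    moreover have "\<epsilon> (i k) \<in> discrete_simplex n 1"
      using i that by (intro std_unit_in_discrete_simplex) (meson atLeastAtMost_iff image_subset_iff le0)
    ultimately show ?thesis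
      using discrete_simplex_add[OF discrete_simplex_add[OF \<alpha>]] assms(1,2) by force
  qed
  show "set L \<subseteq> discrete_simplex n d \<times> discrete_simplex n d" using 1 2 unfolding L by auto
  show "length L = s + 1" unfolding L by simp
qed

lemma q_null_iff_log_null:
  assumes L: "set L \<subseteq> \<Delta> \<times> \<Delta>"
    and \<rho>: "\<And>x. x \<in> \<Delta> \<Longrightarrow> \<rho> x = (if x \<in> J then exp (v x) else 0)"
  shows "q_null q (map (\<lambda>(\<beta>, \<gamma>). \<rho> \<beta> * \<rho> \<gamma>) L) \<longleftrightarrow> log_null q J v L"
proof -
  let ?b = "map (\<lambda>(\<beta>, \<gamma>). \<rho> \<beta> * \<rho> \<gamma>) L"
  have K: "active J L \<subseteq> {..<length ?b}" by (auto simp: active_def)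
  have b: "?b ! k = (if k \<in> active J L then exp (term_value v L k) else 0)" if "k < length ?b" for k
  proof -
    have "fst (L ! k) \<in> \<Delta>" "snd (L ! k) \<in> \<Delta>"
      using subsetD[OF L nth_mem[of k L]] that by (auto simp: mem_Times_iff)
    then show ?thesis
      using that \<rho>[of "fst (L ! k)"] \<rho>[of "snd (L ! k)"]
      by (auto simp: case_prod_beta active_def term_value_def exp_add)
  qed
  consider "q = 0" | "q = \<infinity>" | "0 < q" "q < \<infinity>"
    by (metis less_top not_gr_zero infinity_ennreal_def)
  then show ?thesis
  proof cases
    case 1
    have "q_null 0 ?b \<longleftrightarrow> (\<forall>k\<in>active J L. \<exists>l\<in>active J L - {k}. term_value v L k \<le> term_value v L l)"
      by (rule q_null_extreme_exp(1)[OF K b])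
    then show ?thesis unfolding \<open>q = 0\<close> log_null_def by simp
  next
    case 2
    have "q_null \<infinity> ?b \<longleftrightarrow> (\<forall>k\<in>active J L. 3 \<le> card (active J L) \<or> (\<exists>l\<in>active J L - {k}. term_value v L l = term_value v L k))"
      by (rule q_null_extreme_exp(2)[OF K b])
    then show ?thesis unfolding \<open>q = \<infinity>\<close> log_null_def by simp
  next
    case 3
    have "q_null q ?b \<longleftrightarrow> (\<forall>k\<in>active J L. exp (1 / enn2real q * term_value v L k) \<le>
        (\<Sum>l\<in>active J L - {k}. exp (1 / enn2real q * term_value v L l)))"
      by (rule q_null_finite_exp[OF K b 3])
    then show ?thesis using 3 unfolding log_null_def by auto
  qed
qed

definition strong_terms :: "nat \<Rightarrow> nat \<Rightarrow> (nat \<Rightarrow> nat) set \<Rightarrow> ((nat \<Rightarrow> nat) \<times> (nat \<Rightarrow> nat)) list set" where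
  "strong_terms n d J = (\<Union>s\<in>{2..d}. pluecker_terms n d J s)"

definition weak_terms :: "nat \<Rightarrow> nat \<Rightarrow> (nat \<Rightarrow> nat) set \<Rightarrow> ((nat \<Rightarrow> nat) \<times> (nat \<Rightarrow> nat)) list set" where
  "weak_terms n d J = (if 2 \<le> d then pluecker_terms n d J 2 else {})"

lemma weak_subset_strong: "weak_terms n d J \<subseteq> strong_terms n d J"
  by (auto simp: weak_terms_def strong_terms_def)

lemma strong_terms_in_simplex:
  "L \<in> strong_terms n d J \<Longrightarrow> set L \<subseteq> discrete_simplex n d \<times> discrete_simplex n d"
  unfolding strong_terms_def using pluecker_terms_in_simplex(1) by fastforce

lemma finite_strong_terms: "finite (strong_terms n d J)"
proof (rule finite_subset)
  show "strong_terms n d J \<subseteq>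
      {L. set L \<subseteq> discrete_simplex n d \<times> discrete_simplex n d \<and> length L \<le> d + 1}"
    unfolding strong_terms_def using pluecker_terms_in_simplex by fastforce
  show "finite \<dots>"
    by (intro finite_lists_length_le finite_cartesian_product finite_discrete_simplex)
qed

definition log_reps ::
  "ennreal \<Rightarrow> 'a set \<Rightarrow> ('a \<times> 'a) list set \<Rightarrow> ('a \<Rightarrow> real) set" where
  "log_reps q J \<L> = {v \<in> J \<rightarrow>\<^sub>E UNIV. \<forall>L\<in>\<L>. log_null q J v L}"

definition exp_vec :: "'a set \<Rightarrow> ('a \<Rightarrow> real) \<Rightarrow> 'a \<Rightarrow> real" where
  "exp_vec J v = (\<lambda>x\<in>J. exp (v x))"

lemma log_vec_exp_vec: "v \<in> J \<rightarrow>\<^sub>E UNIV \<Longrightarrow> log_vec J (exp_vec J v) = v"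
  by (auto simp: log_vec_def exp_vec_def fun_eq_iff PiE_def extensional_def)

text \<open>Stated for an arbitrary family of relations, so that strong and weak representations are
  treated alike. The inverse of the logarithm extends \<open>exp\<close> by zero outside
  \<open>J\<close>.\<close>

lemma reps_log_image:
  fixes q :: ennreal
  assumes "J \<subseteq> \<Delta>" "\<And>L. L \<in> \<L> \<Longrightarrow> set L \<subseteq> \<Delta> \<times> \<Delta>"
  defines "R \<equiv> {\<rho> \<in> \<Delta> \<rightarrow>\<^sub>E {0..}. {\<alpha> \<in> \<Delta>. \<rho> \<alpha> \<noteq> 0} = J \<and>
      (\<forall>L\<in>\<L>. q_null q (map (\<lambda>(\<beta>, \<gamma>). \<rho> \<beta> * \<rho> \<gamma>) L))}"
  shows "log_vec J ` R = log_reps q J \<L>"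
    and "(\<lambda>\<rho>. restrict \<rho> J) ` R = exp_vec J ` log_reps q J \<L>"
proof -
  define E where "E v = (\<lambda>x\<in>\<Delta>. if x \<in> J then exp (v x) else 0)" for v :: "'a \<Rightarrow> real"
  have E1: "E v \<in> R" "log_vec J (E v) = v" "restrict (E v) J = exp_vec J v" if v: "v \<in> log_reps q J \<L>" for v
  proof -
    have "{x \<in> \<Delta>. E v x \<noteq> 0} = J" using assms(1) by (auto simp: E_def)
    moreover have "q_null q (map (\<lambda>(\<beta>, \<gamma>). E v \<beta> * E v \<gamma>) L)" if "L \<in> \<L>" for L
      using q_null_iff_log_null[of L \<Delta> "E v" J v q] assms(2)[OF that] v that
      by (simp add: E_def log_reps_def)
    ultimately show "E v \<in> R" by (auto simp: R_def E_def)
    show "log_vec J (E v) = v" "restrict (E v) J = exp_vec J v"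
      using v assms(1)
      by (auto simp: log_reps_def log_vec_def E_def exp_vec_def fun_eq_iff PiE_def extensional_def)
  qed
  have E2: "log_vec J \<rho> \<in> log_reps q J \<L>" "restrict \<rho> J = exp_vec J (log_vec J \<rho>)" if \<rho>: "\<rho> \<in> R" for \<rho>
  proof -
    have pos: "\<rho> x = (if x \<in> J then exp (log_vec J \<rho> x) else 0)" if "x \<in> \<Delta>" for x
    proof (cases "x \<in> J")
      case True
      then have "0 \<le> \<rho> x" "\<rho> x \<noteq> 0" using \<rho> that by (auto simp: R_def)
      then show ?thesis using True by (simp add: log_vec_def)
    next
      case False
      then show ?thesis using \<rho> that by (auto simp: R_def)
    qed
    have "log_null q J (log_vec J \<rho>) L" if "L \<in> \<L>" for L
      using q_null_iff_log_null[of L \<Delta> \<rho> J "log_vec J \<rho>" q, OF assms(2)[OF that] pos] \<rho> that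
      by (simp add: R_def)
    then show "log_vec J \<rho> \<in> log_reps q J \<L>" by (simp add: log_reps_def log_vec_def)
    show "restrict \<rho> J = exp_vec J (log_vec J \<rho>)"
      using pos assms(1) by (auto simp: exp_vec_def fun_eq_iff)
  qed
  show "log_vec J ` R = log_reps q J \<L>" using E1 E2 by (metis (no_types, lifting) image_iff subsetI subset_antisym)
  show "(\<lambda>\<rho>. restrict \<rho> J) ` R = exp_vec J ` log_reps q J \<L>"
  proof (intro subset_antisym image_subsetI)
    fix \<rho> assume "\<rho> \<in> R"
    then show "restrict \<rho> J \<in> exp_vec J ` log_reps q J \<L>" using E2 by blast
  next
    fix v assume "v \<in> log_reps q J \<L>"
    then show "exp_vec J v \<in> (\<lambda>\<rho>. restrict \<rho> J) ` R" using E1 by (metis (no_types, lifting) image_iff)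
  qed
qed

lemma strong_reps_eq:
  "strong_reps q n d J = {\<rho> \<in> discrete_simplex n d \<rightarrow>\<^sub>E {0..}. {\<alpha> \<in> discrete_simplex n d. \<rho> \<alpha> \<noteq> 0} = J \<and>
      (\<forall>L\<in>strong_terms n d J. q_null q (map (\<lambda>(\<beta>, \<gamma>). \<rho> \<beta> * \<rho> \<gamma>) L))}"
  by (auto simp: strong_reps_def strong_terms_def pluecker_relations_iff)

lemma weak_reps_eq:
  "weak_reps q n d J = {\<rho> \<in> discrete_simplex n d \<rightarrow>\<^sub>E {0..}. {\<alpha> \<in> discrete_simplex n d. \<rho> \<alpha> \<noteq> 0} = J \<and>
      (\<forall>L\<in>weak_terms n d J. q_null q (map (\<lambda>(\<beta>, \<gamma>). \<rho> \<beta> * \<rho> \<gamma>) L))}"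
  by (auto simp: weak_reps_def weak_terms_def pluecker_relations_iff)

section \<open>Three-term relations; weak against strong at q = 0 and at q = infinity\<close>

context M_convex_set begin

text \<open>The sorted sequence is \<open>a, b, c\<close> and the single index of the second
  sequence is \<open>e\<close>; the entry at \<open>k\<close> takes the \<open>k\<close>-th of the
  three and pairs it with \<open>e\<close>.\<close>

lemma sorted_triple_in_terms:
  assumes "2 \<le> d" "t \<in> discrete_simplex n (d - 2)" "delta_min J \<le> t"
    "t + \<epsilon> a + \<epsilon> b + \<epsilon> c + \<epsilon> e \<le> delta_max J"
    "a \<in> {1..n}" "b \<in> {1..n}" "c \<in> {1..n}" "e \<in> {1..n}" "a \<le> b" "b \<le> c"
  shows "[(t + \<epsilon> b + \<epsilon> c, t + \<epsilon> a + \<epsilon> e), (t + \<epsilon> a + \<epsilon> c, t + \<epsilon> b + \<epsilon> e), (t + \<epsilon> a + \<epsilon> b, t + \<epsilon> c + \<epsilon> e)]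
    \<in> weak_terms n d J"
proof -
  define i where "i m = (if m = 0 then a else if m = 1 then b else c)" for m :: nat
  have i: "i 0 = a" "i 1 = b" "i 2 = c" by (simp_all add: i_def)
  have sets: "{0..2::nat} = {0, 1, 2}" "{0, 1, 2} - {0::nat} = {1, 2}" "{0, 1, 2} - {1::nat} = {0, 2}"
    "{0, 1, 2} - {2::nat} = {0, 1}" "[0..<2 + 1] = [0, 1, 2::nat]" by (auto simp: upt_rec)
  have S: "(\<Sum>m\<in>{0, 1, 2}. \<epsilon> (i m)) = \<epsilon> a + \<epsilon> b + \<epsilon> c" "(\<Sum>m\<in>{1, 2}. \<epsilon> (i m)) = \<epsilon> b + \<epsilon> c"
    "(\<Sum>m\<in>{0, 2}. \<epsilon> (i m)) = \<epsilon> a + \<epsilon> c" "(\<Sum>m\<in>{0, 1}. \<epsilon> (i m)) = \<epsilon> a + \<epsilon> b"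
    by (simp_all add: i_def add.assoc)
  have "mono_on {0..2} i" using assms(9,10) unfolding sets by (auto simp: monotone_on_def i_def)
  moreover have "i ` {0..2} \<subseteq> {1..n}" unfolding sets using assms(5-7) by (auto simp: i_def)
  moreover have "t + (\<Sum>m\<in>{0..2}. \<epsilon> (i m)) + (\<Sum>m\<in>{2..2::nat}. \<epsilon> e) \<le> delta_max J"
    using assms(4) unfolding sets S by (simp add: add.assoc)
  moreover have "[(t + \<epsilon> b + \<epsilon> c, t + \<epsilon> a + \<epsilon> e), (t + \<epsilon> a + \<epsilon> c, t + \<epsilon> b + \<epsilon> e), (t + \<epsilon> a + \<epsilon> b, t + \<epsilon> c + \<epsilon> e)] =
     map (\<lambda>k. (t + (\<Sum>m\<in>{0..2} - {k}. \<epsilon> (i m)), t + \<epsilon> (i k) + (\<Sum>m\<in>{2..2::nat}. \<epsilon> e))) [0..<2 + 1]"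
    unfolding sets list.map S i by (simp add: add.assoc)
  moreover have "(\<lambda>_. e) ` {2..2::nat} \<subseteq> {1..n}" "mono_on {2..2::nat} (\<lambda>_. e)"
    using assms(8) by (auto simp: monotone_on_def)
  ultimately show ?thesis
    using assms(1-3) unfolding weak_terms_def pluecker_terms_def if_P[OF assms(1)] mem_Collect_eq
    by (intro exI[of _ t] exI[of _ i] exI[of _ "\<lambda>_. e"] conjI)
qed

text \<open>Relations list sorted indices only, while exchange arguments need arbitrary ones. The
  entries are the three ways to split \<open>a, b, c, e\<close> into two pairs, and nullity does not
  depend on their order; so knowing the list up to a permutation suffices.\<close>

lemma triple_in_terms:
  assumes "delta_min J \<le> t" "t + \<epsilon> a + \<epsilon> b + \<epsilon> c + \<epsilon> e \<le> delta_max J"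
    "t + \<epsilon> a + \<epsilon> b \<in> J" "t + \<epsilon> c + \<epsilon> e \<in> J"
  obtains p q r where "[p, q, r] \<in> weak_terms n d J"
    "(p, q, r) \<in> (let A = (t + \<epsilon> b + \<epsilon> c, t + \<epsilon> a + \<epsilon> e); B = (t + \<epsilon> a + \<epsilon> c, t + \<epsilon> b + \<epsilon> e); C = (t + \<epsilon> a + \<epsilon> b, t + \<epsilon> c + \<epsilon> e)
      in {(A, B, C), (A, C, B), (B, A, C), (B, C, A), (C, A, B), (C, B, A)})"
proof -
  have "(t + \<epsilon> a + \<epsilon> b) a \<noteq> 0" "(t + \<epsilon> a + \<epsilon> b) b \<noteq> 0" "(t + \<epsilon> c + \<epsilon> e) c \<noteq> 0" "(t + \<epsilon> c + \<epsilon> e) e \<noteq> 0"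
    by (auto simp: std_unit_def)
  then have idx: "a \<in> {1..n}" "b \<in> {1..n}" "c \<in> {1..n}" "e \<in> {1..n}"
    using assms(3,4) subset discrete_simplex_support by blast+
  have "t + \<epsilon> a + \<epsilon> b \<in> discrete_simplex n d" using assms(3) subset by blast
  moreover have "(\<Sum>k\<in>{1..n}. (t + \<epsilon> a + \<epsilon> b) k) = (\<Sum>k\<in>{1..n}. t k) + 2"
    using idx by (simp add: sum.distrib std_unit_def)
  ultimately have t: "2 \<le> d" "t \<in> discrete_simplex n (d - 2)"
    unfolding discrete_simplex_def by auto
  define S where "S x y = t + \<epsilon> x + \<epsilon> y" for x y
  have S_sym: "S x y = S y x" for x y by (simp add: S_def ac_simps)
  \<comment> \<open>The equality of multisets records that \<open>x, y, z\<close> rearrange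
    \<open>a, b, c\<close>; membership in \<open>{1..n}\<close> and the upper bound depend on the
    multiset only.\<close>
  have in_terms: "[(S y z, S x e), (S x z, S y e), (S x y, S z e)] \<in> weak_terms n d J"
    if "{#x, y, z#} = {#a, b, c#}" "x \<le> y" "y \<le> z" for x y z
  proof -
    have "x \<in> {1..n}" "y \<in> {1..n}" "z \<in> {1..n}"
      using idx arg_cong[OF that(1), of set_mset] by auto
    moreover have "t + \<epsilon> x + \<epsilon> y + \<epsilon> z + \<epsilon> e = t + \<epsilon> a + \<epsilon> b + \<epsilon> c + \<epsilon> e"
      using arg_cong[OF that(1), of "\<lambda>M. t + sum_mset (image_mset \<epsilon> M) + \<epsilon> e"] by (simp add: add.assoc)
    ultimately show ?thesis
      unfolding S_def using assms(2) idx(4) that(2,3) by (intro sorted_triple_in_terms[OF t assms(1)]) auto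
  qed
  note sym = S_sym[of b a] S_sym[of c a] S_sym[of c b]
  consider "a \<le> b" "b \<le> c" | "a \<le> c" "c \<le> b" | "b \<le> a" "a \<le> c" | "b \<le> c" "c \<le> a"
    | "c \<le> a" "a \<le> b" | "c \<le> b" "b \<le> a" by linarith
  then show ?thesis
  proof cases
    case 1 from in_terms[OF _ this] show ?thesis by (intro that) (auto simp: sym S_def[symmetric] Let_def)
  next
    case 2 from in_terms[OF _ this] show ?thesis by (intro that) (auto simp: sym S_def[symmetric] Let_def)
  next
    case 3 from in_terms[OF _ this] show ?thesis by (intro that) (auto simp: sym S_def[symmetric] Let_def)
  next
    case 4 from in_terms[OF _ this] show ?thesis by (intro that) (auto simp: sym S_def[symmetric] Let_def)
  next
    case 5 from in_terms[OF _ this] show ?thesis by (intro that) (auto simp: sym S_def[symmetric] Let_def)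
  next
    case 6 from in_terms[OF _ this] show ?thesis by (intro that) (auto simp: sym S_def[symmetric] Let_def)
  qed
qed

end

lemma active_triple:
  "active J [p, q, r] = (if fst p \<in> J \<and> snd p \<in> J then {0} else {}) \<union>
    (if fst q \<in> J \<and> snd q \<in> J then {1} else {}) \<union> (if fst r \<in> J \<and> snd r \<in> J then {2} else {})"
proof -
  have insert: "{x \<in> insert a B. P x} = (if P a then {a} else {}) \<union> {x \<in> B. P x}"
    for a B and P :: "nat \<Rightarrow> bool" by auto
  have "active J [p, q, r] = {k \<in> {0, 1, 2}. fst ([p, q, r] ! k) \<in> J \<and> snd ([p, q, r] ! k) \<in> J}"
    unfolding active_def by auto
  then show ?thesis unfolding insert by simp
qed

lemma log_null_zero_triple:
  assumes "log_null 0 J v [p, q, r]"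
  defines "A \<equiv> \<lambda>x. fst x \<in> J \<and> snd x \<in> J" and "w \<equiv> \<lambda>x. v (fst x) + v (snd x)"
  shows "A p \<Longrightarrow> A q \<and> w p \<le> w q \<or> A r \<and> w p \<le> w r"
    and "A q \<Longrightarrow> A p \<and> w q \<le> w p \<or> A r \<and> w q \<le> w r"
    and "A r \<Longrightarrow> A p \<and> w r \<le> w p \<or> A q \<and> w r \<le> w q"
  using assms(1) unfolding log_null_def active_triple term_value_def A_def w_def
  by (auto split: if_splits)

lemma log_null_infinity_triple:
  assumes "log_null \<infinity> J v [p, q, r]"
  defines "A \<equiv> \<lambda>x. fst x \<in> J \<and> snd x \<in> J" and "w \<equiv> \<lambda>x. v (fst x) + v (snd x)"
  shows "A p \<Longrightarrow> A q \<Longrightarrow> \<not> A r \<Longrightarrow> w p = w q"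
    and "A p \<Longrightarrow> A r \<Longrightarrow> \<not> A q \<Longrightarrow> w p = w r"
    and "A q \<Longrightarrow> A r \<Longrightarrow> \<not> A p \<Longrightarrow> w q = w r"
  using assms(1) unfolding log_null_def active_triple term_value_def A_def w_def
  by (auto split: if_splits)

context M_convex_set begin

text \<open>The order of the two index sequences is forgotten and their multiplicities are kept:
  \<open>\<iota>\<close> and \<open>\<kappa>\<close> are the sums of the unit vectors. In this form
  the exchange properties apply.\<close>

lemma strong_term_cases:
  assumes "L \<in> strong_terms n d J"
  obtains \<alpha> \<iota> \<kappa> i where "delta_min J \<le> \<alpha>" "\<alpha> + \<iota> + \<kappa> \<le> delta_max J"
    "\<And>x. \<iota> x = card {m. m < length L \<and> i m = x}"
    "\<And>k. k < length L \<Longrightarrow> L ! k = (\<alpha> + \<iota> - \<epsilon> (i k), \<alpha> + \<kappa> + \<epsilon> (i k))"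
proof -
  obtain s \<alpha> i j where L: "L = map (\<lambda>k. (\<alpha> + (\<Sum>m\<in>{0..s} - {k}. \<epsilon> (i m)),
      \<alpha> + \<epsilon> (i k) + (\<Sum>m\<in>{2..s}. \<epsilon> (j m)))) [0..<s + 1]"
    and \<alpha>: "delta_min J \<le> \<alpha>"
      "\<alpha> + (\<Sum>m\<in>{0..s}. \<epsilon> (i m)) + (\<Sum>m\<in>{2..s}. \<epsilon> (j m)) \<le> delta_max J"
    using assms unfolding strong_terms_def pluecker_terms_def by blast
  show ?thesis
  proof (rule that[OF \<alpha>])
    fix x
    have "(\<Sum>m\<in>{0..s}. \<epsilon> (i m)) x = (\<Sum>m\<in>{0..s}. if i m = x then 1 else 0)"
      unfolding sum_fun_apply std_unit_def by (intro sum.cong) auto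
    also have "\<dots> = card {m. m < length L \<and> i m = x}"
      by (simp add: L sum.If_cases Int_def less_Suc_eq_le)
    finally show "(\<Sum>m\<in>{0..s}. \<epsilon> (i m)) x = card {m. m < length L \<and> i m = x}" .
  next
    fix k assume k: "k < length L"
    then have "(\<Sum>m\<in>{0..s}. \<epsilon> (i m)) = \<epsilon> (i k) + (\<Sum>m\<in>{0..s} - {k}. \<epsilon> (i m))"
      by (intro sum.remove) (auto simp: L)
    then have "\<alpha> + (\<Sum>m\<in>{0..s}. \<epsilon> (i m)) - \<epsilon> (i k) = \<alpha> + (\<Sum>m\<in>{0..s} - {k}. \<epsilon> (i m))"
      by (auto simp: fun_eq_iff)
    then show "L ! k = (\<alpha> + (\<Sum>m\<in>{0..s}. \<epsilon> (i m)) - \<epsilon> (i k), \<alpha> + (\<Sum>m\<in>{2..s}. \<epsilon> (j m)) + \<epsilon> (i k))"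
      using k unfolding L by (simp add: nth_append ac_simps del: upt_Suc)
  qed
qed

text \<open>This is the local hypothesis of \<open>valuated_exchange\<close>: the splitting
  \<open>a, b\<close> and \<open>c, e\<close> is active, hence has a rival among the other
  two.\<close>

lemma weak_zero_exchange:
  assumes v: "\<And>L. L \<in> weak_terms n d J \<Longrightarrow> log_null 0 J v L"
    and t: "delta_min J \<le> t" "t + \<epsilon> a + \<epsilon> b + \<epsilon> c + \<epsilon> e \<le> delta_max J"
      "t + \<epsilon> a + \<epsilon> b \<in> J" "t + \<epsilon> c + \<epsilon> e \<in> J"
  shows "t + \<epsilon> a + \<epsilon> c \<in> J \<and> t + \<epsilon> b + \<epsilon> e \<in> J \<and>
          v (t + \<epsilon> a + \<epsilon> b) + v (t + \<epsilon> c + \<epsilon> e) \<le> v (t + \<epsilon> a + \<epsilon> c) + v (t + \<epsilon> b + \<epsilon> e) \<or>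
        t + \<epsilon> a + \<epsilon> e \<in> J \<and> t + \<epsilon> b + \<epsilon> c \<in> J \<and>
          v (t + \<epsilon> a + \<epsilon> b) + v (t + \<epsilon> c + \<epsilon> e) \<le> v (t + \<epsilon> a + \<epsilon> e) + v (t + \<epsilon> b + \<epsilon> c)"
proof -
  obtain p q r where L: "[p, q, r] \<in> weak_terms n d J"
    "(p, q, r) \<in> (let A = (t + \<epsilon> b + \<epsilon> c, t + \<epsilon> a + \<epsilon> e); B = (t + \<epsilon> a + \<epsilon> c, t + \<epsilon> b + \<epsilon> e); C = (t + \<epsilon> a + \<epsilon> b, t + \<epsilon> c + \<epsilon> e)
      in {(A, B, C), (A, C, B), (B, A, C), (B, C, A), (C, A, B), (C, B, A)})"
    by (rule triple_in_terms[OF t])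
  show ?thesis
    using L(2) log_null_zero_triple[of J v, OF v[OF L(1)]] t(3,4)
    unfolding Let_def by (elim insertE emptyE) auto
qed

text \<open>This is the local hypothesis of \<open>two_term_relation\<close>: exactly two of the
  three splittings are active, so their values agree.\<close>

lemma weak_infinity_exchange:
  assumes v: "\<And>L. L \<in> weak_terms n d J \<Longrightarrow> log_null \<infinity> J v L"
    and t: "delta_min J \<le> t" "t + \<epsilon> a + \<epsilon> b + \<epsilon> c + \<epsilon> e \<le> delta_max J"
      "t + \<epsilon> a + \<epsilon> b \<in> J" "t + \<epsilon> c + \<epsilon> e \<in> J" "t + \<epsilon> a + \<epsilon> c \<in> J" "t + \<epsilon> b + \<epsilon> e \<in> J"
      "\<not> (t + \<epsilon> a + \<epsilon> e \<in> J \<and> t + \<epsilon> b + \<epsilon> c \<in> J)"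
  shows "v (t + \<epsilon> a + \<epsilon> b) + v (t + \<epsilon> c + \<epsilon> e) = v (t + \<epsilon> a + \<epsilon> c) + v (t + \<epsilon> b + \<epsilon> e)"
proof -
  obtain p q r where L: "[p, q, r] \<in> weak_terms n d J"
    "(p, q, r) \<in> (let A = (t + \<epsilon> b + \<epsilon> c, t + \<epsilon> a + \<epsilon> e); B = (t + \<epsilon> a + \<epsilon> c, t + \<epsilon> b + \<epsilon> e); C = (t + \<epsilon> a + \<epsilon> b, t + \<epsilon> c + \<epsilon> e)
      in {(A, B, C), (A, C, B), (B, A, C), (B, C, A), (C, A, B), (C, B, A)})"
    by (rule triple_in_terms[OF t(1-4)])
  show ?thesis
    using L(2) log_null_infinity_triple[of J v, OF v[OF L(1)]] t(3-)
    unfolding Let_def by (elim insertE emptyE) auto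
qed

text \<open>A repeated index gives the same term twice. Otherwise \<open>i k\<close> has
  multiplicity one, so \<open>\<alpha> + \<iota> - \<epsilon> (i k)\<close> contains it less often
  than the second factor, and an exchange at \<open>i k\<close> leads to another index of the
  relation. The exchange property is a hypothesis so that a valuated and a plain one can be
  inserted.\<close>

lemma active_partner:
  assumes L: "\<And>x. \<iota> x = card {m. m < length L \<and> i m = x}"
      "\<And>k. k < length L \<Longrightarrow> L ! k = (\<alpha> + \<iota> - \<epsilon> (i k), \<alpha> + \<kappa> + \<epsilon> (i k))"
    and k: "k \<in> active J L"
    and exch: "\<And>x y u. \<lbrakk>x \<in> J; y \<in> J; y u < x u\<rbrakk> \<Longrightarrow>
        \<exists>e. x e < y e \<and> x - \<epsilon> u + \<epsilon> e \<in> J \<and> y + \<epsilon> u - \<epsilon> e \<in> J \<and>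
          v x + v y \<le> v (x - \<epsilon> u + \<epsilon> e) + v (y + \<epsilon> u - \<epsilon> e)"
  shows "\<exists>l\<in>active J L - {k}. term_value v L k \<le> term_value v L l"
proof (cases "\<exists>l<length L. l \<noteq> k \<and> i l = i k")
  case True
  then obtain l where "l < length L" "l \<noteq> k" "i l = i k" by blast
  then show ?thesis using k L(2) by (intro bexI[of _ l]) (auto simp: active_def term_value_def)
next
  case False
  have kL: "k < length L" "\<alpha> + \<iota> - \<epsilon> (i k) \<in> J" "\<alpha> + \<kappa> + \<epsilon> (i k) \<in> J"
    using k L(2) by (auto simp: active_def)
  have "{m. m < length L \<and> i m = i k} = {k}" using False kL(1) by auto
  then have ik: "\<iota> (i k) = 1" by (simp add: L(1))
  then have gt: "(\<alpha> + \<iota> - \<epsilon> (i k)) (i k) < (\<alpha> + \<kappa> + \<epsilon> (i k)) (i k)" by (simp add: std_unit_def)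
  from exch[OF kL(3,2) gt]
  obtain x where x: "(\<alpha> + \<kappa> + \<epsilon> (i k)) x < (\<alpha> + \<iota> - \<epsilon> (i k)) x"
    "\<alpha> + \<kappa> + \<epsilon> (i k) - \<epsilon> (i k) + \<epsilon> x \<in> J" "\<alpha> + \<iota> - \<epsilon> (i k) + \<epsilon> (i k) - \<epsilon> x \<in> J"
    "v (\<alpha> + \<kappa> + \<epsilon> (i k)) + v (\<alpha> + \<iota> - \<epsilon> (i k)) \<le>
     v (\<alpha> + \<kappa> + \<epsilon> (i k) - \<epsilon> (i k) + \<epsilon> x) + v (\<alpha> + \<iota> - \<epsilon> (i k) + \<epsilon> (i k) - \<epsilon> x)"
    by blast
  \<comment> \<open>\<open>\<alpha>\<close> is common to both sides, so the excess at
    \<open>x\<close> must come from \<open>\<iota>\<close>.\<close>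
  have "\<iota> x > 0" using x(1) by (auto simp: std_unit_def split: if_splits)
  then obtain l where l: "l < length L" "i l = x" unfolding L(1) by (auto simp: card_gt_0_iff)
  moreover have "l \<noteq> k" using x(1) ik l(2) by (auto simp: std_unit_def)
  moreover have "\<alpha> + \<kappa> + \<epsilon> (i k) - \<epsilon> (i k) + \<epsilon> x = \<alpha> + \<kappa> + \<epsilon> x"
    "\<alpha> + \<iota> - \<epsilon> (i k) + \<epsilon> (i k) - \<epsilon> x = \<alpha> + \<iota> - \<epsilon> x"
    using ik by (auto simp: fun_eq_iff std_unit_def)
  ultimately show ?thesis
    using x(2-4) L(2)[OF l(1)] L(2)[OF kL(1)] by (intro bexI[of _ l]) (auto simp: active_def term_value_def)
qed

lemma weak_imp_strong_zero:
  assumes "\<And>L. L \<in> weak_terms n d J \<Longrightarrow> log_null 0 J v L" and L: "L \<in> strong_terms n d J"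
  shows "log_null 0 J v L"
proof -
  obtain \<alpha> \<iota> \<kappa> i where "delta_min J \<le> \<alpha>" "\<alpha> + \<iota> + \<kappa> \<le> delta_max J"
    and L: "\<And>x. \<iota> x = card {m. m < length L \<and> i m = x}"
    "\<And>k. k < length L \<Longrightarrow> L ! k = (\<alpha> + \<iota> - \<epsilon> (i k), \<alpha> + \<kappa> + \<epsilon> (i k))"
    by (rule strong_term_cases[OF L]) blast
  have "\<exists>l\<in>active J L - {k}. term_value v L k \<le> term_value v L l" if "k \<in> active J L" for k
    by (rule active_partner[OF L that valuated_exchange[OF weak_zero_exchange[OF assms(1)]]])
  then show ?thesis by (simp add: log_null_def)
qed

text \<open>The partner argument for the constant valuation 0, whose inequality is trivial:
  M-convexity alone rules out a relation with a single nonzero term.\<close>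

lemma active_not_singleton:
  assumes L: "L \<in> strong_terms n d J" and "k \<in> active J L"
  shows "\<exists>l\<in>active J L. l \<noteq> k"
proof -
  obtain \<alpha> \<iota> \<kappa> i where "delta_min J \<le> \<alpha>" "\<alpha> + \<iota> + \<kappa> \<le> delta_max J"
    and L: "\<And>x. \<iota> x = card {m. m < length L \<and> i m = x}"
    "\<And>k. k < length L \<Longrightarrow> L ! k = (\<alpha> + \<iota> - \<epsilon> (i k), \<alpha> + \<kappa> + \<epsilon> (i k))"
    by (rule strong_term_cases[OF L]) blast
  have "\<exists>l\<in>active J L - {k}. term_value (\<lambda>_. 0) L k \<le> term_value (\<lambda>_. 0) L l"
  proof (rule active_partner[OF L assms(2)])
    fix x y u assume "x \<in> J" "y \<in> J" "y u < x u"
    then obtain e where "x e < y e" "y + \<epsilon> u - \<epsilon> e \<in> J" "x - \<epsilon> u + \<epsilon> e \<in> J"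
      using exchange[of y x u] by metis
    then show "\<exists>e. x e < y e \<and> x - \<epsilon> u + \<epsilon> e \<in> J \<and> y + \<epsilon> u - \<epsilon> e \<in> J \<and> (0::real) + 0 \<le> 0 + 0"
      by auto
  qed
  then show ?thesis by blast
qed

text \<open>Three active terms leave nothing to prove and a single one is impossible, so two remain.
  Either they carry the same index, or both indices have multiplicity one and
  \<open>two_term_relation\<close> applies.\<close>

lemma weak_imp_strong_infinity:
  assumes v: "\<And>L. L \<in> weak_terms n d J \<Longrightarrow> log_null \<infinity> J v L" and L: "L \<in> strong_terms n d J"
  shows "log_null \<infinity> J v L"
proof -
  obtain \<alpha> \<iota> \<kappa> i where bounds: "delta_min J \<le> \<alpha>" "\<alpha> + \<iota> + \<kappa> \<le> delta_max J"
    and \<iota>: "\<And>x. \<iota> x = card {m. m < length L \<and> i m = x}"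
    and nth: "\<And>k. k < length L \<Longrightarrow> L ! k = (\<alpha> + \<iota> - \<epsilon> (i k), \<alpha> + \<kappa> + \<epsilon> (i k))"
    by (rule strong_term_cases[OF L]) blast
  let ?K = "active J L"
  have "3 \<le> card ?K \<or> (\<exists>l\<in>?K - {k}. term_value v L l = term_value v L k)" if k: "k \<in> ?K" for k
  proof (cases "3 \<le> card ?K")
    case False
    obtain l where l: "l \<in> ?K" "l \<noteq> k" using active_not_singleton[OF L k] by blast
    have "card ?K \<le> card {k, l}" using False l by simp
    then have K: "?K = {k, l}"
      using k l by (intro card_seteq[symmetric] finite_active) auto
    have kl: "k < length L" "l < length L" using k l by (auto simp: active_def)
    \<comment> \<open>A repetition of \<open>i k\<close> or \<open>i l\<close> has the same pair of
      arguments, so it is active too; with only two active positions, distinct indices cannot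
      repeat.\<close>
    have same: "m \<in> ?K" if "m < length L" "i m = i k \<or> i m = i l" for m
      using that k l(1) nth[of k] nth[of l] nth[of m] by (auto simp: active_def)
    have mem: "\<alpha> + \<iota> - \<epsilon> (i k) \<in> J" "\<alpha> + \<kappa> + \<epsilon> (i k) \<in> J" "\<alpha> + \<iota> - \<epsilon> (i l) \<in> J" "\<alpha> + \<kappa> + \<epsilon> (i l) \<in> J"
      using k l(1) nth by (auto simp: active_def)
    have val: "term_value v L m = v (\<alpha> + \<iota> - \<epsilon> (i m)) + v (\<alpha> + \<kappa> + \<epsilon> (i m))" if "m < length L" for m
      by (simp add: term_value_def nth[OF that])
    have "term_value v L k = term_value v L l"
    proof (cases "i k = i l")
      case True
      then show ?thesis using val kl by simp
    next
      case ne: False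
      have "m = k" if "m < length L" "i m = i k" for m using same[of m] that ne K by auto
      moreover have "m = l" if "m < length L" "i m = i l" for m using same[of m] that ne K by auto
      ultimately have "{m. m < length L \<and> i m = i k} = {k}" "{m. m < length L \<and> i m = i l} = {l}"
        using kl by blast+
      then have one: "\<iota> (i k) = 1" "\<iota> (i l) = 1" by (simp_all add: \<iota>)
      have two: "\<not> (\<alpha> + \<iota> - \<epsilon> x \<in> J \<and> \<alpha> + \<kappa> + \<epsilon> x \<in> J)" if "x \<noteq> i k" "x \<noteq> i l" "\<iota> x > 0" for x
      proof
        assume x: "\<alpha> + \<iota> - \<epsilon> x \<in> J \<and> \<alpha> + \<kappa> + \<epsilon> x \<in> J"
        obtain m where m: "m < length L" "i m = x" using \<open>\<iota> x > 0\<close> unfolding \<iota> by (auto simp: card_gt_0_iff)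
        then have "m \<in> ?K" using x nth[OF m(1)] by (auto simp: active_def)
        then show False using that m(2) unfolding K by auto
      qed
      show ?thesis
        unfolding val[OF kl(1)] val[OF kl(2)]
        by (rule two_term_relation[of v, OF weak_infinity_exchange[OF v] bounds one ne mem two])
    qed
    then show ?thesis using l by auto
  qed simp
  then show ?thesis by (simp add: log_null_def)
qed

lemma log_reps_weak_eq_strong:
  assumes "q = 0 \<or> q = \<infinity>"
  shows "log_reps q J (weak_terms n d J) = log_reps q J (strong_terms n d J)"
  using assms weak_imp_strong_zero weak_imp_strong_infinity weak_subset_strong[of n d J]
  unfolding log_reps_def by blast

end

subsection \<open>Gauges of star-shaped sets\<close>

lemma continuous_map_Euclidean_coord: "continuous_map (Euclidean_space m) euclideanreal (\<lambda>x. x i)"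
  unfolding Euclidean_space_def
  by (intro continuous_map_from_subtopology continuous_map_product_projection UNIV_I)

lemma continuous_map_into_Euclidean:
  assumes "\<And>x. x \<in> topspace X \<Longrightarrow> f x \<in> topspace (Euclidean_space m)"
    and "\<And>i. i < m \<Longrightarrow> continuous_map X euclideanreal (\<lambda>x. f x i)"
  shows "continuous_map X (Euclidean_space m) f"
proof (rule continuous_map_eq)
  show "continuous_map X (Euclidean_space m) (\<lambda>x i. if i < m then f x i else 0)"
    using assms(2) by (simp add: continuous_map_componentwise_Euclidean_space)
  show "(\<lambda>i. if i < m then f x i else 0) = f x" if "x \<in> topspace X" for x
    using assms(1)[OF that] by (auto simp: topspace_Euclidean_space)
qed

lemma openin_less_continuous_map:
  fixes f h :: "'a \<Rightarrow> real"
  assumes "continuous_map X euclideanreal f" "continuous_map X euclideanreal h"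
  shows "openin X {x \<in> topspace X. f x < h x}"
proof -
  have "continuous_map X euclideanreal (\<lambda>x. h x - f x)" using assms by (intro continuous_intros)
  from openin_continuous_map_preimage[OF this, of "{0<..}"] show ?thesis by simp
qed

definition dilate :: "real \<Rightarrow> (nat \<Rightarrow> real) \<Rightarrow> nat \<Rightarrow> real" where
  "dilate t x = (\<lambda>i. t * x i)"

lemma dilate_simps [simp]:
  "dilate s (dilate t x) = dilate (s * t) x" "dilate 1 x = x"
  "x \<in> topspace (Euclidean_space m) \<Longrightarrow> dilate t x \<in> topspace (Euclidean_space m)"
  by (auto simp: dilate_def topspace_Euclidean_space)

lemma continuous_map_dilate: "continuous_map (Euclidean_space m) (Euclidean_space m) (dilate t)"
  unfolding dilate_def
  by (intro continuous_map_into_Euclidean continuous_map_real_mult_left continuous_map_Euclidean_coord)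
    (auto simp: topspace_Euclidean_space)

lemma continuous_map_dilate_scalar:
  assumes "x \<in> topspace (Euclidean_space m)"
  shows "continuous_map euclideanreal (Euclidean_space m) (\<lambda>t. dilate t x)"
  using assms unfolding dilate_def
  by (intro continuous_map_into_Euclidean continuous_map_real_mult_right)
    (auto simp: topspace_Euclidean_space)

lemma openin_scalars:
  assumes "openin (Euclidean_space m) U" "x \<in> topspace (Euclidean_space m)"
  shows "open {t. dilate t x \<in> U}"
  using openin_continuous_map_preimage[OF continuous_map_dilate_scalar[OF assms(2)] assms(1)] by simp

text \<open>The Minkowski functional of \<open>C\<close>, without convexity. Strict sublevel sets
  are unions of dilates of the open set \<open>D\<close>, and for nonnegative levels strict
  superlevel sets are unions of dilates of the complement of \<open>C\<close>; semicontinuity from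
  both sides gives continuity.\<close>

lemma gauge_exists:
  fixes m :: nat and C D :: "(nat \<Rightarrow> real) set"
  defines "E \<equiv> Euclidean_space m"
  assumes D: "D \<subseteq> C" "openin E D" and C: "closedin E C"
    and star: "\<And>x t. x \<in> C \<Longrightarrow> 0 \<le> t \<Longrightarrow> t < 1 \<Longrightarrow> dilate t x \<in> D"
    and zero: "(\<lambda>_. 0) \<in> C"
  shows "\<exists>g. continuous_map E euclideanreal g \<and>
    (\<forall>x\<in>topspace E. 0 \<le> g x \<and> (\<forall>t\<ge>0. g (dilate t x) = t * g x) \<and>
      (x \<in> C \<longleftrightarrow> g x \<le> 1) \<and> (g x = 0 \<longleftrightarrow> (\<forall>t\<ge>0. dilate t x \<in> C)))"
proof -
  define S where "S x = {s. 0 < s \<and> dilate (1 / s) x \<in> C}" for x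
  define g where "g x = Inf (S x)" for x
  have bdd: "bdd_below (S x)" for x by (auto simp: S_def bdd_below_def intro: less_imp_le)
  have zeroD: "(\<lambda>_. 0) \<in> D" using star[OF zero, of 0] by (simp add: dilate_def)
  have ne: "S x \<noteq> {}" if "x \<in> topspace E" for x
  proof -
    have "open {t. dilate t x \<in> D}" using openin_scalars D(2) that unfolding E_def by blast
    moreover have "0 \<in> {t. dilate t x \<in> D}" using zeroD by (simp add: dilate_def)
    ultimately obtain e where e: "0 < e" "\<And>t. \<bar>t\<bar> < e \<Longrightarrow> dilate t x \<in> D"
      unfolding open_dist by (auto simp: dist_real_def)
    then have "dilate (e / 2) x \<in> C" using D by auto
    then have "2 / e \<in> S x" using e by (simp add: S_def)
    then show ?thesis by blast
  qed
  have lt: "dilate (1 / s) x \<in> D" if x: "x \<in> topspace E" and gx: "g x < s" for x s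
  proof -
    obtain s' where "s' \<in> S x" "s' < s"
      using cInf_lessD[OF ne[OF x]] gx unfolding g_def by blast
    then show ?thesis using star[of "dilate (1 / s') x" "s' / s"] by (simp add: S_def)
  qed
  have le: "g x \<le> s" if "dilate (1 / s) x \<in> C" "0 < s" for x s
    unfolding g_def using that bdd by (intro cInf_lower) (auto simp: S_def)
  have pos: "0 \<le> g x" if "x \<in> topspace E" for x
    unfolding g_def using ne[OF that] by (intro cInf_greatest) (auto simp: S_def)
  have C_iff: "x \<in> C \<longleftrightarrow> g x \<le> 1" if x: "x \<in> topspace E" for x
  proof
    show "x \<in> C \<Longrightarrow> g x \<le> 1" using le[of 1 x] by simp
    assume g: "g x \<le> 1"
    show "x \<in> C"
    proof (rule ccontr)
      assume "x \<notin> C"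
      have "openin E (topspace E - C)" using C by blast
      then have "open {t. dilate t x \<in> topspace E - C}" using openin_scalars x unfolding E_def by blast
      moreover have "1 \<in> {t. dilate t x \<in> topspace E - C}" using \<open>x \<notin> C\<close> x by simp
      ultimately have "\<exists>e>0. \<forall>t. dist t 1 < e \<longrightarrow> t \<in> {t. dilate t x \<in> topspace E - C}"
        unfolding open_dist by blast
      then obtain e where e: "0 < e" "\<And>t. \<bar>t - 1\<bar> < e \<Longrightarrow> dilate t x \<notin> C"
        by (auto simp: dist_real_def)
      \<comment> \<open>Close enough to 1 to stay outside \<open>C\<close>, yet \<open>1 / t\<close>
        exceeds 1 and hence \<open>g x\<close>, which puts \<open>dilate t x\<close> into
        \<open>D\<close>. The bound \<open>1 / 2\<close> keeps \<open>t\<close> positive.\<close>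
      define t where "t = max (1 / 2) (1 - e / 2)"
      have t: "0 < t" "t < 1" "\<bar>t - 1\<bar> < e" using e(1) by (auto simp: t_def)
      then have "1 < 1 / t" by simp
      then have "g x < 1 / t" using g by linarith
      then show False using lt[OF x, of "1 / t"] t e D by auto
    qed
  qed
  have homo_le: "g (dilate t x) \<le> t * g x" if x: "x \<in> topspace E" and t: "0 < t" for t x
  proof (rule field_le_epsilon)
    fix e :: real assume "0 < e"
    define s where "s = t * g x + e"
    have s: "0 < s" using pos[OF x] t \<open>0 < e\<close> by (simp add: s_def add_nonneg_pos)
    have "g x < s / t" using t \<open>0 < e\<close> by (simp add: s_def field_simps)
    from lt[OF x this] have "dilate (1 / s) (dilate t x) \<in> C" using D by auto
    from le[OF this s] show "g (dilate t x) \<le> t * g x + e" by (simp add: s_def)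
  qed
  have homo: "g (dilate t x) = t * g x" if x: "x \<in> topspace E" and t: "0 \<le> t" for t x
  proof (cases "t = 0")
    case True
    have 0: "dilate s (dilate 0 x) \<in> C" for s using zero by (simp add: dilate_def)
    have "g (dilate 0 x) \<le> 0"
      by (rule field_le_epsilon) (use le[OF 0] in simp)
    moreover have "0 \<le> g (dilate 0 x)" using pos x by (simp add: E_def)
    ultimately show ?thesis using True by simp
  next
    case False
    have "g (dilate (1 / t) (dilate t x)) \<le> 1 / t * g (dilate t x)"
      using False t x by (intro homo_le) (auto simp: E_def)
    then have "t * g x \<le> g (dilate t x)" using False t by (simp add: field_simps)
    then show ?thesis using homo_le[OF x, of t] False t by simp
  qed
  have zero_iff: "g x = 0 \<longleftrightarrow> (\<forall>t\<ge>0. dilate t x \<in> C)" if x: "x \<in> topspace E" for x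
  proof
    assume "g x = 0"
    then show "\<forall>t\<ge>0. dilate t x \<in> C" using C_iff homo[OF x] x by (simp add: E_def)
  next
    assume *: "\<forall>t\<ge>0. dilate t x \<in> C"
    have "t * g x \<le> 1" if "0 \<le> t" for t
      using * C_iff[of "dilate t x"] homo[OF x that] x that by (simp add: E_def)
    \<comment> \<open>For positive \<open>g x\<close> this scalar would reach level 2, which is
      outside \<open>C\<close>.\<close>
    from this[of "2 / g x"] pos[OF x] show "g x = 0" by (cases "g x = 0") auto
  qed
  have "continuous_map E euclideanreal g"
    unfolding continuous_map_upper_lower_semicontinuous_lt
  proof (intro conjI allI)
    fix a :: real
    have pre: "openin E {x \<in> topspace E. dilate t x \<in> U}" if "openin E U" for t U
      using openin_continuous_map_preimage[OF continuous_map_dilate] that unfolding E_def by blast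
    show "openin E {x \<in> topspace E. a < g x}"
    proof (cases "a < 0")
      case True
      then have "{x \<in> topspace E. a < g x} = topspace E" using pos by force
      then show ?thesis by simp
    next
      case False
      have "{x \<in> topspace E. a < g x} = (\<Union>s\<in>{a<..}. {x \<in> topspace E. dilate (1 / s) x \<in> topspace E - C})"
      proof (intro subset_antisym subsetI)
        fix x assume x: "x \<in> {x \<in> topspace E. a < g x}"
        then obtain s where s: "a < s" "s < g x" using dense by blast
        then have "dilate (1 / s) x \<notin> C" using le[of s x] False by auto
        then show "x \<in> (\<Union>s\<in>{a<..}. {x \<in> topspace E. dilate (1 / s) x \<in> topspace E - C})"
          using s x by (auto simp: E_def)
      next
        fix x assume "x \<in> (\<Union>s\<in>{a<..}. {x \<in> topspace E. dilate (1 / s) x \<in> topspace E - C})"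
        then obtain s where s: "a < s" "x \<in> topspace E" "dilate (1 / s) x \<notin> C" by auto
        then have "s \<le> g x" using lt[of x s] D by (meson not_less subsetD)
        then show "x \<in> {x \<in> topspace E. a < g x}" using s by auto
      qed
      moreover have "openin E (topspace E - C)" using C by blast
      ultimately show ?thesis
        by (simp only:) (rule openin_Union, elim imageE, simp only: pre)
    qed
    show "openin E {x \<in> topspace E. g x < a}"
    proof -
      have "{x \<in> topspace E. g x < a} = (\<Union>s\<in>{0<..<a}. {x \<in> topspace E. dilate (1 / s) x \<in> D})"
      proof (intro subset_antisym subsetI)
        fix x assume x: "x \<in> {x \<in> topspace E. g x < a}"
        then obtain s where s: "g x < s" "s < a" using dense by blast
        then show "x \<in> (\<Union>s\<in>{0<..<a}. {x \<in> topspace E. dilate (1 / s) x \<in> D})"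
          using lt[of x s] pos[of x] x by auto
      next
        fix x assume "x \<in> (\<Union>s\<in>{0<..<a}. {x \<in> topspace E. dilate (1 / s) x \<in> D})"
        then obtain s where s: "0 < s" "s < a" "x \<in> topspace E" "dilate (1 / s) x \<in> D" by auto
        then have "g x \<le> s" using le D by auto
        then show "x \<in> {x \<in> topspace E. g x < a}" using s by auto
      qed
      then show ?thesis using pre[OF D(2)] by auto
    qed
  qed
  then show ?thesis using pos homo C_iff zero_iff by blast
qed

text \<open>If another exponent is at least \<open>y k\<close>, its term alone balances the left
  side and a third term gives strictness; two equal exponents would just stay equal. Otherwise all
  differences \<open>y l - y k\<close> are negative, and shrinking them increases every summand of
  the quotient.\<close>

lemma exp_sum_strict_contraction:
  fixes y :: "'a \<Rightarrow> real"
  assumes K: "finite K" "3 \<le> card K" "k \<in> K" and le: "exp (y k) \<le> (\<Sum>l\<in>K - {k}. exp (y l))"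
    and t: "0 \<le> t" "t < 1"
  shows "exp (t * y k) < (\<Sum>l\<in>K - {k}. exp (t * y l))"
proof -
  have card: "2 \<le> card (K - {k})" using K by simp
  show ?thesis
  proof (cases "\<exists>l\<in>K - {k}. y k \<le> y l")
    case True
    then obtain l where l: "l \<in> K - {k}" "y k \<le> y l" by blast
    have "K - {k} - {l} \<noteq> {}"
    proof
      assume "K - {k} - {l} = {}"
      then have "card (K - {k}) \<le> card {l}" by (intro card_mono) auto
      moreover have "card {l} = 1" by simp
      ultimately show False using card by linarith
    qed
    then have "0 < (\<Sum>j\<in>K - {k} - {l}. exp (t * y j))" using K by (intro sum_pos) auto
    moreover have "exp (t * y k) \<le> exp (t * y l)" using l t by (simp add: mult_left_mono)
    moreover have "(\<Sum>j\<in>K - {k}. exp (t * y j)) = exp (t * y l) + (\<Sum>j\<in>K - {k} - {l}. exp (t * y j))"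
      using l K by (intro sum.remove) auto
    ultimately show ?thesis by linarith
  next
    case False
    have "1 \<le> (\<Sum>l\<in>K - {k}. exp (y l)) / exp (y k)" using le by simp
    also have "\<dots> = (\<Sum>l\<in>K - {k}. exp (y l - y k))" by (simp add: sum_divide_distrib exp_diff)
    also have "\<dots> < (\<Sum>l\<in>K - {k}. exp (t * (y l - y k)))"
    proof (rule sum_strict_mono)
      show "K - {k} \<noteq> {}" using card by (metis card.empty not_numeral_le_zero)
      fix l assume "l \<in> K - {k}"
      then have "y l - y k < 0" using False by (auto simp: not_le)
      then have "(y l - y k) * 1 < (y l - y k) * t" using t by (intro mult_strict_left_mono_neg)
      then show "exp (y l - y k) < exp (t * (y l - y k))" by (simp add: mult.commute)
    qed (use K in auto)
    also have "\<dots> = (\<Sum>l\<in>K - {k}. exp (t * y l)) / exp (t * y k)"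
      by (simp add: sum_divide_distrib exp_diff right_diff_distrib)
    finally show ?thesis by simp
  qed
qed

text \<open>If \<open>y k\<close> were strictly largest, the left side would outgrow the finitely
  many summands as \<open>t\<close> tends to infinity.\<close>

lemma max_attained_of_exp_sums:
  fixes y :: "'a \<Rightarrow> real"
  assumes K: "finite K" "k \<in> K" and p: "0 < p"
    and le: "\<And>t. 0 \<le> t \<Longrightarrow> exp (p * (t * y k)) \<le> (\<Sum>l\<in>K - {k}. exp (p * (t * y l)))"
  shows "\<exists>l\<in>K - {k}. y k \<le> y l"
proof (rule ccontr)
  assume "\<not> ?thesis"
  then have less: "y l < y k" if "l \<in> K - {k}" for l using that by (meson not_le)
  have ne: "K - {k} \<noteq> {}" using le[of 0] by (metis exp_gt_zero not_le order_refl sum.empty)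
  define M where "M = Max (y ` (K - {k}))"
  define N where "N = real (card (K - {k}))"
  have "M \<in> y ` (K - {k})" unfolding M_def using K ne by (intro Max_in) auto
  then have M: "M < y k" using less by auto
  \<comment> \<open>Chosen so that the gap between the exponents becomes \<open>N\<close>, the
    number of summands; \<open>exp N \<le> N\<close> is absurd.\<close>
  define t where "t = N / (p * (y k - M))"
  have t: "0 \<le> t" using p M by (simp add: t_def N_def)
  have "exp (p * (t * y k)) \<le> (\<Sum>l\<in>K - {k}. exp (p * (t * M)))"
  proof (rule order_trans[OF le[OF t] sum_mono])
    fix l assume "l \<in> K - {k}"
    then have "y l \<le> M" unfolding M_def using K by (intro Max_ge) auto
    then show "exp (p * (t * y l)) \<le> exp (p * (t * M))" using p t by (simp add: mult_left_mono)
  qed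
  also have "\<dots> = N * exp (p * (t * M))" by (simp add: N_def)
  finally have "exp (p * (t * y k) - p * (t * M)) \<le> N" by (simp add: exp_diff field_simps)
  also have "p * (t * y k) - p * (t * M) = t * (p * (y k - M))" by (simp add: algebra_simps)
  also have "\<dots> = N" using p M by (simp add: t_def)
  finally show False using exp_ge_add_one_self[of N] by simp
qed

lemma term_value_dilate:
  assumes "k \<in> active J L" "\<And>\<beta>. \<beta> \<in> J \<Longrightarrow> w \<beta> = t * v \<beta>"
  shows "term_value w L k = t * term_value v L k"
  using assms by (auto simp: term_value_def active_def algebra_simps)

text \<open>\<open>\<sigma>\<close> parametrises the ambient space continuously and homogeneously,
  and \<open>null\<close> says that all relations hold there at \<open>\<infinity>\<close>.
  Relations with at most two active terms then hold for \<open>q\<close> as well, so openness has to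
  be drawn from the others only. The gauge vanishes on the rays contained in \<open>C\<close>; these
  are the ones where no active term is strictly dominant.\<close>

lemma log_reps_gauge:
  fixes \<sigma> :: "(nat \<Rightarrow> real) \<Rightarrow> 'a \<Rightarrow> real" and m :: nat
  defines "E \<equiv> Euclidean_space m"
  assumes fin: "finite \<L>" and q: "0 < q" "q < \<infinity>"
    and cont: "\<And>\<beta>. \<beta> \<in> J \<Longrightarrow> continuous_map E euclideanreal (\<lambda>x. \<sigma> x \<beta>)"
    and hom: "\<And>x t \<beta>. x \<in> topspace E \<Longrightarrow> \<beta> \<in> J \<Longrightarrow> \<sigma> (dilate t x) \<beta> = t * \<sigma> x \<beta>"
    and null: "\<And>x L. x \<in> topspace E \<Longrightarrow> L \<in> \<L> \<Longrightarrow> log_null \<infinity> J (\<sigma> x) L"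
  shows "\<exists>g. continuous_map E euclideanreal g \<and>
    (\<forall>x\<in>topspace E. 0 \<le> g x \<and> (\<forall>t\<ge>0. g (dilate t x) = t * g x) \<and>
      ((\<forall>L\<in>\<L>. log_null q J (\<sigma> x) L) \<longleftrightarrow> g x \<le> 1) \<and>
      (g x = 0 \<longleftrightarrow> (\<forall>L\<in>\<L>. log_null 0 J (\<sigma> x) L)))"
proof -
  define p where "p = 1 / enn2real q"
  have p: "0 < p" using q by (simp add: p_def enn2real_positive_iff less_top)
  define y where "y x L = term_value (\<sigma> x) L" for x L
  define K where "K L = active J L" for L :: "('a \<times> 'a) list"
  have finK: "finite (K L)" for L by (simp add: K_def finite_active)
  define lhs where "lhs L k x = exp (p * y x L k)" for L k x
  define rhs where "rhs L k x = (\<Sum>l\<in>K L - {k}. exp (p * y x L l))" for L k x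
  define C where "C = {x \<in> topspace E. \<forall>L\<in>\<L>. \<forall>k\<in>K L. lhs L k x \<le> rhs L k x}"
  \<comment> \<open>Relations with two active terms are left out: they are equalities on the whole
    space, so their strict versions have no solutions.\<close>
  define D where "D = {x \<in> topspace E. \<forall>L\<in>{L \<in> \<L>. 3 \<le> card (K L)}. \<forall>k\<in>K L. lhs L k x < rhs L k x}"
  have q_iff: "log_null q J (\<sigma> x) L \<longleftrightarrow> (\<forall>k\<in>K L. lhs L k x \<le> rhs L k x)" for x L
    using q unfolding log_null_def lhs_def rhs_def K_def y_def p_def by auto
  have zero_iff: "log_null 0 J (\<sigma> x) L \<longleftrightarrow> (\<forall>k\<in>K L. \<exists>l\<in>K L - {k}. y x L k \<le> y x L l)" for x L
    unfolding log_null_def K_def y_def by simp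
  have y_dilate: "y (dilate t x) L k = t * y x L k" if "x \<in> topspace E" "k \<in> K L" for t x L k
    using that hom unfolding y_def K_def by (intro term_value_dilate) auto
  have lhs_dilate: "lhs L k (dilate t x) = exp (p * (t * y x L k))" if "x \<in> topspace E" "k \<in> K L" for t x L k
    using that by (simp add: lhs_def y_dilate)
  have rhs_dilate: "rhs L k (dilate t x) = (\<Sum>l\<in>K L - {k}. exp (p * (t * y x L l)))" if "x \<in> topspace E" for t x L k
    unfolding rhs_def using that by (intro sum.cong refl) (simp add: y_dilate)
  have dil: "dilate t x \<in> topspace E" if "x \<in> topspace E" for t x using that by (simp add: E_def)
  have small: "lhs L k x \<le> rhs L k x" if "x \<in> topspace E" "L \<in> \<L>" "\<not> 3 \<le> card (K L)" "k \<in> K L" for x L k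
  proof -
    have "\<exists>l\<in>K L - {k}. y x L l = y x L k"
      using null[OF that(1,2)] that(3,4) unfolding log_null_def K_def y_def by auto
    then obtain l where "l \<in> K L - {k}" "y x L l = y x L k" by blast
    then show ?thesis unfolding lhs_def rhs_def
      using member_le_sum[of l "K L - {k}" "\<lambda>l. exp (p * y x L l)"] finK by auto
  qed
  have cont_y: "continuous_map E euclideanreal (\<lambda>x. y x L k)" if "k \<in> K L" for L k
    using that unfolding y_def K_def term_value_def active_def by (intro continuous_intros cont) auto
  have cont_exp: "continuous_map E euclideanreal (\<lambda>x. exp (p * y x L k))" if "k \<in> K L" for L k
  proof -
    have "continuous_map euclideanreal euclideanreal (\<lambda>s::real. exp (p * s))"
      by (simp add: continuous_on_exp continuous_on_mult_left continuous_on_id)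
    from continuous_map_compose[OF cont_y[OF that] this] show ?thesis by (simp add: o_def)
  qed
  have cont_lhs: "continuous_map E euclideanreal (lhs L k)" if "k \<in> K L" for L k
    using cont_exp[OF that] unfolding lhs_def .
  have cont_rhs: "continuous_map E euclideanreal (rhs L k)" for L k
    unfolding rhs_def using finK by (intro continuous_map_sum cont_exp) auto
  have "D \<subseteq> C"
    unfolding C_def D_def using small by (force intro: less_imp_le)
  moreover have "openin E D"
  proof -
    define \<U> where "\<U> = (\<lambda>(L, k). {x \<in> topspace E. lhs L k x < rhs L k x}) ` (SIGMA L:{L \<in> \<L>. 3 \<le> card (K L)}. K L)"
    have "openin E (\<Inter>(insert (topspace E) \<U>))"
    proof (rule openin_Inter)
      show "finite (insert (topspace E) \<U>)"
        unfolding \<U>_def using fin finK by (intro finite.insertI finite_imageI finite_SigmaI) auto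
      show "openin E U" if "U \<in> insert (topspace E) \<U>" for U
        using that openin_less_continuous_map[OF cont_lhs cont_rhs] unfolding \<U>_def by auto
    qed auto
    also have "\<Inter>(insert (topspace E) \<U>) = D" unfolding \<U>_def D_def by auto
    finally show ?thesis .
  qed
  moreover have "closedin E C"
  proof -
    have "C = topspace E - (\<Union>L\<in>\<L>. \<Union>k\<in>K L. {x \<in> topspace E. rhs L k x < lhs L k x})"
      unfolding C_def by (auto simp: not_le[symmetric])
    moreover have "openin E (\<Union>L\<in>\<L>. \<Union>k\<in>K L. {x \<in> topspace E. rhs L k x < lhs L k x})"
      by (intro openin_clauses(3) ballI) (auto intro!: openin_clauses(3) openin_less_continuous_map[OF cont_rhs cont_lhs])
    ultimately show ?thesis by (simp only: closedin_diff closedin_topspace)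
  qed
  moreover have "dilate t x \<in> D" if "x \<in> C" "0 \<le> t" "t < 1" for x t
  proof -
    have x: "x \<in> topspace E" using that by (simp add: C_def)
    have "lhs L k (dilate t x) < rhs L k (dilate t x)" if L: "L \<in> \<L>" "3 \<le> card (K L)" "k \<in> K L" for L k
    proof -
      have "lhs L k x \<le> rhs L k x" using \<open>x \<in> C\<close> L by (auto simp: C_def)
      from exp_sum_strict_contraction[OF finK L(2,3) this[unfolded lhs_def rhs_def] \<open>0 \<le> t\<close> \<open>t < 1\<close>]
      show ?thesis by (simp add: lhs_dilate[OF x L(3)] rhs_dilate[OF x] mult.left_commute)
    qed
    then show ?thesis using dil[OF x] by (auto simp: D_def)
  qed
  moreover have "(\<lambda>_. 0) \<in> C"
  proof -
    have x: "(\<lambda>_. 0) \<in> topspace E" by (simp add: E_def topspace_Euclidean_space)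
    have 0: "dilate 0 (\<lambda>_. 0) = (\<lambda>_. 0)" by (simp add: dilate_def)
    have "lhs L k (\<lambda>_. 0) \<le> rhs L k (\<lambda>_. 0)" if "L \<in> \<L>" "k \<in> K L" for L k
    proof (cases "3 \<le> card (K L)")
      case True
      \<comment> \<open>At the origin all exponentials are 1, so the inequality merely counts
        summands.\<close>
      then have "1 \<le> card (K L - {k})" using that(2) finK by simp
      then show ?thesis
        using lhs_dilate[OF x that(2), of 0] rhs_dilate[OF x, of L k 0] unfolding 0 by simp
    qed (use small[OF x] that in auto)
    then show ?thesis using x by (simp add: C_def)
  qed
  ultimately have "\<exists>g. continuous_map E euclideanreal g \<and>
    (\<forall>x\<in>topspace E. 0 \<le> g x \<and> (\<forall>t\<ge>0. g (dilate t x) = t * g x) \<and>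
      (x \<in> C \<longleftrightarrow> g x \<le> 1) \<and> (g x = 0 \<longleftrightarrow> (\<forall>t\<ge>0. dilate t x \<in> C)))"
    unfolding E_def by (rule gauge_exists)
  moreover have "x \<in> C \<longleftrightarrow> (\<forall>L\<in>\<L>. log_null q J (\<sigma> x) L)" if "x \<in> topspace E" for x
    using that by (auto simp: C_def q_iff)
  moreover have "(\<forall>t\<ge>0. dilate t x \<in> C) \<longleftrightarrow> (\<forall>L\<in>\<L>. log_null 0 J (\<sigma> x) L)" if x: "x \<in> topspace E" for x
  proof
    assume *: "\<forall>t\<ge>0. dilate t x \<in> C"
    show "\<forall>L\<in>\<L>. log_null 0 J (\<sigma> x) L"
      unfolding zero_iff
    proof (intro ballI)
      fix L k assume L: "L \<in> \<L>" "k \<in> K L"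
      have "exp (p * (t * y x L k)) \<le> (\<Sum>l\<in>K L - {k}. exp (p * (t * y x L l)))" if "0 \<le> t" for t
      proof -
        have "lhs L k (dilate t x) \<le> rhs L k (dilate t x)" using * that L unfolding C_def by blast
        then show ?thesis by (simp only: lhs_dilate[OF x L(2)] rhs_dilate[OF x])
      qed
      from max_attained_of_exp_sums[OF finK L(2) p this]
      show "\<exists>l\<in>K L - {k}. y x L k \<le> y x L l" .
    qed
  next
    assume *: "\<forall>L\<in>\<L>. log_null 0 J (\<sigma> x) L"
    have "lhs L k (dilate t x) \<le> rhs L k (dilate t x)" if t: "0 \<le> t" and L: "L \<in> \<L>" "k \<in> K L" for t L k
    proof -
      obtain l where l: "l \<in> K L - {k}" "y x L k \<le> y x L l"
        using bspec[OF * L(1), unfolded zero_iff, rule_format, OF L(2)] by (elim bexE)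
      have "exp (p * (t * y x L k)) \<le> exp (p * (t * y x L l))"
        using l(2) p t by (simp add: mult_left_mono)
      also have "\<dots> \<le> (\<Sum>l\<in>K L - {k}. exp (p * (t * y x L l)))"
        using l(1) finK by (intro member_le_sum) auto
      finally show ?thesis by (simp add: lhs_dilate[OF x L(2)] rhs_dilate[OF x])
    qed
    then show "\<forall>t\<ge>0. dilate t x \<in> C" using dil[OF x] by (auto simp: C_def)
  qed
  ultimately show ?thesis by simp
qed

text \<open>Both sides are parametrised by rays from the origin: on a ray with \<open>N = a s\<close> and \<open>g = b s\<close>, the
  map is \<open>s \<mapsto> s / (1 + (a - b) s)\<close>, which sends \<open>g = 1\<close> to \<open>N = 1\<close>.\<close>

lemma gauge_ball_homeomorphic:
  fixes m :: nat and N g :: "(nat \<Rightarrow> real) \<Rightarrow> real"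
  defines "E \<equiv> Euclidean_space m"
  assumes g: "continuous_map E euclideanreal g" "\<And>x. x \<in> topspace E \<Longrightarrow> 0 \<le> g x"
    "\<And>x t. x \<in> topspace E \<Longrightarrow> 0 \<le> t \<Longrightarrow> g (dilate t x) = t * g x"
    and N: "continuous_map E euclideanreal N" "\<And>x. x \<in> topspace E \<Longrightarrow> 0 \<le> N x"
    "\<And>x t. x \<in> topspace E \<Longrightarrow> 0 \<le> t \<Longrightarrow> N (dilate t x) = t * N x"
    and gN: "\<And>x. x \<in> topspace E \<Longrightarrow> N x = 0 \<Longrightarrow> g x = 0"
  shows "subtopology E {x. g x \<le> 1} homeomorphic_space
    subtopology E {x. N x \<le> 1 \<and> \<not> (N x = 1 \<and> g x = 0)}"
proof -
  let ?G = "{x. g x \<le> 1}" and ?B = "{x. N x \<le> 1 \<and> \<not> (N x = 1 \<and> g x = 0)}"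
  define f where "f x = dilate (inverse (1 + N x - g x)) x" for x
  define h where "h x = dilate (inverse (1 - N x + g x)) x" for x
  have dil: "dilate t x \<in> topspace E" if "x \<in> topspace E" for t x using that by (simp add: E_def)
  \<comment> \<open>The denominator could vanish only for \<open>N x = 0\<close> and
    \<open>g x = 1\<close>, which \<open>gN\<close> excludes. For the inverse map the removed points
    are exactly those of the ball where the denominator vanishes.\<close>
  have a: "0 < 1 + N x - g x" if "x \<in> topspace E" "g x \<le> 1" for x
    using that N(2)[of x] g(2)[of x] gN[of x] by (cases "N x = 0") auto
  have b: "0 < 1 - N x + g x" if "x \<in> topspace E" "N x \<le> 1" "\<not> (N x = 1 \<and> g x = 0)" for x
    using that N(2)[of x] g(2)[of x] by (cases "g x = 0") auto
  have f: "f x \<in> topspace E" "N (f x) = N x / (1 + N x - g x)" "g (f x) = g x / (1 + N x - g x)"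
    if "x \<in> topspace E" "g x \<le> 1" for x
    using a[OF that] g(3)[OF that(1)] N(3)[OF that(1)] dil[OF that(1)]
    by (auto simp: f_def divide_inverse mult.commute)
  have h: "h x \<in> topspace E" "N (h x) = N x / (1 - N x + g x)" "g (h x) = g x / (1 - N x + g x)"
    if "x \<in> topspace E" "N x \<le> 1" "\<not> (N x = 1 \<and> g x = 0)" for x
    using b[OF that] g(3)[OF that(1)] N(3)[OF that(1)] dil[OF that(1)]
    by (auto simp: h_def divide_inverse mult.commute)
  have cont_dilate: "continuous_map (subtopology E S) E (\<lambda>x. dilate (c x) x)"
    if "continuous_map (subtopology E S) euclideanreal c" for S c
    unfolding E_def
  proof (rule continuous_map_into_Euclidean)
    show "dilate (c x) x \<in> topspace (Euclidean_space m)"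
      if "x \<in> topspace (subtopology (Euclidean_space m) S)" for x
      using that dil by (simp add: E_def)
    show "continuous_map (subtopology (Euclidean_space m) S) euclideanreal (\<lambda>x. dilate (c x) x i)" for i
      using that unfolding dilate_def E_def
      by (intro continuous_map_real_mult continuous_map_from_subtopology[OF continuous_map_Euclidean_coord])
  qed
  have "homeomorphic_maps (subtopology E ?G) (subtopology E ?B) f h"
    unfolding homeomorphic_maps_def
  proof (intro conjI ballI)
    show "continuous_map (subtopology E ?G) (subtopology E ?B) f"
      unfolding continuous_map_in_subtopology
    proof
      show "continuous_map (subtopology E ?G) E f"
        unfolding f_def
        by (intro cont_dilate continuous_map_real_inverse continuous_intros continuous_map_from_subtopology g N)
          (use a in force)
      show "f \<in> topspace (subtopology E ?G) \<rightarrow> ?B"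
      proof
        fix x assume x: "x \<in> topspace (subtopology E ?G)"
        then show "f x \<in> ?B" using f(2,3)[of x] a[of x] by (auto simp: divide_le_eq_1 divide_eq_eq)
      qed
    qed
    show "continuous_map (subtopology E ?B) (subtopology E ?G) h"
      unfolding continuous_map_in_subtopology
    proof
      show "continuous_map (subtopology E ?B) E h"
        unfolding h_def
        by (intro cont_dilate continuous_map_real_inverse continuous_intros continuous_map_from_subtopology g N)
          (use b in force)
      show "h \<in> topspace (subtopology E ?B) \<rightarrow> ?G"
      proof
        fix x assume x: "x \<in> topspace (subtopology E ?B)"
        then show "h x \<in> ?G" using h(3)[of x] b[of x] by (auto simp: divide_le_eq_1)
      qed
    qed
    fix x assume x: "x \<in> topspace (subtopology E ?G)"
    then have x': "x \<in> topspace E" "g x \<le> 1" by auto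
    \<comment> \<open>\<open>N\<close> and \<open>g\<close> scale by the same factor, so the
      denominator of \<open>h\<close> at \<open>f x\<close> is the reciprocal of the one of
      \<open>f\<close> at \<open>x\<close>.\<close>
    have "1 - N (f x) + g (f x) = inverse (1 + N x - g x)"
      unfolding f(2,3)[OF x'] using a[OF x'] by (simp add: field_simps)
    then show "h (f x) = x" unfolding h_def using a[OF x'] by (simp add: f_def)
  next
    fix x assume x: "x \<in> topspace (subtopology E ?B)"
    then have x': "x \<in> topspace E" "N x \<le> 1" "\<not> (N x = 1 \<and> g x = 0)" by auto
    have "1 + N (h x) - g (h x) = inverse (1 - N x + g x)"
      unfolding h(2,3)[OF x'] using b[OF x'] by (simp add: field_simps)
    then show "f (h x) = x" unfolding f_def using b[OF x'] by (simp add: h_def)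
  qed
  then show ?thesis by (rule homeomorphic_maps_imp_homeomorphic_space)
qed

text \<open>\<open>T\<close> and \<open>f\<close> have the same fibres, so \<open>T\<close> descends
  to the quotient, and the continuous section \<open>s\<close> supplies the inverse. Points of the
  quotient are only known as values of \<open>f\<close>, whence the choice of a
  representative.\<close>

lemma quotient_topology_homeomorphic:
  assumes T: "continuous_map X Y T" and s: "continuous_map Y X s"
    and Ts: "\<And>y. y \<in> topspace Y \<Longrightarrow> T (s y) = y"
    and fibres: "\<And>x x'. x \<in> topspace X \<Longrightarrow> x' \<in> topspace X \<Longrightarrow> f x = f x' \<longleftrightarrow> T x = T x'"
  shows "homeomorphic_maps Y (quotient_topology X f) (f \<circ> s) (\<lambda>A. T (SOME x. x \<in> topspace X \<and> f x = A))"
proof -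
  let ?k = "\<lambda>A. T (SOME x. x \<in> topspace X \<and> f x = A)"
  have k: "?k (f x) = T x" if "x \<in> topspace X" for x
  proof -
    have "(SOME x'. x' \<in> topspace X \<and> f x' = f x) \<in> topspace X \<and> f (SOME x'. x' \<in> topspace X \<and> f x' = f x) = f x"
      by (rule someI[of _ x]) (use that in simp)
    then show ?thesis using fibres that by blast
  qed
  have sX: "s y \<in> topspace X" if "y \<in> topspace Y" for y
    using s that by (auto simp: continuous_map_def)
  have TY: "T x \<in> topspace Y" if "x \<in> topspace X" for x
    using T that by (auto simp: continuous_map_def)
  have q: "quotient_map X (quotient_topology X f) f" by (rule quotient_map_quotient_topology)
  show ?thesis
    unfolding homeomorphic_maps_def
  proof (intro conjI ballI)
    show "continuous_map Y (quotient_topology X f) (f \<circ> s)"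
      by (rule continuous_map_compose[OF s quotient_imp_continuous_map[OF q]])
    have "continuous_map X Y (?k \<circ> f)"
      by (rule continuous_map_eq[OF T]) (simp add: k)
    then show "continuous_map (quotient_topology X f) Y ?k"
      by (simp only: continuous_compose_quotient_map_eq[OF q])
    show "?k ((f \<circ> s) y) = y" if "y \<in> topspace Y" for y
      using k[OF sX[OF that]] Ts[OF that] by simp
    show "(f \<circ> s) (?k A) = A" if A: "A \<in> topspace (quotient_topology X f)" for A
    proof -
      obtain x where x: "x \<in> topspace X" "A = f x"
        using A by (auto simp: topspace_quotient_topology)
      then show ?thesis using k fibres sX TY Ts by simp
    qed
  qed
qed

subsection \<open>Coordinates on a space of functions modulo constants\<close>

text \<open>Meant for \<open>VQ\<close>, a bare record of operations: the axioms are transported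
  from \<open>\<real>^m\<close> along \<open>k\<close>, and the images of the unit vectors form a
  basis. This identifies the Tutte rank with the number of coordinates.\<close>

lemma coordinate_vectorspace:
  fixes M :: "(real, 'v) module" and k :: "(nat \<Rightarrow> real) \<Rightarrow> 'v" and m :: nat
  defines "E \<equiv> topspace (Euclidean_space m)"
  assumes bij: "bij_betw k E (carrier M)"
    and zero: "k (\<lambda>_. 0) = \<zero>\<^bsub>M\<^esub>"
    and add: "\<And>x y. x \<in> E \<Longrightarrow> y \<in> E \<Longrightarrow> k x \<oplus>\<^bsub>M\<^esub> k y = k (\<lambda>i. x i + y i)"
    and smult: "\<And>r x. x \<in> E \<Longrightarrow> r \<odot>\<^bsub>M\<^esub> k x = k (dilate r x)"
  shows "vectorspace class_ring M" "vectorspace.dim class_ring M = m"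
proof -
  have carrier: "carrier M = k ` E" using bij by (simp add: bij_betw_def)
  have inj: "inj_on k E" using bij by (simp add: bij_betw_def)
  have closed: "(\<lambda>_. 0) \<in> E" "\<And>x y. x \<in> E \<Longrightarrow> y \<in> E \<Longrightarrow> (\<lambda>i. x i + y i) \<in> E"
    "\<And>r x. x \<in> E \<Longrightarrow> dilate r x \<in> E"
    by (auto simp: E_def topspace_Euclidean_space dilate_def)
  have "\<zero>\<^bsub>M\<^esub> \<in> carrier M" using zero closed(1) unfolding carrier by (metis image_eqI)
  moreover have "v \<oplus>\<^bsub>M\<^esub> w \<in> carrier M" if "v \<in> carrier M" "w \<in> carrier M" for v w
    using that add closed(2) unfolding carrier by auto
  moreover have "\<exists>u\<in>carrier M. v \<oplus>\<^bsub>M\<^esub> u = \<zero>\<^bsub>M\<^esub>" if v: "v \<in> carrier M" for v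
  proof -
    obtain x where x: "x \<in> E" "v = k x" using v unfolding carrier by blast
    have "k x \<oplus>\<^bsub>M\<^esub> k (dilate (-1) x) = \<zero>\<^bsub>M\<^esub>"
      unfolding add[OF x(1) closed(3)[OF x(1)]] zero[symmetric] by (simp add: dilate_def)
    then show ?thesis using x closed(3) unfolding carrier by blast
  qed
  moreover have "c \<odot>\<^bsub>M\<^esub> v \<in> carrier M" if "v \<in> carrier M" for c v
    using that smult closed(3) unfolding carrier by auto
  moreover have "v \<oplus>\<^bsub>M\<^esub> w = w \<oplus>\<^bsub>M\<^esub> v" if "v \<in> carrier M" "w \<in> carrier M" for v w
    using that add unfolding carrier by (auto simp: add.commute)
  moreover have "(v \<oplus>\<^bsub>M\<^esub> w) \<oplus>\<^bsub>M\<^esub> u = v \<oplus>\<^bsub>M\<^esub> (w \<oplus>\<^bsub>M\<^esub> u)"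
    if "v \<in> carrier M" "w \<in> carrier M" "u \<in> carrier M" for v w u
    using that add closed(2) unfolding carrier by (auto simp: add.assoc)
  moreover have "v \<oplus>\<^bsub>M\<^esub> \<zero>\<^bsub>M\<^esub> = v" if "v \<in> carrier M" for v
    using that add closed(1) unfolding carrier zero[symmetric] by auto
  moreover have "(a * b) \<odot>\<^bsub>M\<^esub> v = a \<odot>\<^bsub>M\<^esub> (b \<odot>\<^bsub>M\<^esub> v)" if "v \<in> carrier M" for a b v
    using that smult closed(3) unfolding carrier by auto
  moreover have "1 \<odot>\<^bsub>M\<^esub> v = v" if "v \<in> carrier M" for v
    using that smult unfolding carrier by auto
  moreover have "(a + b) \<odot>\<^bsub>M\<^esub> v = (a \<odot>\<^bsub>M\<^esub> v) \<oplus>\<^bsub>M\<^esub> (b \<odot>\<^bsub>M\<^esub> v)" if "v \<in> carrier M" for a b v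
    using that smult add closed(3) unfolding carrier by (auto simp: dilate_def distrib_right)
  moreover have "a \<odot>\<^bsub>M\<^esub> (v \<oplus>\<^bsub>M\<^esub> w) = (a \<odot>\<^bsub>M\<^esub> v) \<oplus>\<^bsub>M\<^esub> (a \<odot>\<^bsub>M\<^esub> w)"
    if "v \<in> carrier M" "w \<in> carrier M" for a v w
    using that smult add closed(2,3) unfolding carrier by (auto simp: dilate_def distrib_left)
  ultimately show vs: "vectorspace class_ring M"
    by (intro vs_criteria) (auto simp: class_field)
  interpret vectorspace class_ring M by (rule vs)
  define u where "u i = (\<lambda>j. if j = i then 1 else 0 :: real)" for i :: nat
  define h where "h i = k (u i)" for i
  have u: "u i \<in> E" if "i < m" for i
    using that by (auto simp: u_def E_def topspace_Euclidean_space)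
  have inj_h: "inj_on h {..<m}"
  proof (rule inj_onI)
    fix i j assume "i \<in> {..<m}" "j \<in> {..<m}" "h i = h j"
    then have "u i = u j" using inj u unfolding h_def by (auto simp: inj_on_def)
    then have "u i i = u j i" by simp
    then show "i = j" by (simp add: u_def split: if_splits)
  qed
  have h_carrier: "h ` {..<m} \<subseteq> carrier M" using u by (auto simp: h_def carrier)
  have lincomb: "lincomb a (h ` F) = k (\<lambda>i. if i \<in> F then a (h i) else 0)"
    if "finite F" "F \<subseteq> {..<m}" for a F
    using that
  proof (induction F rule: finite_induct)
    case empty
    then show ?case by (simp add: lincomb_def zero)
  next
    case (insert i F)
    have ni: "h i \<notin> h ` F" using insert inj_h by (auto simp: inj_on_def)
    have E: "(\<lambda>i. if i \<in> F then a (h i) else 0) \<in> E"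
      using insert by (auto simp: E_def topspace_Euclidean_space)
    have "lincomb a (insert (h i) (h ` F)) = a (h i) \<odot>\<^bsub>M\<^esub> h i \<oplus>\<^bsub>M\<^esub> lincomb a (h ` F)"
      unfolding lincomb_def using insert ni h_carrier
      by (intro finsum_insert) (auto intro!: smult_closed)
    also have "\<dots> = k (\<lambda>j. dilate (a (h i)) (u i) j + (if j \<in> F then a (h j) else 0))"
      using insert u[of i] E closed by (simp add: h_def smult add)
    also have "(\<lambda>j. dilate (a (h i)) (u i) j + (if j \<in> F then a (h j) else 0)) =
        (\<lambda>j. if j \<in> insert i F then a (h j) else 0)"
      using insert by (auto simp: fun_eq_iff dilate_def u_def)
    finally show ?case by simp
  qed
  have "lin_indpt (h ` {..<m})"
  proof (rule finite_lin_indpt2)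
    fix a assume "lincomb a (h ` {..<m}) = \<zero>\<^bsub>M\<^esub>"
    then have "k (\<lambda>i. if i \<in> {..<m} then a (h i) else 0) = k (\<lambda>_. 0)"
      using lincomb[of "{..<m}" a] zero by simp
    then have "(\<lambda>i. if i \<in> {..<m} then a (h i) else 0) = (\<lambda>_. 0)"
      by (rule inj_onD[OF inj]) (auto simp: E_def topspace_Euclidean_space)
    then show "\<forall>v\<in>h ` {..<m}. a v = \<zero>\<^bsub>class_ring\<^esub>" by (auto simp: fun_eq_iff) metis
  qed (use h_carrier in auto)
  moreover have "span (h ` {..<m}) = carrier M"
  proof
    show "span (h ` {..<m}) \<subseteq> carrier M" using h_carrier by (rule span_is_subset2)
    show "carrier M \<subseteq> span (h ` {..<m})"
    proof
      fix v assume "v \<in> carrier M"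
      then obtain x where x: "x \<in> E" "v = k x" unfolding carrier by blast
      define a where "a w = x (inv_into {..<m} h w)" for w
      have "a (h i) = x i" if "i < m" for i using that inj_h by (simp add: a_def)
      then have "(\<lambda>i. if i \<in> {..<m} then a (h i) else 0) = x"
        using x(1) by (auto simp: fun_eq_iff E_def topspace_Euclidean_space)
      then have "v = lincomb a (h ` {..<m})" using lincomb[of "{..<m}" a] x by simp
      then show "v \<in> span (h ` {..<m})" unfolding span_def by auto
    qed
  qed
  ultimately have "basis (h ` {..<m})" using h_carrier by (simp add: basis_def)
  then have "dim = card (h ` {..<m})" by (intro dim_basis) auto
  then show "dim = m" using card_image[OF inj_h] by simp
qed

text \<open>The coordinates \<open>e i\<close> form a maximal set on which \<open>V\<close> admits dual vectors.\<close>

lemma echelon_basis: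
  fixes V :: "('a \<Rightarrow> real) set"
  assumes J: "finite J" and V: "V \<subseteq> J \<rightarrow>\<^sub>E UNIV" and zero: "(\<lambda>\<alpha>\<in>J. 0) \<in> V"
    and lin: "\<And>u v c. u \<in> V \<Longrightarrow> v \<in> V \<Longrightarrow> (\<lambda>\<alpha>\<in>J. u \<alpha> + c * v \<alpha>) \<in> V"
  shows "\<exists>(m::nat) e b. (\<forall>i<m. e i \<in> J \<and> b i \<in> V \<and> (\<forall>k<m. b i (e k) = (if k = i then 1 else 0))) \<and>
    (\<forall>v\<in>V. \<forall>\<alpha>\<in>J. v \<alpha> = (\<Sum>i<m. v (e i) * b i \<alpha>))"
proof -
  define dual where "dual P s \<longleftrightarrow> (\<forall>p\<in>P. s p \<in> V \<and> (\<forall>p'\<in>P. s p p' = (if p' = p then 1 else 0)))"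
    for P and s :: "'a \<Rightarrow> 'a \<Rightarrow> real"
  have "\<exists>P. (P \<subseteq> J \<and> (\<exists>s. dual P s)) \<and> (\<forall>Q. Q \<subseteq> J \<and> (\<exists>s. dual Q s) \<longrightarrow> card Q \<le> card P)"
  proof (rule ex_has_greatest_nat)
    show "{} \<subseteq> J \<and> (\<exists>s. dual {} s)" by (simp add: dual_def)
    show "\<forall>Q. Q \<subseteq> J \<and> (\<exists>s. dual Q s) \<longrightarrow> card Q < Suc (card J)"
      using J card_mono by (auto simp: less_Suc_eq_le)
  qed
  then obtain P s where P: "P \<subseteq> J" and s: "dual P s"
    and max: "\<And>Q s. Q \<subseteq> J \<Longrightarrow> dual Q s \<Longrightarrow> card Q \<le> card P" by blast
  have finP: "finite P" using P J finite_subset by blast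
  have comb: "(\<lambda>\<alpha>\<in>J. v \<alpha> - (\<Sum>p\<in>F. v p * s p \<alpha>)) \<in> V" if "finite F" "F \<subseteq> P" "v \<in> V" for v F
    using that
  proof (induction F rule: finite_induct)
    case empty
    have eq: "(\<lambda>\<alpha>\<in>J. v \<alpha> - (\<Sum>p\<in>{}. v p * s p \<alpha>)) = (\<lambda>\<alpha>\<in>J. v \<alpha> + 0 * v \<alpha>)" by auto
    show ?case unfolding eq by (rule lin[OF empty(2,2)])
  next
    case (insert q F)
    have IH: "(\<lambda>\<alpha>\<in>J. v \<alpha> - (\<Sum>p\<in>F. v p * s p \<alpha>)) \<in> V" "s q \<in> V"
      using insert.IH insert.prems s unfolding dual_def by blast+
    have eq: "(\<lambda>\<alpha>\<in>J. v \<alpha> - (\<Sum>p\<in>insert q F. v p * s p \<alpha>)) =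
      (\<lambda>\<alpha>\<in>J. (\<lambda>\<alpha>\<in>J. v \<alpha> - (\<Sum>p\<in>F. v p * s p \<alpha>)) \<alpha> + - v q * s q \<alpha>)"
      using insert by (auto simp: fun_eq_iff)
    show ?case unfolding eq by (rule lin[OF IH])
  qed
  have expand: "v \<alpha> = (\<Sum>p\<in>P. v p * s p \<alpha>)" if v: "v \<in> V" and \<alpha>: "\<alpha> \<in> J" for v \<alpha>
  proof (rule ccontr)
    assume ne: "v \<alpha> \<noteq> (\<Sum>p\<in>P. v p * s p \<alpha>)"
    \<comment> \<open>The residual of the expansion lies in \<open>V\<close> and vanishes on
      \<open>P\<close>. If it is nonzero at \<open>\<alpha>\<close>, it extends the dual system by
      \<open>\<alpha>\<close>, against maximality.\<close>
    define w where "w = (\<lambda>\<alpha>\<in>J. v \<alpha> - (\<Sum>p\<in>P. v p * s p \<alpha>))"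
    have w: "w \<in> V" unfolding w_def using comb[OF finP subset_refl v] .
    have w\<alpha>: "w \<alpha> \<noteq> 0" using ne \<alpha> by (simp add: w_def)
    have wP: "w p = 0" if "p \<in> P" for p
    proof -
      have "(\<Sum>p'\<in>P. v p' * s p' p) = (\<Sum>p'\<in>P. if p' = p then v p' else 0)"
        using s that by (intro sum.cong) (auto simp: dual_def)
      then show ?thesis using that P finP by (auto simp: w_def)
    qed
    have \<alpha>P: "\<alpha> \<notin> P" using wP w\<alpha> by auto
    \<comment> \<open>\<open>w\<close> normalised at \<open>\<alpha>\<close> is the new dual vector;
      subtracting multiples of \<open>w\<close> clears the old ones at \<open>\<alpha>\<close> and
      keeps their values on \<open>P\<close>.\<close>
    define s' where "s' p = (if p = \<alpha> then (\<lambda>\<beta>\<in>J. (\<lambda>\<alpha>\<in>J. 0) \<beta> + 1 / w \<alpha> * w \<beta>)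
      else (\<lambda>\<beta>\<in>J. s p \<beta> + - (s p \<alpha> / w \<alpha>) * w \<beta>))" for p
    have "dual (insert \<alpha> P) s'"
      unfolding dual_def
    proof (intro ballI conjI)
      fix p assume p: "p \<in> insert \<alpha> P"
      show "s' p \<in> V"
      proof (cases "p = \<alpha>")
        case True
        show ?thesis unfolding s'_def if_P[OF True] by (rule lin[OF zero w])
      next
        case False
        then have "s p \<in> V" using p s by (auto simp: dual_def)
        then show ?thesis unfolding s'_def if_not_P[OF False] by (rule lin[OF _ w])
      qed
      fix p' assume p': "p' \<in> insert \<alpha> P"
      then have "p' \<in> J" using P \<alpha> by auto
      then show "s' p p' = (if p' = p then 1 else 0)"
        using p p' w\<alpha> wP s \<alpha>P \<alpha> by (auto simp: s'_def dual_def)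
    qed
    then have "card (insert \<alpha> P) \<le> card P" using P \<alpha> by (intro max) auto
    then show False using \<alpha>P finP by simp
  qed
  obtain e where e: "bij_betw e {..<card P} P"
    using ex_bij_betw_nat_finite[OF finP] by (auto simp: atLeast0LessThan)
  have eP: "e i \<in> P" if "i < card P" for i using e that by (auto simp: bij_betw_def)
  have "(\<forall>i<card P. e i \<in> J \<and> s (e i) \<in> V \<and> (\<forall>k<card P. s (e i) (e k) = (if k = i then 1 else 0)))"
  proof (intro allI impI conjI)
    fix i k assume i: "i < card P" and k: "k < card P"
    have "e k = e i \<longleftrightarrow> k = i" using e i k by (auto simp: bij_betw_def inj_on_def)
    then show "s (e i) (e k) = (if k = i then 1 else 0)" using s eP i k by (auto simp: dual_def)
  qed (use eP P s in \<open>auto simp: dual_def\<close>)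
  moreover have "\<forall>v\<in>V. \<forall>\<alpha>\<in>J. v \<alpha> = (\<Sum>i<card P. v (e i) * s (e i) \<alpha>)"
    using expand sum.reindex_bij_betw[OF e, of "\<lambda>p. v p * s p \<alpha>" for v \<alpha>] by simp
  ultimately have *: "(\<forall>i<card P. e i \<in> J \<and> s (e i) \<in> V \<and> (\<forall>k<card P. s (e i) (e k) = (if k = i then 1 else 0))) \<and>
      (\<forall>v\<in>V. \<forall>\<alpha>\<in>J. v \<alpha> = (\<Sum>i<card P. v (e i) * s (e i) \<alpha>))" by (rule conjI)
  show ?thesis
    by (rule exI[of _ "card P"], rule exI[of _ e], rule exI[of _ "\<lambda>i. s (e i)"]) (rule *)
qed

subsection \<open>Balls as manifolds with boundary\<close>

lemma second_countable_Euclidean_space: "second_countable (Euclidean_space m)"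
proof -
  obtain \<B> :: "(nat \<Rightarrow> real) set set" where \<B>: "countable \<B>" "topological_basis \<B>"
    using ex_countable_basis by blast
  have "second_countable (euclidean :: (nat \<Rightarrow> real) topology)"
    unfolding second_countable_def
  proof (intro exI[of _ \<B>] conjI ballI allI impI)
    show "openin euclidean V" if "V \<in> \<B>" for V
      using that \<B>(2) by (simp add: topological_basis_open)
    show "\<exists>V\<in>\<B>. x \<in> V \<and> V \<subseteq> U" if "openin euclidean U \<and> x \<in> U" for U x
      using that topological_basisE[OF \<B>(2), of U x] by (metis open_openin)
  qed (rule \<B>(1))
  then show ?thesis
    unfolding Euclidean_space_def euclidean_product_topology[symmetric] by (rule second_countable_subtopology)
qed

lemma manifold_with_boundary_homeomorphic:
  assumes "X homeomorphic_space Y" "manifold_with_boundary m Y"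
  shows "manifold_with_boundary m X"
proof -
  obtain f where f: "homeomorphic_map X Y f" using assms(1) homeomorphic_space by blast
  then obtain g where fg: "homeomorphic_maps X Y f g" unfolding homeomorphic_map_maps by blast
  have "homeomorphic_map Y X g" using fg homeomorphic_maps_map by blast
  have "Hausdorff_space X" using assms homeomorphic_Hausdorff_space unfolding manifold_with_boundary_def by blast
  moreover have "second_countable X"
    using assms(2) second_countable_open_map_image[of Y X g] \<open>homeomorphic_map Y X g\<close>
    unfolding manifold_with_boundary_def
    by (simp add: homeomorphic_eq_everything_map)
  moreover have "\<exists>U W. openin X U \<and> x \<in> U \<and> openin (half_space m) W \<and>
        subtopology X U homeomorphic_space subtopology (half_space m) W" if x: "x \<in> topspace X" for x
  proof -
    have "f x \<in> topspace Y" using f x homeomorphic_imp_surjective_map by blast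
    then obtain U W where UW: "openin Y U" "f x \<in> U" "openin (half_space m) W"
        "subtopology Y U homeomorphic_space subtopology (half_space m) W"
      using assms(2) unfolding manifold_with_boundary_def by blast
    let ?U = "{y \<in> topspace X. f y \<in> U}"
    have "openin X ?U"
      using openin_continuous_map_preimage[OF homeomorphic_imp_continuous_map[OF f] UW(1)] .
    moreover have "f ` (topspace X \<inter> ?U) = topspace Y \<inter> U"
      using homeomorphic_imp_surjective_map[OF f] by auto
    then have "subtopology X ?U homeomorphic_space subtopology Y U"
      by (rule homeomorphic_map_imp_homeomorphic_space[OF homeomorphic_map_subtopologies[OF f]])
    then have "subtopology X ?U homeomorphic_space subtopology (half_space m) W"
      using UW(4) by (rule homeomorphic_space_trans)
    ultimately show ?thesis using UW(2,3) x by blast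
  qed
  ultimately show ?thesis by (simp add: manifold_with_boundary_def)
qed

text \<open>Inversion at a boundary point \<open>p\<close> of the ball, with \<open>p = c e\<^sub>0\<close> and \<open>c = \<plusminus>1\<close>, maps the rest of
  the ball to a half-space.\<close>

lemma cball_minus_point_homeomorphic_half_space:
  fixes c :: real
  assumes m: "0 < m" and c: "c * c = 1"
  defines "p \<equiv> \<lambda>i. if i = 0 then c else (0::real)"
  shows "subtopology (Euclidean_cball m) (- {p}) homeomorphic_space half_space m"
proof -
  let ?E = "Euclidean_space m"
  define S where "S x = (\<Sum>i\<in>{1..<m}. (x i)\<^sup>2)" for x :: "nat \<Rightarrow> real"
  have S0: "0 \<le> S x" for x by (simp add: S_def sum_nonneg)
  have norm: "(\<Sum>i<m. (x i)\<^sup>2) = (x 0)\<^sup>2 + S x" for x :: "nat \<Rightarrow> real"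
    using m unfolding S_def lessThan_atLeast0 by (simp add: sum.atLeast_Suc_lessThan)
  \<comment> \<open>Inversion at \<open>p\<close> turns the unit ball into the half-space where
    \<open>- c\<close> times the first coordinate is at least \<open>1 / 2\<close>; the factor
    \<open>- c\<close> and the shift in \<open>f\<close> normalise this to
    \<open>0 \<le> y 0\<close>. \<open>D\<close> and \<open>Q\<close> are the squared distances to
    the centre of inversion before and after this, and they are reciprocal.\<close>
  define D where "D x = (x 0 - c)\<^sup>2 + S x" for x
  define Q where "Q y = (y 0 + 1 / 2)\<^sup>2 + S y" for y
  define f where "f x = (\<lambda>i. if i = 0 then - c * (x 0 - c) / D x - 1 / 2 else x i / D x)" for x :: "nat \<Rightarrow> real"
  define h where "h y = (\<lambda>i. if i = 0 then c - c * (y 0 + 1 / 2) / Q y else y i / Q y)" for y :: "nat \<Rightarrow> real"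
  have top1: "x \<in> topspace (subtopology (Euclidean_cball m) (- {p})) \<longleftrightarrow>
      x \<in> topspace ?E \<and> (x 0)\<^sup>2 + S x \<le> 1 \<and> x \<noteq> p" for x
    by (auto simp: Euclidean_cball_def norm)
  have top2: "y \<in> topspace (half_space m) \<longleftrightarrow> y \<in> topspace ?E \<and> 0 \<le> y 0" for y
    by (auto simp: half_space_def)
  have D: "0 < D x" if x: "x \<in> topspace ?E" "x \<noteq> p" for x
  proof -
    obtain i where i: "x i \<noteq> p i" using x(2) by (auto simp: fun_eq_iff)
    show ?thesis
    proof (cases "i = 0")
      case True
      then show ?thesis using i S0[of x] by (simp add: D_def p_def add_pos_nonneg)
    next
      case False
      then have "i < m" "x i \<noteq> 0" using i x(1) by (auto simp: p_def topspace_Euclidean_space not_le)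
      then have "0 < S x" unfolding S_def using False by (intro sum_pos2[of _ i]) auto
      then show ?thesis by (simp add: D_def add_nonneg_pos)
    qed
  qed
  have Q: "0 < Q y" if "0 \<le> y 0" for y
    using S0[of y] that unfolding Q_def by (intro add_pos_nonneg) auto
  have Sf: "S (f x) = S x / (D x)\<^sup>2" for x
    unfolding S_def sum_divide_distrib by (intro sum.cong) (auto simp: f_def power_divide)
  have Sh: "S (h y) = S y / (Q y)\<^sup>2" for y
    unfolding S_def sum_divide_distrib by (intro sum.cong) (auto simp: h_def power_divide)
  have cont_S: "continuous_map X euclideanreal (\<lambda>x. S (F x))"
    if "\<And>i. continuous_map X euclideanreal (\<lambda>x. F x i)" for X :: "'b topology" and F
    unfolding S_def by (intro continuous_map_sum continuous_map_real_pow that) auto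
  have Qf: "Q (f x) = 1 / D x" if "0 < D x" for x
  proof -
    have "Q (f x) = (c * c * (x 0 - c)\<^sup>2 + S x) / (D x)\<^sup>2"
      unfolding Q_def Sf by (simp add: f_def power_divide add_divide_distrib power2_eq_square)
    also have "\<dots> = D x / (D x)\<^sup>2" by (simp add: c D_def)
    finally show ?thesis using that by (simp add: power2_eq_square)
  qed
  have Dh: "D (h y) = 1 / Q y" if "0 < Q y" for y
  proof -
    have "D (h y) = (c * c * (y 0 + 1 / 2)\<^sup>2 + S y) / (Q y)\<^sup>2"
      unfolding D_def Sh by (simp add: h_def power_divide add_divide_distrib power2_eq_square)
    also have "\<dots> = Q y / (Q y)\<^sup>2" by (simp add: c Q_def)
    finally show ?thesis using that by (simp add: power2_eq_square)
  qed
  have fE: "f x \<in> topspace ?E" "h x \<in> topspace ?E" if "x \<in> topspace ?E" for x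
    using that m by (auto simp: topspace_Euclidean_space f_def h_def)
  have half: "0 \<le> f x 0" if "x \<in> topspace ?E" "(x 0)\<^sup>2 + S x \<le> 1" "x \<noteq> p" for x
  proof -
    have "D x \<le> 2 * (- c * (x 0 - c))"
      using that(2) c by (simp add: D_def power2_eq_square algebra_simps)
    then show ?thesis using D[OF that(1,3)] by (simp add: f_def field_simps)
  qed
  have ball: "(h y 0)\<^sup>2 + S (h y) \<le> 1" if y: "0 \<le> y 0" for y
  proof -
    have Qy: "0 < Q y" using Q[of y] y by simp
    have "2 * c * h y 0 = 2 * (c * c) - 2 * (c * c) * (y 0 + 1 / 2) / Q y"
      by (simp add: h_def algebra_simps)
    then have h0: "2 * c * h y 0 = 2 - (2 * y 0 + 1) / Q y" unfolding c by simp
    have "(h y 0)\<^sup>2 + S (h y) = D (h y) + 2 * c * h y 0 - c * c"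
      by (simp add: D_def power2_eq_square algebra_simps)
    also have "\<dots> = 1 - 2 * y 0 / Q y"
      unfolding h0 c Dh[OF Qy] by (simp add: add_divide_distrib)
    also have "\<dots> \<le> 1" using Qy y by simp
    finally show ?thesis .
  qed
  have "homeomorphic_maps (subtopology (Euclidean_cball m) (- {p})) (half_space m) f h"
    unfolding homeomorphic_maps_def
  proof (intro conjI ballI)
    let ?X = "subtopology (Euclidean_cball m) (- {p})"
    have coord: "continuous_map ?X euclideanreal (\<lambda>x. x i)" for i
      unfolding Euclidean_cball_def
      by (intro continuous_map_from_subtopology continuous_map_Euclidean_coord)
    have DX: "D x \<noteq> 0" if "x \<in> topspace ?X" for x using that D[of x] unfolding top1 by auto
    have contD: "continuous_map ?X euclideanreal D"
      unfolding D_def by (intro continuous_intros cont_S coord) auto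
    have "continuous_map ?X ?E f"
    proof (rule continuous_map_into_Euclidean)
      show "f x \<in> topspace ?E" if "x \<in> topspace ?X" for x using that fE by (simp only: top1)
      show "continuous_map ?X euclideanreal (\<lambda>x. f x i)" for i
      proof (cases "i = 0")
        case True
        then have "(\<lambda>x. f x i) = (\<lambda>x. - c * (x 0 - c) / D x - 1 / 2)" by (simp add: f_def)
        then show ?thesis by (simp only:) (intro continuous_intros coord contD DX; simp)
      next
        case False
        then have "(\<lambda>x. f x i) = (\<lambda>x. x i / D x)" by (simp add: f_def)
        then show ?thesis by (simp only:) (intro continuous_intros coord contD DX; simp)
      qed
    qed
    moreover have "f \<in> topspace ?X \<rightarrow> {x. 0 \<le> x 0}"
      using half by (auto simp only: top1 Pi_iff mem_Collect_eq)
    ultimately show "continuous_map ?X (half_space m) f"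
      by (simp add: half_space_def continuous_map_in_subtopology)
    have coord': "continuous_map (half_space m) euclideanreal (\<lambda>x. x i)" for i
      unfolding half_space_def by (intro continuous_map_from_subtopology continuous_map_Euclidean_coord)
    have QX: "Q x \<noteq> 0" if "x \<in> topspace (half_space m)" for x using that Q[of x] unfolding top2 by auto
    have contQ: "continuous_map (half_space m) euclideanreal Q"
      unfolding Q_def by (intro continuous_intros cont_S coord') auto
    have "continuous_map (half_space m) ?E h"
    proof (rule continuous_map_into_Euclidean)
      show "h x \<in> topspace ?E" if "x \<in> topspace (half_space m)" for x using that fE by (simp only: top2)
      show "continuous_map (half_space m) euclideanreal (\<lambda>x. h x i)" for i
      proof (cases "i = 0")
        case True
        then have "(\<lambda>x. h x i) = (\<lambda>x. c - c * (x 0 + 1 / 2) / Q x)" by (simp add: h_def)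
        then show ?thesis by (simp only:) (intro continuous_intros coord' contQ QX; simp)
      next
        case False
        then have "(\<lambda>x. h x i) = (\<lambda>x. x i / Q x)" by (simp add: h_def)
        then show ?thesis by (simp only:) (intro continuous_intros coord' contQ QX; simp)
      qed
    qed
    moreover have "h y \<noteq> p" if "0 \<le> y 0" for y
    proof
      assume "h y = p"
      then have "D (h y) = 0" by (simp add: D_def S_def p_def)
      then show False using Dh[of y] Q[of y] that by simp
    qed
    ultimately show "continuous_map (half_space m) ?X h"
      using ball unfolding Euclidean_cball_def continuous_map_in_subtopology
      by (auto simp: top2 norm)
    fix x assume x: "x \<in> topspace ?X"
    then have x': "0 < D x" using D[of x] unfolding top1 by simp
    have "c * (c * (x 0 - c)) = x 0 - c" using c by (metis mult.assoc mult_1)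
    then show "h (f x) = x"
      using x' c unfolding h_def Qf[OF x'] by (auto simp: fun_eq_iff f_def field_simps)
  next
    fix y assume y: "y \<in> topspace (half_space m)"
    then have y': "0 < Q y" using Q[of y] unfolding top2 by simp
    have "c * (c * (y 0 + 1 / 2)) = y 0 + 1 / 2" using c by (metis mult.assoc mult_1)
    then show "f (h y) = y"
      using y' c unfolding f_def Dh[OF y'] by (auto simp: fun_eq_iff h_def field_simps)
  qed
  then show ?thesis by (rule homeomorphic_maps_imp_homeomorphic_space)
qed

text \<open>Every point of the ball avoids one of the two poles, so the inversions at the poles
  provide charts at interior and boundary points alike, and they restrict to open subsets.\<close>

lemma manifold_with_boundary_open_in_cball:
  assumes A: "openin (Euclidean_cball m) A"
  shows "manifold_with_boundary m (subtopology (Euclidean_cball m) A)"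
proof -
  let ?X = "subtopology (Euclidean_cball m) A"
  have "Hausdorff_space ?X"
    unfolding Euclidean_cball_def by (intro Hausdorff_space_subtopology Hausdorff_Euclidean_space)
  moreover have "second_countable ?X"
    unfolding Euclidean_cball_def by (intro second_countable_subtopology second_countable_Euclidean_space)
  moreover have "\<exists>U W. openin ?X U \<and> x \<in> U \<and> openin (half_space m) W \<and>
        subtopology ?X U homeomorphic_space subtopology (half_space m) W" if x: "x \<in> topspace ?X" for x
  proof (cases "m = 0")
    \<comment> \<open>In dimension 0 there is no pole to remove; ball and half-space are the same
      point.\<close>
    case True
    have E0: "topspace (Euclidean_space m) = {\<lambda>_. 0}"
      using True by (auto simp: topspace_Euclidean_space)
    have "Euclidean_cball m = Euclidean_space m" "half_space m = Euclidean_space m"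
      unfolding Euclidean_cball_def half_space_def by (rule subtopology_superset; simp add: E0)+
    moreover have "subtopology (Euclidean_space m) A = Euclidean_space m"
      using x E0 \<open>Euclidean_cball m = Euclidean_space m\<close> by (intro subtopology_superset) auto
    ultimately show ?thesis
      using x by (intro exI[of _ "topspace (Euclidean_space m)"]) simp
  next
    case False
    define c :: real where "c = (if x 0 = 1 then - 1 else 1)"
    define p where "p = (\<lambda>i::nat. if i = 0 then c else (0::real))"
    have "x \<noteq> p" by (auto simp: p_def c_def fun_eq_iff)
    have "c * c = 1" by (simp add: c_def)
    let ?Y = "subtopology (Euclidean_cball m) (- {p})"
    obtain f where f: "homeomorphic_map ?Y (half_space m) f"
      using cball_minus_point_homeomorphic_half_space[of m c] False \<open>c * c = 1\<close>
      unfolding p_def homeomorphic_space by blast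
    define U where "U = A \<inter> - {p}"
    have AU: "A \<subseteq> topspace (Euclidean_cball m)" using A by (rule openin_subset)
    have "closedin (Euclidean_cball m) ({p} \<inter> topspace (Euclidean_cball m))"
    proof (cases "p \<in> topspace (Euclidean_cball m)")
      case True
      have "Hausdorff_space (Euclidean_cball m)"
        unfolding Euclidean_cball_def by (intro Hausdorff_space_subtopology Hausdorff_Euclidean_space)
      then show ?thesis using True by (simp add: closedin_Hausdorff_singleton)
    qed simp
    then have "openin (Euclidean_cball m) (A - {p} \<inter> topspace (Euclidean_cball m))"
      by (rule openin_diff[OF A])
    moreover have "A - {p} \<inter> topspace (Euclidean_cball m) = U" using AU by (auto simp: U_def)
    ultimately have U: "openin (Euclidean_cball m) U" by simp
    have UX: "openin ?X U" using U unfolding openin_subtopology by (intro exI[of _ U]) (auto simp: U_def)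
    have UY: "openin ?Y U" using U unfolding openin_subtopology by (intro exI[of _ U]) (auto simp: U_def)
    have "openin (half_space m) (f ` U)"
      using f UY homeomorphic_map_openness_eq by blast
    moreover have "subtopology ?Y U homeomorphic_space subtopology (half_space m) (f ` U)"
    proof (rule homeomorphic_map_imp_homeomorphic_space[OF homeomorphic_map_subtopologies[OF f]])
      show "f ` (topspace ?Y \<inter> U) = topspace (half_space m) \<inter> f ` U"
        using homeomorphic_imp_surjective_map[OF f] openin_subset[OF UY] by auto
    qed
    moreover have "subtopology ?Y U = subtopology ?X U"
      unfolding subtopology_subtopology by (rule arg_cong[of _ _ "subtopology _"]) (auto simp: U_def)
    moreover have "x \<in> U" using x \<open>x \<noteq> p\<close> by (simp add: U_def)
    ultimately show ?thesis using UX by metis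
  qed
  ultimately show ?thesis by (simp add: manifold_with_boundary_def)
qed

text \<open>Points of the ball are functions on all of \<open>nat\<close> that vanish from
  \<open>m\<close> on, so the ball is a closed subset of a product of compact intervals, and
  Tychonoff applies.\<close>

lemma compact_space_Euclidean_cball: "compact_space (Euclidean_cball m)"
proof -
  let ?B = "{x \<in> topspace (Euclidean_space m). (\<Sum>i<m. (x i)\<^sup>2) \<le> 1}"
  have "compactin (powertop_real UNIV) (PiE UNIV (\<lambda>_. {-1..1}))"
    by (simp add: compactin_PiE)
  moreover have "?B \<subseteq> PiE UNIV (\<lambda>_. {-1..1})"
  proof
    fix x assume x: "x \<in> ?B"
    have "\<bar>x i\<bar> \<le> 1" for i
    proof (cases "i < m")
      case True
      then have "(x i)\<^sup>2 \<le> (\<Sum>i<m. (x i)\<^sup>2)" by (intro member_le_sum) auto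
      then have "(x i)\<^sup>2 \<le> 1" using x by auto
      then show ?thesis by (simp add: abs_square_le_1)
    qed (use x in \<open>simp add: topspace_Euclidean_space\<close>)
    then show "x \<in> PiE UNIV (\<lambda>_. {-1..1})" by (auto simp: abs_le_iff minus_le_iff)
  qed
  moreover have "closedin (powertop_real UNIV) ?B"
  proof -
    have "continuous_map (powertop_real UNIV) euclideanreal (\<lambda>x. \<Sum>i<m. (x i)\<^sup>2)"
      by (intro continuous_map_sum continuous_map_real_pow continuous_map_product_projection) auto
    from closedin_continuous_map_preimage[OF this, of "{..1}"]
    have "closedin (powertop_real UNIV) {x. (\<Sum>i<m. (x i)\<^sup>2) \<le> 1}" by simp
    moreover have "?B = topspace (Euclidean_space m) \<inter> {x. (\<Sum>i<m. (x i)\<^sup>2) \<le> 1}" by auto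
    ultimately show ?thesis using closedin_Euclidean_space by (simp only: closedin_Int)
  qed
  ultimately have "compactin (powertop_real UNIV) ?B" by (rule closed_compactin)
  moreover have "Euclidean_cball m = subtopology (powertop_real UNIV) ?B"
    unfolding Euclidean_cball_def Euclidean_space_def subtopology_subtopology
    by (rule arg_cong[of _ _ "subtopology _"]) auto
  ultimately show ?thesis by (simp add: compact_space_subtopology)
qed

subsection \<open>Topology of the Grassmannians\<close>

text \<open>Every term is a product of two values, so adding \<open>c\<close> moves all term values
  by \<open>2 * c\<close>. Hence the conditions descend to the quotients by constants and by
  scaling.\<close>

lemma log_null_shift:
  assumes "\<And>\<beta>. \<beta> \<in> J \<Longrightarrow> w \<beta> = v \<beta> + c"
  shows "log_null q J w L \<longleftrightarrow> log_null q J v L"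
proof -
  have w: "term_value w L k = term_value v L k + 2 * c" if "k \<in> active J L" for k
    using assms that by (auto simp: term_value_def active_def)
  let ?p = "1 / enn2real q"
  have e: "exp (?p * term_value w L k) = exp (?p * (2 * c)) * exp (?p * term_value v L k)" if "k \<in> active J L" for k
    unfolding w[OF that] by (simp add: exp_add[symmetric] algebra_simps del: exp_add)
  have s: "(\<Sum>l\<in>active J L - {k}. exp (?p * term_value w L l)) =
      exp (?p * (2 * c)) * (\<Sum>l\<in>active J L - {k}. exp (?p * term_value v L l))" for k
    unfolding sum_distrib_left by (intro sum.cong refl e) auto
  show ?thesis
    unfolding log_null_def
  proof (rule ball_cong[OF refl], goal_cases)
    case (1 k)
    have "(exp (?p * term_value w L k) \<le> (\<Sum>l\<in>active J L - {k}. exp (?p * term_value w L l))) \<longleftrightarrow>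
        (exp (?p * term_value v L k) \<le> (\<Sum>l\<in>active J L - {k}. exp (?p * term_value v L l)))"
      unfolding e[OF 1] s by simp
    moreover have "(\<exists>l\<in>active J L - {k}. term_value w L k \<le> term_value w L l) \<longleftrightarrow>
        (\<exists>l\<in>active J L - {k}. term_value v L k \<le> term_value v L l)"
      using w 1 by (intro bex_cong refl) auto
    moreover have "(\<exists>l\<in>active J L - {k}. term_value w L l = term_value w L k) \<longleftrightarrow>
        (\<exists>l\<in>active J L - {k}. term_value v L l = term_value v L k)"
      using w 1 by (intro bex_cong refl) auto
    ultimately show ?case by simp
  qed
qed

text \<open>With two active indices each inequality has a single summand on the right, and together
  they give equality. So logarithmic representations for finite \<open>q\<close> lie in V_J.\<close>

lemma log_null_finite_imp_infinity:
  assumes "log_null q J v L" "0 < q" "q < \<infinity>"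
  shows "log_null \<infinity> J v L"
proof -
  let ?K = "active J L" and ?p = "1 / enn2real q"
  have p: "0 < ?p" using assms by (simp add: enn2real_positive_iff less_top)
  have le: "exp (?p * term_value v L k) \<le> (\<Sum>l\<in>?K - {k}. exp (?p * term_value v L l))" if "k \<in> ?K" for k
  proof -
    have "q \<noteq> 0" "q \<noteq> \<infinity>" using assms by auto
    then show ?thesis using assms(1) that unfolding log_null_def by (simp only: if_False)
  qed
  have "3 \<le> card ?K \<or> (\<exists>l\<in>?K - {k}. term_value v L l = term_value v L k)" if k: "k \<in> ?K" for k
  proof (cases "3 \<le> card ?K")
    case False
    have "?K - {k} \<noteq> {}" using le[OF k] by (metis exp_gt_zero not_le sum.empty)
    then obtain l where l: "l \<in> ?K" "l \<noteq> k" by blast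
    have "card ?K \<le> card {k, l}" using False l by simp
    then have K: "?K = {k, l}"
      using k l by (intro card_seteq[symmetric] finite_active) auto
    then have "?K - {k} = {l}" "?K - {l} = {k}" using l by auto
    then have "term_value v L k \<le> term_value v L l" "term_value v L l \<le> term_value v L k"
      using le[OF k] le[OF l(1)] p by (simp_all add: mult_le_cancel_left_pos)
    then show ?thesis using l by (intro disjI2 bexI[of _ l]) auto
  qed simp
  then show ?thesis by (simp add: log_null_def)
qed

text \<open>Below three active terms the partner of \<open>k\<close> is the only other active index,
  hence the same for \<open>u\<close> and \<open>v\<close>, and equality of term values is a linear
  condition. This makes V_J a subspace.\<close>

lemma log_null_infinity_combination:
  assumes "log_null \<infinity> J u L" "log_null \<infinity> J v L" "\<And>\<beta>. \<beta> \<in> J \<Longrightarrow> w \<beta> = u \<beta> + c * v \<beta>"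
  shows "log_null \<infinity> J w L"
proof -
  let ?K = "active J L"
  have w: "term_value w L k = term_value u L k + c * term_value v L k" if "k \<in> ?K" for k
    using that assms(3) by (auto simp: term_value_def active_def algebra_simps)
  have "3 \<le> card ?K \<or> (\<exists>l\<in>?K - {k}. term_value w L l = term_value w L k)" if k: "k \<in> ?K" for k
  proof (cases "3 \<le> card ?K")
    case False
    obtain l where l: "l \<in> ?K - {k}" "term_value u L l = term_value u L k"
      using assms(1) k False unfolding log_null_def by auto
    obtain l' where l': "l' \<in> ?K - {k}" "term_value v L l' = term_value v L k"
      using assms(2) k False unfolding log_null_def by auto
    have "l = l'"
    proof (rule ccontr)
      assume "l \<noteq> l'"
      then have "card {k, l, l'} = 3" using l l' by auto
      moreover have "card {k, l, l'} \<le> card ?K"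
        using k l l' by (intro card_mono finite_active) auto
      ultimately show False using False by simp
    qed
    then show ?thesis using l l' k w by (intro disjI2 bexI[of _ l]) auto
  qed simp
  then show ?thesis by (simp add: log_null_def)
qed

section \<open>Cosets of constants, scaling orbits and their coordinates\<close>

lemma ones_coset_eq: "ones_coset J v = {\<lambda>\<alpha>\<in>J. c + v \<alpha> | c. True}"
proof -
  have "(\<lambda>\<alpha>\<in>J. (\<lambda>\<alpha>\<in>J. c) \<alpha> + v \<alpha>) = (\<lambda>\<alpha>\<in>J. c + v \<alpha>)" for c by auto
  moreover have "ones_coset J v = {\<lambda>\<alpha>\<in>J. (\<lambda>\<alpha>\<in>J. c) \<alpha> + v \<alpha> | c. True}"
    by (simp add: ones_coset_def ones_line_def a_r_coset_def' real_power_def del: restrict_apply) blast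
  ultimately show ?thesis by simp
qed

lemma ones_coset_eq_iff:
  assumes "u \<in> J \<rightarrow>\<^sub>E UNIV" "v \<in> J \<rightarrow>\<^sub>E UNIV"
  shows "ones_coset J u = ones_coset J v \<longleftrightarrow> (\<exists>c. \<forall>\<alpha>\<in>J. u \<alpha> = c + v \<alpha>)"
proof
  assume "ones_coset J u = ones_coset J v"
  moreover have "u \<in> ones_coset J u"
    unfolding ones_coset_eq using assms(1) by (intro CollectI exI[of _ 0]) (auto simp: fun_eq_iff PiE_def extensional_def)
  ultimately have "u \<in> ones_coset J v" by simp
  then obtain c where "u = (\<lambda>\<alpha>\<in>J. c + v \<alpha>)" unfolding ones_coset_eq by blast
  then show "\<exists>c. \<forall>\<alpha>\<in>J. u \<alpha> = c + v \<alpha>" by auto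
next
  assume "\<exists>c. \<forall>\<alpha>\<in>J. u \<alpha> = c + v \<alpha>"
  then obtain c where c: "\<And>\<alpha>. \<alpha> \<in> J \<Longrightarrow> u \<alpha> = c + v \<alpha>" by blast
  have "(\<lambda>\<alpha>\<in>J. a + u \<alpha>) = (\<lambda>\<alpha>\<in>J. (a + c) + v \<alpha>)" "(\<lambda>\<alpha>\<in>J. a + v \<alpha>) = (\<lambda>\<alpha>\<in>J. (a - c) + u \<alpha>)" for a
    using c by (auto simp: fun_eq_iff)
  then show "ones_coset J u = ones_coset J v"
    unfolding ones_coset_eq by blast
qed

lemma scaling_orbit_eq_iff:
  assumes "\<And>\<alpha>. \<alpha> \<in> J \<Longrightarrow> 0 < \<rho> \<alpha>" "\<And>\<alpha>. \<alpha> \<in> J \<Longrightarrow> 0 < \<rho>' \<alpha>" "\<rho> \<in> J \<rightarrow>\<^sub>E UNIV" "\<rho>' \<in> J \<rightarrow>\<^sub>E UNIV"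
  shows "scaling_orbit J \<rho> = scaling_orbit J \<rho>' \<longleftrightarrow> (\<exists>c. \<forall>\<alpha>\<in>J. ln (\<rho> \<alpha>) = c + ln (\<rho>' \<alpha>))"
proof
  assume "scaling_orbit J \<rho> = scaling_orbit J \<rho>'"
  moreover have "\<rho> \<in> scaling_orbit J \<rho>"
    unfolding scaling_orbit_def using assms(3) by (intro CollectI exI[of _ 1]) (auto simp: fun_eq_iff PiE_def extensional_def)
  ultimately have "\<rho> \<in> scaling_orbit J \<rho>'" by simp
  then obtain c where "0 < c" "\<rho> = (\<lambda>\<alpha>\<in>J. c * \<rho>' \<alpha>)" unfolding scaling_orbit_def by blast
  then show "\<exists>c. \<forall>\<alpha>\<in>J. ln (\<rho> \<alpha>) = c + ln (\<rho>' \<alpha>)"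
    using ln_mult_pos[OF \<open>0 < c\<close> assms(2)] by (intro exI[of _ "ln c"]) auto
next
  assume "\<exists>c. \<forall>\<alpha>\<in>J. ln (\<rho> \<alpha>) = c + ln (\<rho>' \<alpha>)"
  then obtain c where c: "\<And>\<alpha>. \<alpha> \<in> J \<Longrightarrow> ln (\<rho> \<alpha>) = c + ln (\<rho>' \<alpha>)" by blast
  have \<rho>: "\<rho> \<alpha> = exp c * \<rho>' \<alpha>" if "\<alpha> \<in> J" for \<alpha>
    using arg_cong[OF c[OF that], of exp] assms(1,2)[OF that] by (simp add: exp_add)
  have "(\<lambda>\<alpha>\<in>J. a * \<rho> \<alpha>) = (\<lambda>\<alpha>\<in>J. (a * exp c) * \<rho>' \<alpha>)" "(\<lambda>\<alpha>\<in>J. a * \<rho>' \<alpha>) = (\<lambda>\<alpha>\<in>J. (a * exp (- c)) * \<rho> \<alpha>)" for a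
    using \<rho> by (auto simp: fun_eq_iff exp_minus)
  note eq = this
  show "scaling_orbit J \<rho> = scaling_orbit J \<rho>'"
  proof (intro subset_antisym subsetI)
    fix x assume "x \<in> scaling_orbit J \<rho>"
    then obtain a where "0 < a" "x = (\<lambda>\<alpha>\<in>J. a * \<rho> \<alpha>)" unfolding scaling_orbit_def by blast
    then show "x \<in> scaling_orbit J \<rho>'"
      unfolding scaling_orbit_def eq(1) by (intro CollectI exI[of _ "a * exp c"]) simp
  next
    fix x assume "x \<in> scaling_orbit J \<rho>'"
    then obtain a where "0 < a" "x = (\<lambda>\<alpha>\<in>J. a * \<rho>' \<alpha>)" unfolding scaling_orbit_def by blast
    then show "x \<in> scaling_orbit J \<rho>"
      unfolding scaling_orbit_def eq(2) by (intro CollectI exI[of _ "a * exp (- c)"]) simp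
  qed
qed

lemma ones_coset_arith:
  shows "ones_coset J u <+>\<^bsub>real_power J\<^esub> ones_coset J v = ones_coset J (\<lambda>\<alpha>\<in>J. u \<alpha> + v \<alpha>)"
    and "ones_line J <+>\<^bsub>real_power J\<^esub> ((\<lambda>v. r \<odot>\<^bsub>real_power J\<^esub> v) ` ones_coset J v) = ones_coset J (\<lambda>\<alpha>\<in>J. r * v \<alpha>)"
    and "ones_line J = ones_coset J (\<lambda>\<alpha>\<in>J. 0)"
proof -
  have sum: "A <+>\<^bsub>real_power J\<^esub> B = {\<lambda>\<alpha>\<in>J. a \<alpha> + b \<alpha> | a b. a \<in> A \<and> b \<in> B}" for A B :: "('a \<Rightarrow> real) set"
    by (auto simp: set_add_def' real_power_def)
  show "ones_line J = ones_coset J (\<lambda>\<alpha>\<in>J. 0)"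
    unfolding ones_coset_eq ones_line_def by (simp cong: restrict_cong)
  show "ones_coset J u <+>\<^bsub>real_power J\<^esub> ones_coset J v = ones_coset J (\<lambda>\<alpha>\<in>J. u \<alpha> + v \<alpha>)"
  proof (intro subset_antisym subsetI)
    fix x assume "x \<in> ones_coset J u <+>\<^bsub>real_power J\<^esub> ones_coset J v"
    then obtain a b where "x = (\<lambda>\<alpha>\<in>J. (\<lambda>\<alpha>\<in>J. a + u \<alpha>) \<alpha> + (\<lambda>\<alpha>\<in>J. b + v \<alpha>) \<alpha>)"
      unfolding sum ones_coset_eq by blast
    then have "x = (\<lambda>\<alpha>\<in>J. (a + b) + (\<lambda>\<alpha>\<in>J. u \<alpha> + v \<alpha>) \<alpha>)" by (auto simp: fun_eq_iff)
    then show "x \<in> ones_coset J (\<lambda>\<alpha>\<in>J. u \<alpha> + v \<alpha>)" unfolding ones_coset_eq by blast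
  next
    fix x assume "x \<in> ones_coset J (\<lambda>\<alpha>\<in>J. u \<alpha> + v \<alpha>)"
    then obtain c where "x = (\<lambda>\<alpha>\<in>J. c + (\<lambda>\<alpha>\<in>J. u \<alpha> + v \<alpha>) \<alpha>)" unfolding ones_coset_eq by blast
    then have "x = (\<lambda>\<alpha>\<in>J. (\<lambda>\<alpha>\<in>J. c + u \<alpha>) \<alpha> + (\<lambda>\<alpha>\<in>J. 0 + v \<alpha>) \<alpha>)" by (auto simp: fun_eq_iff)
    then show "x \<in> ones_coset J u <+>\<^bsub>real_power J\<^esub> ones_coset J v" unfolding sum ones_coset_eq by blast
  qed
  show "ones_line J <+>\<^bsub>real_power J\<^esub> ((\<lambda>v. r \<odot>\<^bsub>real_power J\<^esub> v) ` ones_coset J v) = ones_coset J (\<lambda>\<alpha>\<in>J. r * v \<alpha>)"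
  proof (intro subset_antisym subsetI)
    fix x assume "x \<in> ones_line J <+>\<^bsub>real_power J\<^esub> ((\<lambda>v. r \<odot>\<^bsub>real_power J\<^esub> v) ` ones_coset J v)"
    then obtain a b where "x = (\<lambda>\<alpha>\<in>J. (\<lambda>\<alpha>\<in>J. a) \<alpha> + (r \<odot>\<^bsub>real_power J\<^esub> (\<lambda>\<alpha>\<in>J. b + v \<alpha>)) \<alpha>)"
      unfolding sum ones_coset_eq ones_line_def by blast
    then have "x = (\<lambda>\<alpha>\<in>J. (a + r * b) + (\<lambda>\<alpha>\<in>J. r * v \<alpha>) \<alpha>)"
      by (auto simp: fun_eq_iff real_power_def distrib_left)
    then show "x \<in> ones_coset J (\<lambda>\<alpha>\<in>J. r * v \<alpha>)" unfolding ones_coset_eq by blast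
  next
    fix x assume "x \<in> ones_coset J (\<lambda>\<alpha>\<in>J. r * v \<alpha>)"
    then obtain c where "x = (\<lambda>\<alpha>\<in>J. c + (\<lambda>\<alpha>\<in>J. r * v \<alpha>) \<alpha>)" unfolding ones_coset_eq by blast
    then have "x = (\<lambda>\<alpha>\<in>J. (\<lambda>\<alpha>\<in>J. c) \<alpha> + (r \<odot>\<^bsub>real_power J\<^esub> (\<lambda>\<alpha>\<in>J. 0 + v \<alpha>)) \<alpha>)"
      by (auto simp: fun_eq_iff real_power_def)
    then show "x \<in> ones_line J <+>\<^bsub>real_power J\<^esub> ((\<lambda>v. r \<odot>\<^bsub>real_power J\<^esub> v) ` ones_coset J v)"
      unfolding sum ones_coset_eq ones_line_def by blast
  qed
qed

lemma continuous_map_log_vec: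
  assumes "\<And>\<rho> \<alpha>. \<rho> \<in> S \<Longrightarrow> \<alpha> \<in> J \<Longrightarrow> 0 < \<rho> \<alpha>"
  shows "continuous_map (subtopology (powertop_real J) S) (powertop_real J) (log_vec J)"
  unfolding continuous_map_componentwise
proof (intro conjI ballI)
  show "log_vec J ` topspace (subtopology (powertop_real J) S) \<subseteq> extensional J"
    by (auto simp: log_vec_def)
  fix \<alpha> assume \<alpha>: "\<alpha> \<in> J"
  let ?X = "subtopology (powertop_real J) S"
  have "continuous_map ?X (top_of_set {0<..}) (\<lambda>\<rho>. \<rho> \<alpha>)"
    unfolding continuous_map_in_subtopology
    using assms \<alpha> by (auto intro!: continuous_map_from_subtopology continuous_map_product_projection)
  moreover have "continuous_map (top_of_set {0<..}) euclideanreal (ln :: real \<Rightarrow> real)"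
    by (auto intro!: continuous_on_ln continuous_on_id)
  ultimately have "continuous_map ?X euclideanreal (ln \<circ> (\<lambda>\<rho>. \<rho> \<alpha>))"
    by (rule continuous_map_compose)
  then show "continuous_map ?X euclideanreal (\<lambda>\<rho>. log_vec J \<rho> \<alpha>)"
    using \<alpha> by (simp add: log_vec_def o_def)
qed

lemma continuous_map_exp_vec: "continuous_map (powertop_real J) (powertop_real J) (exp_vec J)"
  unfolding continuous_map_componentwise
proof (intro conjI ballI)
  show "exp_vec J ` topspace (powertop_real J) \<subseteq> extensional J" by (auto simp: exp_vec_def)
  fix \<alpha> assume \<alpha>: "\<alpha> \<in> J"
  have "continuous_map (powertop_real J) euclideanreal (\<lambda>v. v \<alpha>)"
    using \<alpha> by (rule continuous_map_product_projection)
  moreover have "continuous_map euclideanreal euclideanreal (exp :: real \<Rightarrow> real)"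
    by (simp add: continuous_on_exp continuous_on_id)
  ultimately have "continuous_map (powertop_real J) euclideanreal (exp \<circ> (\<lambda>v. v \<alpha>))"
    by (rule continuous_map_compose)
  then show "continuous_map (powertop_real J) euclideanreal (\<lambda>v. exp_vec J v \<alpha>)"
    using \<alpha> by (simp add: exp_vec_def o_def)
qed

text \<open>The vectors of \<open>V\<close> vanishing at \<open>a\<close> form a complement of the
  constants, and \<open>b\<close> is a basis of it dual to the coordinates \<open>e\<close>. It is a
  concrete model of the quotient by constants, in which Grassmannians, Dressian and balls are
  compared.\<close>

locale coordinate_system =
  fixes V :: "('a \<Rightarrow> real) set" and J :: "'a set" and m :: nat and a :: 'a
    and e :: "nat \<Rightarrow> 'a" and b :: "nat \<Rightarrow> 'a \<Rightarrow> real"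
  assumes V_ext: "V \<subseteq> J \<rightarrow>\<^sub>E UNIV"
    and V_const: "\<And>v c. v \<in> V \<Longrightarrow> (\<lambda>\<alpha>\<in>J. c + v \<alpha>) \<in> V"
    and V_zero: "(\<lambda>\<alpha>\<in>J. 0) \<in> V"
    and V_comb: "\<And>u v c. u \<in> V \<Longrightarrow> v \<in> V \<Longrightarrow> (\<lambda>\<alpha>\<in>J. u \<alpha> + c * v \<alpha>) \<in> V"
    and a: "a \<in> J" and e: "\<And>i. i < m \<Longrightarrow> e i \<in> J"
    and b: "\<And>i. i < m \<Longrightarrow> b i \<in> V" "\<And>i. i < m \<Longrightarrow> b i a = 0"
    and dual: "\<And>i k. i < m \<Longrightarrow> k < m \<Longrightarrow> b i (e k) = (if k = i then 1 else 0)"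
    and expand: "\<And>v \<alpha>. v \<in> V \<Longrightarrow> v a = 0 \<Longrightarrow> \<alpha> \<in> J \<Longrightarrow> v \<alpha> = (\<Sum>i<m. v (e i) * b i \<alpha>)"
begin

abbreviation "E \<equiv> Euclidean_space m"

text \<open>\<open>lift x\<close> is the representative of its class modulo constants that vanishes at \<open>a\<close>.\<close>

definition coords :: "('a \<Rightarrow> real) \<Rightarrow> nat \<Rightarrow> real" where
  "coords v = (\<lambda>i. if i < m then v (e i) - v a else 0)"

definition lift :: "(nat \<Rightarrow> real) \<Rightarrow> 'a \<Rightarrow> real" where
  "lift x = (\<lambda>\<alpha>\<in>J. \<Sum>i<m. x i * b i \<alpha>)"

lemma coords_in_E: "coords v \<in> topspace E"
  by (simp add: coords_def topspace_Euclidean_space)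

lemma lift_in_V: "lift x \<in> V"
proof -
  have "(\<lambda>\<alpha>\<in>J. \<Sum>i<k. x i * b i \<alpha>) \<in> V" if "k \<le> m" for k
    using that
  proof (induction k)
    case 0
    then show ?case using V_zero by (simp only: lessThan_0 sum.empty)
  next
    case (Suc k)
    have eq: "(\<lambda>\<alpha>\<in>J. \<Sum>i<Suc k. x i * b i \<alpha>) = (\<lambda>\<alpha>\<in>J. (\<lambda>\<alpha>\<in>J. \<Sum>i<k. x i * b i \<alpha>) \<alpha> + x k * b k \<alpha>)"
      by (auto simp: fun_eq_iff)
    show ?case unfolding eq using Suc by (intro V_comb b) auto
  qed
  then show ?thesis by (simp add: lift_def)
qed

lemma coords_lift: "x \<in> topspace E \<Longrightarrow> coords (lift x) = x"
proof
  fix k assume x: "x \<in> topspace E"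
  have "(\<Sum>i<m. x i * b i (e k)) = (\<Sum>i<m. if i = k then x i else 0)" if "k < m"
    using that by (intro sum.cong) (auto simp: dual)
  moreover have "(\<Sum>i<m. x i * b i a) = 0" by (simp add: b)
  ultimately show "coords (lift x) k = x k"
    using x e a by (auto simp: coords_def lift_def topspace_Euclidean_space)
qed

lemma lift_coords: "v \<in> V \<Longrightarrow> \<alpha> \<in> J \<Longrightarrow> lift (coords v) \<alpha> = v \<alpha> - v a"
proof -
  assume v: "v \<in> V" and \<alpha>: "\<alpha> \<in> J"
  have "(\<lambda>\<alpha>\<in>J. - v a + v \<alpha>) \<in> V" using V_const v by blast
  from expand[OF this _ \<alpha>] show ?thesis
    using a \<alpha> e by (simp add: lift_def coords_def algebra_simps)
qed

lemma lift_linear: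
  "\<alpha> \<in> J \<Longrightarrow> lift (dilate t x) \<alpha> = t * lift x \<alpha>"
  "\<alpha> \<in> J \<Longrightarrow> lift (\<lambda>i. x i + y i) \<alpha> = lift x \<alpha> + lift y \<alpha>"
  by (simp_all add: lift_def dilate_def sum_distrib_left mult.assoc sum.distrib distrib_right)

lemma coords_eq_iff:
  assumes "u \<in> V" "v \<in> V"
  shows "coords u = coords v \<longleftrightarrow> (\<exists>c. \<forall>\<alpha>\<in>J. u \<alpha> = c + v \<alpha>)"
proof
  assume eq: "coords u = coords v"
  have "u \<alpha> = (u a - v a) + v \<alpha>" if "\<alpha> \<in> J" for \<alpha>
    using lift_coords[OF assms(1) that] lift_coords[OF assms(2) that] eq by simp
  then show "\<exists>c. \<forall>\<alpha>\<in>J. u \<alpha> = c + v \<alpha>" by blast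
next
  assume "\<exists>c. \<forall>\<alpha>\<in>J. u \<alpha> = c + v \<alpha>"
  then obtain c where "\<And>\<alpha>. \<alpha> \<in> J \<Longrightarrow> u \<alpha> = c + v \<alpha>" by blast
  then show "coords u = coords v" using a e by (auto simp: coords_def)
qed

lemma continuous_map_coords: "continuous_map (subtopology (powertop_real J) S) E coords"
proof (rule continuous_map_into_Euclidean[OF coords_in_E])
  fix i assume "i < m"
  then show "continuous_map (subtopology (powertop_real J) S) euclideanreal (\<lambda>x. coords x i)"
    using a e by (auto simp: coords_def intro!: continuous_intros continuous_map_from_subtopology continuous_map_product_projection)
qed

lemma continuous_map_lift_component:
  "\<alpha> \<in> J \<Longrightarrow> continuous_map E euclideanreal (\<lambda>x. lift x \<alpha>)"
  by (auto simp: lift_def intro!: continuous_map_sum continuous_map_real_mult_right continuous_map_Euclidean_coord)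

lemma continuous_map_lift: "continuous_map E (powertop_real J) lift"
  unfolding continuous_map_componentwise using continuous_map_lift_component by (auto simp: lift_def)

lemma quotient_by_constants:
  "homeomorphic_map E (quotient_topology (subtopology (powertop_real J) V) (ones_coset J)) (ones_coset J \<circ> lift)"
proof -
  let ?X = "subtopology (powertop_real J) V"
  have top: "topspace ?X = V" using V_ext by auto
  have "homeomorphic_maps E (quotient_topology ?X (ones_coset J)) (ones_coset J \<circ> lift)
      (\<lambda>A. coords (SOME x. x \<in> topspace ?X \<and> ones_coset J x = A))"
  proof (rule quotient_topology_homeomorphic)
    show "continuous_map ?X E coords" by (rule continuous_map_coords)
    show "coords (lift y) = y" if "y \<in> topspace E" for y using that by (rule coords_lift)
    show "continuous_map E ?X lift"
      using continuous_map_lift lift_in_V by (auto simp: continuous_map_in_subtopology)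
    fix u v assume "u \<in> topspace ?X" "v \<in> topspace ?X"
    then have "u \<in> V" "v \<in> V" by (simp_all only: top)
    then show "ones_coset J u = ones_coset J v \<longleftrightarrow> coords u = coords v"
      using V_ext coords_eq_iff ones_coset_eq_iff[of u J v] by blast
  qed
  then show ?thesis by (rule homeomorphic_maps_imp_map)
qed

text \<open>In logarithms scaling is the addition of constants, so \<open>coords\<close> after the
  logarithm separates the orbits and \<open>exp_vec J\<close> after \<open>lift\<close> is a
  continuous section. \<open>R_const\<close> keeps the normalised representatives inside
  \<open>R\<close>.\<close>

lemma quotient_by_scaling:
  assumes R: "R \<subseteq> V" and R_const: "\<And>v w c. v \<in> R \<Longrightarrow> w \<in> V \<Longrightarrow> (\<And>\<alpha>. \<alpha> \<in> J \<Longrightarrow> w \<alpha> = v \<alpha> + c) \<Longrightarrow> w \<in> R"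
  shows "quotient_topology (subtopology (powertop_real J) (exp_vec J ` R)) (scaling_orbit J)
    homeomorphic_space subtopology E {x. lift x \<in> R}"
proof -
  let ?X = "subtopology (powertop_real J) (exp_vec J ` R)" and ?Y = "subtopology E {x. lift x \<in> R}"
  have top: "topspace ?X = exp_vec J ` R" by (auto simp: exp_vec_def)
  have log: "log_vec J (exp_vec J v) = v" if "v \<in> V" for v
    by (rule log_vec_exp_vec) (rule subsetD[OF V_ext that])
  have "homeomorphic_maps ?Y (quotient_topology ?X (scaling_orbit J)) (scaling_orbit J \<circ> (exp_vec J \<circ> lift))
      (\<lambda>A. (coords \<circ> log_vec J) (SOME x. x \<in> topspace ?X \<and> scaling_orbit J x = A))"
  proof (rule quotient_topology_homeomorphic)
    have "continuous_map ?X (powertop_real J) (log_vec J)"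
      by (rule continuous_map_log_vec) (auto simp: exp_vec_def)
    moreover have "continuous_map (powertop_real J) E coords"
      using continuous_map_coords[of UNIV] by (simp only: subtopology_UNIV)
    ultimately have "continuous_map ?X E (coords \<circ> log_vec J)"
      by (rule continuous_map_compose)
    moreover have "lift (coords (log_vec J \<rho>)) \<in> R" if "\<rho> \<in> exp_vec J ` R" for \<rho>
    proof -
      obtain v where v: "v \<in> R" "\<rho> = exp_vec J v" using \<open>\<rho> \<in> exp_vec J ` R\<close> by blast
      then have "v \<in> V" using R by blast
      have "lift (coords v) \<alpha> = v \<alpha> + - v a" if "\<alpha> \<in> J" for \<alpha>
        using lift_coords[OF \<open>v \<in> V\<close> that] by simp
      then show ?thesis using R_const[OF v(1) lift_in_V] v log[OF \<open>v \<in> V\<close>] by simp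
    qed
    ultimately show "continuous_map ?X ?Y (coords \<circ> log_vec J)"
      unfolding continuous_map_in_subtopology top by auto
    show "continuous_map ?Y ?X (exp_vec J \<circ> lift)"
      unfolding continuous_map_in_subtopology
      by (auto intro!: continuous_map_compose[OF continuous_map_from_subtopology[OF continuous_map_lift] continuous_map_exp_vec])
    show "(coords \<circ> log_vec J) ((exp_vec J \<circ> lift) y) = y" if "y \<in> topspace ?Y" for y
      using that coords_lift log[OF lift_in_V] by simp
    fix \<rho> \<rho>' assume "\<rho> \<in> topspace ?X" "\<rho>' \<in> topspace ?X"
    then obtain u v where uv: "u \<in> R" "v \<in> R" "\<rho> = exp_vec J u" "\<rho>' = exp_vec J v" unfolding top by blast
    then have "u \<in> V" "v \<in> V" using R by auto
    have "scaling_orbit J \<rho> = scaling_orbit J \<rho>' \<longleftrightarrow> (\<exists>c. \<forall>\<alpha>\<in>J. u \<alpha> = c + v \<alpha>)"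
      unfolding uv by (subst scaling_orbit_eq_iff) (auto simp: exp_vec_def)
    then show "scaling_orbit J \<rho> = scaling_orbit J \<rho>' \<longleftrightarrow> (coords \<circ> log_vec J) \<rho> = (coords \<circ> log_vec J) \<rho>'"
      using coords_eq_iff[OF \<open>u \<in> V\<close> \<open>v \<in> V\<close>] log \<open>u \<in> V\<close> \<open>v \<in> V\<close> by (simp add: uv)
  qed
  then show ?thesis
    using homeomorphic_maps_imp_homeomorphic_space homeomorphic_space_sym by blast
qed

end

text \<open>\<open>is_norm\<close> mentions no topology. Continuity comes from finite dimension: the
  triangle inequality over the unit vectors bounds \<open>F\<close> by a weighted l1 norm, which
  then controls differences of values.\<close>

lemma norm_on_coordinates:
  fixes m :: nat and M :: "(real, 'v) module" and k :: "(nat \<Rightarrow> real) \<Rightarrow> 'v"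
  defines "E \<equiv> Euclidean_space m"
  assumes k: "\<And>x. x \<in> topspace E \<Longrightarrow> k x \<in> carrier M" "k (\<lambda>_. 0) = \<zero>\<^bsub>M\<^esub>" "inj_on k (topspace E)"
    and add: "\<And>x y. x \<in> topspace E \<Longrightarrow> y \<in> topspace E \<Longrightarrow> k x \<oplus>\<^bsub>M\<^esub> k y = k (\<lambda>i. x i + y i)"
    and smult: "\<And>r x. x \<in> topspace E \<Longrightarrow> r \<odot>\<^bsub>M\<^esub> k x = k (dilate r x)"
    and N: "is_norm M N"
  defines "F \<equiv> \<lambda>x. N (k x)"
  shows "continuous_map E euclideanreal F" "\<And>x. x \<in> topspace E \<Longrightarrow> 0 \<le> F x"
    "\<And>x t. x \<in> topspace E \<Longrightarrow> 0 \<le> t \<Longrightarrow> F (dilate t x) = t * F x"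
    "\<And>x. x \<in> topspace E \<Longrightarrow> F x = 0 \<longleftrightarrow> x = (\<lambda>_. 0)"
proof -
  have pos: "0 \<le> F x" if "x \<in> topspace E" for x
    using N k(1)[OF that] by (simp add: is_norm_def F_def)
  have homo: "F (dilate t x) = \<bar>t\<bar> * F x" if "x \<in> topspace E" for x t
    using N k(1)[OF that] smult[OF that, of t] unfolding is_norm_def F_def by metis
  have tri: "F (\<lambda>i. x i + y i) \<le> F x + F y" if "x \<in> topspace E" "y \<in> topspace E" for x y
    using N k(1) that add[OF that] unfolding is_norm_def F_def by metis
  have zero: "(\<lambda>_. 0) \<in> topspace E" by (simp add: E_def topspace_Euclidean_space)
  have F0: "F (\<lambda>_. 0) = 0" using homo[OF zero, of 0] by (simp add: dilate_def)
  define u where "u i = (\<lambda>j. if j = i then 1 else 0 :: real)" for i :: nat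
  have uE: "u i \<in> topspace E" if "i < m" for i using that by (auto simp: u_def E_def topspace_Euclidean_space)
  have bound: "F x \<le> (\<Sum>i<m. \<bar>x i\<bar> * F (u i))" if x: "x \<in> topspace E" for x
  proof -
    have "F (\<lambda>i. if i < j then x i else 0) \<le> (\<Sum>i<j. \<bar>x i\<bar> * F (u i))" if "j \<le> m" for j
      using that
    proof (induction j)
      case 0
      then show ?case using F0 by simp
    next
      case (Suc j)
      have "(\<lambda>i. if i < Suc j then x i else 0) = (\<lambda>i. (if i < j then x i else 0) + dilate (x j) (u j) i)"
        by (auto simp: fun_eq_iff dilate_def u_def less_Suc_eq)
      moreover have "(\<lambda>i. if i < j then x i else 0) \<in> topspace E"
        using Suc.prems by (auto simp: E_def topspace_Euclidean_space)
      moreover have "dilate (x j) (u j) \<in> topspace E"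
        using Suc.prems by (intro dilate_simps(3)[of _ m, folded E_def] uE) simp
      ultimately have "F (\<lambda>i. if i < Suc j then x i else 0) \<le>
          F (\<lambda>i. if i < j then x i else 0) + F (dilate (x j) (u j))"
        using tri by simp
      also have "\<dots> \<le> (\<Sum>i<j. \<bar>x i\<bar> * F (u i)) + \<bar>x j\<bar> * F (u j)"
        using Suc homo[OF uE[of j]] by (intro add_mono) auto
      finally show ?case by simp
    qed
    moreover have "(\<lambda>i. if i < m then x i else 0) = x"
      using x by (auto simp: fun_eq_iff E_def topspace_Euclidean_space)
    ultimately show ?thesis by (metis order_refl)
  qed
  have diff: "F x \<le> F y + (\<Sum>i<m. \<bar>x i - y i\<bar> * F (u i))" if "x \<in> topspace E" "y \<in> topspace E" for x y
  proof -
    have d: "(\<lambda>i. x i - y i) \<in> topspace E" using that by (auto simp: E_def topspace_Euclidean_space)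
    have "F x \<le> F y + F (\<lambda>i. x i - y i)" using tri[OF that(2) d] by simp
    then show ?thesis using bound[OF d] by linarith
  qed
  have cont: "continuous_map E euclideanreal (\<lambda>y. \<Sum>i<m. \<bar>x i - y i\<bar> * F (u i))" for x
    unfolding E_def by (intro continuous_map_sum continuous_intros continuous_map_Euclidean_coord) auto
  show "continuous_map E euclideanreal F"
    unfolding continuous_map_upper_lower_semicontinuous_lt
  proof (intro conjI allI)
    fix c :: real
    show "openin E {x \<in> topspace E. c < F x}"
      unfolding openin_subopen[of E "{x \<in> topspace E. c < F x}"]
    proof
      fix x assume x: "x \<in> {x \<in> topspace E. c < F x}"
      have "openin E {y \<in> topspace E. (\<Sum>i<m. \<bar>x i - y i\<bar> * F (u i)) < F x - c}"
        by (intro openin_less_continuous_map cont) simp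
      moreover have "{y \<in> topspace E. (\<Sum>i<m. \<bar>x i - y i\<bar> * F (u i)) < F x - c} \<subseteq> {x \<in> topspace E. c < F x}"
      proof
        fix y assume y: "y \<in> {y \<in> topspace E. (\<Sum>i<m. \<bar>x i - y i\<bar> * F (u i)) < F x - c}"
        then show "y \<in> {x \<in> topspace E. c < F x}" using diff[of x y] x by auto
      qed
      ultimately show "\<exists>T. openin E T \<and> x \<in> T \<and> T \<subseteq> {x \<in> topspace E. c < F x}"
        using x by (intro exI conjI) auto
    qed
    show "openin E {x \<in> topspace E. F x < c}"
      unfolding openin_subopen[of E "{x \<in> topspace E. F x < c}"]
    proof
      fix x assume x: "x \<in> {x \<in> topspace E. F x < c}"
      have "openin E {y \<in> topspace E. (\<Sum>i<m. \<bar>x i - y i\<bar> * F (u i)) < c - F x}"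
        by (intro openin_less_continuous_map cont) simp
      moreover have "{y \<in> topspace E. (\<Sum>i<m. \<bar>x i - y i\<bar> * F (u i)) < c - F x} \<subseteq> {x \<in> topspace E. F x < c}"
      proof
        fix y assume y: "y \<in> {y \<in> topspace E. (\<Sum>i<m. \<bar>x i - y i\<bar> * F (u i)) < c - F x}"
        then show "y \<in> {x \<in> topspace E. F x < c}"
          using diff[of y x] x by (auto simp: abs_minus_commute)
      qed
      ultimately show "\<exists>T. openin E T \<and> x \<in> T \<and> T \<subseteq> {x \<in> topspace E. F x < c}"
        using x by (intro exI conjI) auto
    qed
  qed
  show "0 \<le> F x" if "x \<in> topspace E" for x using pos that .
  show "F (dilate t x) = t * F x" if "x \<in> topspace E" "0 \<le> t" for x t using homo that by simp
  show "F x = 0 \<longleftrightarrow> x = (\<lambda>_. 0)" if "x \<in> topspace E" for x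
  proof -
    have "F x = 0 \<longleftrightarrow> k x = \<zero>\<^bsub>M\<^esub>" using N k(1)[OF that] by (simp add: is_norm_def F_def)
    also have "\<dots> \<longleftrightarrow> k x = k (\<lambda>_. 0)" by (simp add: k)
    also have "\<dots> \<longleftrightarrow> x = (\<lambda>_. 0)" using inj_on_eq_iff[OF k(3) that zero] .
    finally show ?thesis .
  qed
qed

text \<open>Along a ray \<open>F\<close> grows linearly, so a point at level 1 leaves the ball under
  a slight dilation and is not interior.\<close>

lemma frontier_of_gauge_ball:
  fixes m :: nat
  defines "E \<equiv> Euclidean_space m"
  assumes F: "continuous_map E euclideanreal F"
    "\<And>x t. x \<in> topspace E \<Longrightarrow> 0 \<le> t \<Longrightarrow> F (dilate t x) = t * F x"
  shows "E frontier_of {x \<in> topspace E. F x \<le> 1} = {x \<in> topspace E. F x = 1}"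
proof -
  let ?S = "{x \<in> topspace E. F x \<le> 1}"
  have "closedin E ?S"
    using closedin_continuous_map_preimage[OF F(1), of "{..1}"] by simp
  then have cl: "E closure_of ?S = ?S" by (simp add: closure_of_closedin)
  have int: "E interior_of ?S = {x \<in> topspace E. F x < 1}"
  proof (rule interior_of_unique)
    show "{x \<in> topspace E. F x < 1} \<subseteq> ?S" by auto
    show "openin E {x \<in> topspace E. F x < 1}" using F(1) by (intro openin_less_continuous_map) auto
    fix T assume T: "T \<subseteq> ?S" "openin E T"
    show "T \<subseteq> {x \<in> topspace E. F x < 1}"
    proof
      fix x assume "x \<in> T"
      then have x: "x \<in> topspace E" "F x \<le> 1" using T by auto
      have "open {t. dilate t x \<in> T}" using openin_scalars T x(1) unfolding E_def by blast
      moreover have "1 \<in> {t. dilate t x \<in> T}" using \<open>x \<in> T\<close> by simp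
      ultimately have "\<exists>r>0. \<forall>t. dist t 1 < r \<longrightarrow> t \<in> {t. dilate t x \<in> T}" unfolding open_dist by blast
      then obtain r where r: "0 < r" "\<And>t. dist t 1 < r \<Longrightarrow> dilate t x \<in> T" by auto
      have "dilate (1 + r / 2) x \<in> T" using r by (intro r(2)) (simp add: dist_real_def)
      then have "F (dilate (1 + r / 2) x) \<le> 1" using T by auto
      then have "(1 + r / 2) * F x \<le> 1" using F(2)[OF x(1), of "1 + r / 2"] r(1) by simp
      moreover have "F x \<noteq> 1" using calculation r(1) by auto
      ultimately show "x \<in> {x \<in> topspace E. F x < 1}" using x by auto
    qed
  qed
  show ?thesis unfolding frontier_of_def cl int by auto
qed

text \<open>With the Euclidean norm, \<open>{g \<le> 1}\<close> becomes the set of points of the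
  closed ball with \<open>N < 1\<close> or \<open>g > 0\<close>. It is open in the ball, hence a
  manifold, and dense because it contains the open ball.\<close>

lemma manifold_and_compactification:
  fixes m :: nat and g :: "(nat \<Rightarrow> real) \<Rightarrow> real"
  defines "E \<equiv> Euclidean_space m"
  assumes g: "continuous_map E euclideanreal g" "\<And>x. x \<in> topspace E \<Longrightarrow> 0 \<le> g x"
    "\<And>x t. x \<in> topspace E \<Longrightarrow> 0 \<le> t \<Longrightarrow> g (dilate t x) = t * g x"
    and G: "G homeomorphic_space subtopology E {x. g x \<le> 1}"
  shows "manifold_with_boundary m G" "\<exists>f. compactification G (Euclidean_cball m) f"
proof -
  define N where "N x = sqrt (\<Sum>i<m. (x i)\<^sup>2)" for x :: "nat \<Rightarrow> real"
  have sq: "0 \<le> (\<Sum>i<m. (x i)\<^sup>2)" for x :: "nat \<Rightarrow> real" by (simp add: sum_nonneg)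
  have N_le: "N x \<le> 1 \<longleftrightarrow> (\<Sum>i<m. (x i)\<^sup>2) \<le> 1" for x by (simp add: N_def)
  have cont: "continuous_map E euclideanreal N"
    unfolding N_def E_def
    by (intro continuous_map_sqrt continuous_map_sum continuous_map_real_pow continuous_map_Euclidean_coord) auto
  have homo: "N (dilate t x) = t * N x" if "0 \<le> t" for t x
    using that by (simp add: N_def dilate_def power_mult_distrib sum_distrib_left[symmetric] real_sqrt_mult)
  have zero: "g x = 0" if x: "x \<in> topspace E" "N x = 0" for x
  proof -
    have "\<forall>i\<in>{..<m}. (x i)\<^sup>2 = 0"
      using x(2) sq[of x] by (subst sum_nonneg_eq_0_iff[symmetric]) (auto simp: N_def)
    then have "x i = 0" for i
      using x(1) by (cases "i < m") (auto simp: E_def topspace_Euclidean_space)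
    then have "x = dilate 0 x" by (simp add: fun_eq_iff dilate_def)
    then show ?thesis using g(3)[OF x(1), of 0] by simp
  qed
  have N0: "0 \<le> N x" for x using sq by (simp add: N_def)
  let ?A = "{x. N x \<le> 1 \<and> \<not> (N x = 1 \<and> g x = 0)}"
  let ?U = "{x \<in> topspace E. N x \<le> 1 \<and> \<not> (N x = 1 \<and> g x = 0)}"
  let ?K = "Euclidean_cball m"
  have K: "?K = subtopology E {x. N x \<le> 1}" by (simp add: Euclidean_cball_def E_def N_le)
  have topK: "topspace ?K = {x \<in> topspace E. N x \<le> 1}" by (auto simp: K)
  have ball: "subtopology E {x. g x \<le> 1} homeomorphic_space subtopology E ?A"
    unfolding E_def
    by (rule gauge_ball_homeomorphic) (use g cont homo zero N0 in \<open>simp_all add: E_def\<close>)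
  have KA: "subtopology E ?A = subtopology ?K ?U"
  proof -
    have "{x. N x \<le> 1} \<inter> ?U = topspace E \<inter> ?A" by auto
    then show ?thesis unfolding K subtopology_subtopology by (simp only: subtopology_restrict)
  qed
  have GU: "G homeomorphic_space subtopology ?K ?U"
    using homeomorphic_space_trans[OF G ball] unfolding KA .
  have "openin E ({x \<in> topspace E. N x < 1} \<union> {x \<in> topspace E. 0 < g x})"
    by (intro openin_Un openin_less_continuous_map cont g(1)) auto
  moreover have "?U = ({x \<in> topspace E. N x < 1} \<union> {x \<in> topspace E. 0 < g x}) \<inter> {x. N x \<le> 1}"
    using g(2) by (auto simp: less_le)
  ultimately have openU: "openin ?K ?U"
    unfolding K openin_subtopology by blast
  show "manifold_with_boundary m G"
    using GU manifold_with_boundary_open_in_cball[OF openU] by (rule manifold_with_boundary_homeomorphic)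
  obtain f where f: "homeomorphic_map G (subtopology ?K ?U) f"
    using GU homeomorphic_space by blast
  have "f ` topspace G = topspace ?K \<inter> ?U" using homeomorphic_imp_surjective_map[OF f] by simp
  then have fG: "f ` topspace G = ?U" by (auto simp: topK)
  have "embedding_map G ?K f" using f by (simp add: embedding_map_def fG)
  moreover have "?K closure_of ?U = topspace ?K"
  proof (rule subset_antisym[OF closure_of_subset_topspace], rule subsetI)
    fix x assume xK: "x \<in> topspace ?K"
    then have x: "x \<in> topspace E" "N x \<le> 1" by (auto simp: topK)
    show "x \<in> ?K closure_of ?U"
      unfolding in_closure_of
    proof (intro conjI xK allI impI)
      fix T assume T: "x \<in> T \<and> openin ?K T"
      then obtain T' where T': "openin E T'" "T = T' \<inter> {x. N x \<le> 1}" unfolding K openin_subtopology by blast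
      have "open {t. dilate t x \<in> T'}" using openin_scalars T'(1) x(1) unfolding E_def by blast
      moreover have "1 \<in> {t. dilate t x \<in> T'}" using T T' by simp
      ultimately have "\<exists>r>0. \<forall>t. dist t 1 < r \<longrightarrow> t \<in> {t. dilate t x \<in> T'}" unfolding open_dist by blast
      then obtain r where r: "0 < r" "\<And>t. dist t 1 < r \<Longrightarrow> dilate t x \<in> T'" by auto
      \<comment> \<open>A dilation by \<open>t < 1\<close> moves \<open>x\<close> into the open
        ball, and \<open>t\<close> is close enough to 1 to remain in \<open>T'\<close>.\<close>
      define t where "t = max (1 / 2) (1 - r / 2)"
      have t: "0 < t" "t < 1" "dist t 1 < r" using r(1) by (auto simp: t_def dist_real_def)
      have "N (dilate t x) \<le> t" using homo[of t x] t x(2) N0[of x] by (simp add: mult_left_le)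
      then have "N (dilate t x) < 1" using t by simp
      moreover have "dilate t x \<in> topspace E" using x(1) by (simp add: E_def)
      ultimately have "dilate t x \<in> ?U" "dilate t x \<in> T" using r(2)[OF t(3)] T' by auto
      then show "\<exists>y. y \<in> ?U \<and> y \<in> T" by blast
    qed
  qed
  ultimately have "compactification G ?K f"
    by (simp add: compactification_def compact_space_Euclidean_cball fG)
  then show "\<exists>f. compactification G ?K f" by blast
qed

text \<open>Two active indices are rivals of each other, and opposite inequalities give equality.
  This places the Dressian inside the quotient of V_J.\<close>

lemma log_null_zero_imp_infinity:
  assumes "log_null 0 J v L"
  shows "log_null \<infinity> J v L"
proof -
  let ?K = "active J L"
  have le: "\<exists>l\<in>?K - {k}. term_value v L k \<le> term_value v L l" if "k \<in> ?K" for k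
    using assms that unfolding log_null_def by auto
  have "3 \<le> card ?K \<or> (\<exists>l\<in>?K - {k}. term_value v L l = term_value v L k)" if k: "k \<in> ?K" for k
  proof (cases "3 \<le> card ?K")
    case False
    obtain l where l: "l \<in> ?K - {k}" "term_value v L k \<le> term_value v L l" using le[OF k] by blast
    then have "l \<in> ?K" by blast
    obtain k' where k': "k' \<in> ?K - {l}" "term_value v L l \<le> term_value v L k'" using le[OF \<open>l \<in> ?K\<close>] by blast
    have "card ?K \<le> card {k, l}" using False l by auto
    then have "?K = {k, l}" using k l by (intro card_seteq[symmetric] finite_active) auto
    then have "k' = k" using k' by auto
    then show ?thesis using l k' by (intro disjI2 bexI[of _ l]) auto
  qed simp
  then show ?thesis by (simp add: log_null_def)
qed

section \<open>The structure of both Grassmannians\<close>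

context M_convex_set
begin

lemma V_space_eq: "V_space n d J = log_reps \<infinity> J (strong_terms n d J)"
  unfolding V_space_def strong_reps_eq
  by (rule reps_log_image(1)[OF subset strong_terms_in_simplex])

text \<open>That zero lies in V_J rests on the absence of relations with a single active term. As
  \<open>J\<close> is nonempty, some \<open>a\<close> can normalise constants away, and the
  remaining hyperplane of V_J receives the dual basis.\<close>

lemma V_space_coordinates: "\<exists>m a e b. coordinate_system (V_space n d J) J m a e b"
proof -
  let ?V = "V_space n d J"
  have ext: "?V \<subseteq> J \<rightarrow>\<^sub>E UNIV" unfolding V_space_eq log_reps_def by blast
  have zero: "(\<lambda>\<alpha>\<in>J. 0) \<in> ?V"
  proof -
    have tv: "term_value (\<lambda>\<alpha>\<in>J. 0) L k = 0" if "k \<in> active J L" for L k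
      using that by (auto simp: term_value_def active_def)
    have "log_null \<infinity> J (\<lambda>\<alpha>\<in>J. 0) L" if L: "L \<in> strong_terms n d J" for L
      using active_not_singleton[OF L] tv unfolding log_null_def by (auto simp: Bex_def)
    then show ?thesis by (simp add: V_space_eq log_reps_def)
  qed
  have comb: "(\<lambda>\<alpha>\<in>J. u \<alpha> + c * v \<alpha>) \<in> ?V" if "u \<in> ?V" "v \<in> ?V" for u v c
  proof -
    have "log_null \<infinity> J (\<lambda>\<alpha>\<in>J. u \<alpha> + c * v \<alpha>) L" if "L \<in> strong_terms n d J" for L
    proof (rule log_null_infinity_combination[where c = c])
      show "log_null \<infinity> J u L" "log_null \<infinity> J v L"
        using \<open>u \<in> ?V\<close> \<open>v \<in> ?V\<close> that by (simp_all add: V_space_eq log_reps_def)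
    qed simp
    then show ?thesis by (simp add: V_space_eq log_reps_def)
  qed
  have const: "(\<lambda>\<alpha>\<in>J. c + v \<alpha>) \<in> ?V" if "v \<in> ?V" for v c
  proof -
    have "log_null \<infinity> J (\<lambda>\<alpha>\<in>J. c + v \<alpha>) L \<longleftrightarrow> log_null \<infinity> J v L" for L
      by (rule log_null_shift[of J _ v c]) simp
    then show ?thesis using that by (simp add: V_space_eq log_reps_def)
  qed
  obtain a where a: "a \<in> J" using convex by (auto simp: M_convex_def)
  let ?W = "{v \<in> ?V. v a = 0}"
  have "\<exists>(m::nat) e b. (\<forall>i<m. e i \<in> J \<and> b i \<in> ?W \<and> (\<forall>k<m. b i (e k) = (if k = i then 1 else 0))) \<and>
    (\<forall>v\<in>?W. \<forall>\<alpha>\<in>J. v \<alpha> = (\<Sum>i<m. v (e i) * b i \<alpha>))"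
  proof (rule echelon_basis[OF finite_J])
    show "?W \<subseteq> J \<rightarrow>\<^sub>E UNIV" using ext by blast
    show "(\<lambda>\<alpha>\<in>J. 0) \<in> ?W" using zero a by simp
    show "(\<lambda>\<alpha>\<in>J. u \<alpha> + c * v \<alpha>) \<in> ?W" if "u \<in> ?W" "v \<in> ?W" for u v c
      using comb[of u v c] that a by (simp del: restrict_apply add: restrict_def)
  qed
  then obtain m :: nat and e b where
    *: "\<forall>i<m. e i \<in> J \<and> b i \<in> ?W \<and> (\<forall>k<m. b i (e k) = (if k = i then 1 else 0))"
      "\<forall>v\<in>?W. \<forall>\<alpha>\<in>J. v \<alpha> = (\<Sum>i<m. v (e i) * b i \<alpha>)" by (elim exE conjE)
  have "coordinate_system ?V J m a e b"
    by unfold_locales (use ext const zero comb a * in \<open>simp_all\<close>)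
  then show ?thesis by blast
qed

text \<open>The gauge depends on the family of relations, but its ambient space and its zero set are
  governed by the parameters \<open>\<infinity>\<close> and 0, where strong and weak agree. So one
  argument covers both Grassmannians with the same target.\<close>

lemma Grassmannian_structure:
  assumes \<L>: "\<L> = strong_terms n d J \<or> \<L> = weak_terms n d J" and q: "0 < q" "q < \<infinity>"
  defines "G \<equiv> quotient_topology (subtopology (powertop_real J) (exp_vec J ` log_reps q J \<L>)) (scaling_orbit J)"
  shows "is_norm (VQ n d J) N \<Longrightarrow> G homeomorphic_space ball_minus_Dressian n d J N"
    and "manifold_with_boundary (tutte_rank n d J) G"
    and "\<exists>f. compactification G (Euclidean_cball (tutte_rank n d J)) f"
proof -
  obtain m a e b where "coordinate_system (V_space n d J) J m a e b"
    using V_space_coordinates by (elim exE)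
  then interpret coordinate_system "V_space n d J" J m a e b .
  let ?V = "V_space n d J"
  define k where "k = ones_coset J \<circ> lift"
  have hom_k: "homeomorphic_map E (VQ_top n d J) k"
    unfolding VQ_top_def k_def by (rule quotient_by_constants)
  have topV: "topspace (subtopology (powertop_real J) ?V) = ?V" using V_ext by auto
  have topVQ: "topspace (VQ_top n d J) = carrier (VQ n d J)"
    unfolding VQ_top_def topspace_quotient_topology topV by (simp add: VQ_def)
  have k_image: "k ` topspace E = carrier (VQ n d J)"
    using homeomorphic_imp_surjective_map[OF hom_k] topVQ by simp
  have k_inj: "inj_on k (topspace E)" using homeomorphic_imp_injective_map[OF hom_k] .
  have lift_eqI: "lift x = v" if "v \<in> J \<rightarrow>\<^sub>E UNIV" "\<And>\<alpha>. \<alpha> \<in> J \<Longrightarrow> lift x \<alpha> = v \<alpha>" for x v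
    using that by (auto simp: fun_eq_iff lift_def PiE_def extensional_def)
  have k_zero: "k (\<lambda>_. 0) = \<zero>\<^bsub>VQ n d J\<^esub>"
    using lift_eqI[of "\<lambda>\<alpha>\<in>J. 0" "\<lambda>_. 0"] by (simp add: VQ_def k_def ones_coset_arith(3) lift_def)
  have k_add: "k x \<oplus>\<^bsub>VQ n d J\<^esub> k y = k (\<lambda>i. x i + y i)" for x y
    using lift_eqI[of "\<lambda>\<alpha>\<in>J. lift x \<alpha> + lift y \<alpha>" "\<lambda>i. x i + y i"]
    by (simp add: VQ_def k_def ones_coset_arith(1) lift_linear)
  have k_smult: "r \<odot>\<^bsub>VQ n d J\<^esub> k x = k (dilate r x)" for r x
    using lift_eqI[of "\<lambda>\<alpha>\<in>J. r * lift x \<alpha>" "dilate r x"]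
    by (simp add: VQ_def k_def ones_coset_arith(2) lift_linear)
  have rank: "tutte_rank n d J = m"
    unfolding tutte_rank_def
    by (rule coordinate_vectorspace(2)[where k = k])
      (use k_image k_inj k_zero k_add k_smult in \<open>auto simp: bij_betw_def\<close>)
  have sub: "\<L> \<subseteq> strong_terms n d J" using \<L> weak_subset_strong by blast
  have inf: "log_reps \<infinity> J \<L> = ?V" "log_reps 0 J \<L> = log_reps 0 J (strong_terms n d J)"
    using \<L> log_reps_weak_eq_strong by (auto simp: V_space_eq)
  define R where "R = log_reps q J \<L>"
  have RV: "R \<subseteq> ?V"
    unfolding inf(1)[symmetric] R_def log_reps_def using log_null_finite_imp_infinity q by blast
  have shift: "w \<in> log_reps q' J \<L>" if "v \<in> log_reps q' J \<L>" "w \<in> ?V" "\<And>\<alpha>. \<alpha> \<in> J \<Longrightarrow> w \<alpha> = v \<alpha> + c" for v w c q'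
  proof -
    have "log_null q' J w L \<longleftrightarrow> log_null q' J v L" for L using that(3) by (rule log_null_shift)
    then show ?thesis using that(1,2) V_ext by (auto simp: log_reps_def)
  qed
  have G: "G homeomorphic_space subtopology E {x. lift x \<in> R}"
    unfolding G_def R_def[symmetric] by (rule quotient_by_scaling[OF RV]) (use shift in \<open>auto simp: R_def\<close>)
  have null: "log_null \<infinity> J (lift x) L" if "L \<in> \<L>" for x L
    using lift_in_V that sub unfolding V_space_eq log_reps_def by blast
  have "\<exists>g. continuous_map E euclideanreal g \<and>
    (\<forall>x\<in>topspace E. 0 \<le> g x \<and> (\<forall>t\<ge>0. g (dilate t x) = t * g x) \<and>
      ((\<forall>L\<in>\<L>. log_null q J (lift x) L) \<longleftrightarrow> g x \<le> 1) \<and>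
      (g x = 0 \<longleftrightarrow> (\<forall>L\<in>\<L>. log_null 0 J (lift x) L)))"
    by (rule log_reps_gauge[OF finite_subset[OF sub finite_strong_terms] q])
      (use continuous_map_lift_component lift_linear(1) null in auto)
  then obtain g where g: "continuous_map E euclideanreal g"
    "\<And>x. x \<in> topspace E \<Longrightarrow> 0 \<le> g x"
    "\<And>x t. x \<in> topspace E \<Longrightarrow> 0 \<le> t \<Longrightarrow> g (dilate t x) = t * g x"
    "\<And>x. x \<in> topspace E \<Longrightarrow> lift x \<in> R \<longleftrightarrow> g x \<le> 1"
    "\<And>x. x \<in> topspace E \<Longrightarrow> g x = 0 \<longleftrightarrow> lift x \<in> log_reps 0 J \<L>"
    by (auto simp: R_def log_reps_def lift_def)
  have "topspace E \<inter> {x. lift x \<in> R} = topspace E \<inter> {x. g x \<le> 1}" using g(4) by auto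
  then have "subtopology E {x. lift x \<in> R} = subtopology E {x. g x \<le> 1}"
    by (metis subtopology_restrict)
  with G have Gg: "G homeomorphic_space subtopology E {x. g x \<le> 1}" by simp
  show "manifold_with_boundary (tutte_rank n d J) G"
    "\<exists>f. compactification G (Euclidean_cball (tutte_rank n d J)) f"
    unfolding rank using manifold_and_compactification[OF g(1-3) Gg] by blast+
  assume N: "is_norm (VQ n d J) N"
  define F where "F x = N (k x)" for x
  have F: "continuous_map E euclideanreal F" "\<And>x. x \<in> topspace E \<Longrightarrow> 0 \<le> F x"
    "\<And>x t. x \<in> topspace E \<Longrightarrow> 0 \<le> t \<Longrightarrow> F (dilate t x) = t * F x"
    "\<And>x. x \<in> topspace E \<Longrightarrow> F x = 0 \<longleftrightarrow> x = (\<lambda>_. 0)"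
    unfolding F_def using norm_on_coordinates[OF _ k_zero k_inj k_add k_smult N] k_image by blast+
  have gF: "g x = 0" if "x \<in> topspace E" "F x = 0" for x
    using g(3)[OF that(1), of 0] F(4)[OF that(1)] that(2) by (simp add: dilate_def)
  have "subtopology E {x. g x \<le> 1} homeomorphic_space subtopology E {x. F x \<le> 1 \<and> \<not> (F x = 1 \<and> g x = 0)}"
    by (rule gauge_ball_homeomorphic[OF g(1-3) F(1-3) gF])
  also have "\<dots> homeomorphic_space ball_minus_Dressian n d J N"
  proof -
    let ?B = "{x \<in> topspace E. F x \<le> 1}"
    have B: "unit_cball (VQ n d J) N = k ` ?B"
      unfolding unit_cball_def k_image[symmetric] F_def by auto
    have "VQ_top n d J frontier_of (k ` ?B) = k ` (E frontier_of ?B)"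
      by (rule homeomorphic_map_frontier_of[OF hom_k]) auto
    then have fr: "VQ_top n d J frontier_of (k ` ?B) = k ` {x \<in> topspace E. F x = 1}"
      using frontier_of_gauge_ball[OF F(1,3)] by simp
    have Dr: "Dressian n d J = k ` {x \<in> topspace E. g x = 0}"
    proof -
      have "Dressian n d J = ones_coset J ` log_reps 0 J \<L>"
        unfolding Dressian_def strong_reps_eq inf(2)
        by (rule arg_cong[of _ _ "image _"], rule reps_log_image(1)[OF subset strong_terms_in_simplex])
      also have "\<dots> = k ` {x \<in> topspace E. g x = 0}"
      proof (intro subset_antisym subsetI)
        fix A assume "A \<in> ones_coset J ` log_reps 0 J \<L>"
        then obtain v where v: "v \<in> log_reps 0 J \<L>" "A = ones_coset J v" by blast
        have vV: "v \<in> ?V"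
          using v(1) log_null_zero_imp_infinity unfolding inf(1)[symmetric] log_reps_def by blast
        \<comment> \<open>A class in the Dressian may come with an unnormalised \<open>v\<close>;
          passing to the representative vanishing at \<open>a\<close> changes it by a constant,
          which nullity tolerates.\<close>
        have eq: "lift (coords v) \<alpha> = v \<alpha> + - v a" if "\<alpha> \<in> J" for \<alpha>
          using lift_coords[OF vV that] by simp
        have "lift (coords v) \<in> log_reps 0 J \<L>" by (rule shift[OF v(1) lift_in_V eq])
        then have "g (coords v) = 0" using g(5)[OF coords_in_E] by simp
        moreover have "ones_coset J (lift (coords v)) = ones_coset J v"
          using eq ones_coset_eq_iff[of "lift (coords v)" J v] lift_in_V vV V_ext
          by (metis add.commute subsetD)
        ultimately show "A \<in> k ` {x \<in> topspace E. g x = 0}"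
          using v(2) coords_in_E unfolding k_def by (intro image_eqI[of _ _ "coords v"]) auto
      next
        fix A assume "A \<in> k ` {x \<in> topspace E. g x = 0}"
        then obtain x where "x \<in> topspace E" "g x = 0" "A = ones_coset J (lift x)" by (auto simp: k_def)
        then show "A \<in> ones_coset J ` log_reps 0 J \<L>" using g(5) by blast
      qed
      finally show ?thesis .
    qed
    let ?S = "{x \<in> topspace E. F x \<le> 1 \<and> \<not> (F x = 1 \<and> g x = 0)}"
    have "k ` ?B - (k ` {x \<in> topspace E. g x = 0} \<inter> k ` {x \<in> topspace E. F x = 1}) = k ` ?S"
    proof -
      have "k ` {x \<in> topspace E. g x = 0} \<inter> k ` {x \<in> topspace E. F x = 1} =
          k ` ({x \<in> topspace E. g x = 0} \<inter> {x \<in> topspace E. F x = 1})"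
        by (rule inj_on_image_Int[OF k_inj, symmetric]) auto
      moreover have "k ` ?B - k ` ({x \<in> topspace E. g x = 0} \<inter> {x \<in> topspace E. F x = 1}) =
          k ` (?B - ({x \<in> topspace E. g x = 0} \<inter> {x \<in> topspace E. F x = 1}))"
        by (rule inj_on_image_set_diff[OF k_inj, symmetric]) auto
      moreover have "?B - ({x \<in> topspace E. g x = 0} \<inter> {x \<in> topspace E. F x = 1}) = ?S" by auto
      ultimately show ?thesis by simp
    qed
    then have ball: "ball_minus_Dressian n d J N = subtopology (VQ_top n d J) (k ` ?S)"
      unfolding ball_minus_Dressian_def Let_def B fr Dr by simp
    have "k ` (topspace E \<inter> ?S) = topspace (VQ_top n d J) \<inter> k ` ?S"
      using k_image topVQ by auto
    from homeomorphic_map_subtopologies[OF hom_k this]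
    have "subtopology E ?S homeomorphic_space ball_minus_Dressian n d J N"
      unfolding ball by (rule homeomorphic_map_imp_homeomorphic_space)
    moreover have "?S = topspace E \<inter> {x. F x \<le> 1 \<and> \<not> (F x = 1 \<and> g x = 0)}" by auto
    ultimately show ?thesis by (simp only: subtopology_restrict)
  qed
  finally show "G homeomorphic_space ball_minus_Dressian n d J N"
    using homeomorphic_space_trans[OF Gg] by blast
qed

lemma Gr_eq:
  "Gr q n d J = quotient_topology (subtopology (powertop_real J) (exp_vec J ` log_reps q J (strong_terms n d J))) (scaling_orbit J)"
  unfolding Gr_def rep_space_def strong_reps_eq
  by (simp only: reps_log_image(2)[OF subset strong_terms_in_simplex])

lemma Gr_weak_eq:
  "Gr_weak q n d J = quotient_topology (subtopology (powertop_real J) (exp_vec J ` log_reps q J (weak_terms n d J))) (scaling_orbit J)"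
  unfolding Gr_weak_def rep_space_def weak_reps_eq
  by (simp only: reps_log_image(2)[OF subset strong_terms_in_simplex[OF subsetD[OF weak_subset_strong]]])

end

theorem theorem3p25:
  fixes n d :: nat and J :: "(nat \<Rightarrow> nat) set" and q :: ennreal
  assumes "J \<subseteq> discrete_simplex n d"
    and "M_convex n J"
    and "0 < q" and "q < \<infinity>"
  shows "(\<forall>N. is_norm (VQ n d J) N \<longrightarrow>
            Gr q n d J homeomorphic_space ball_minus_Dressian n d J N \<and>
            Gr_weak q n d J homeomorphic_space ball_minus_Dressian n d J N) \<and>
         (\<forall>G\<in>{Gr q n d J, Gr_weak q n d J}.
            manifold_with_boundary (tutte_rank n d J) G \<and>
            (\<exists>f. compactification G (Euclidean_cball (tutte_rank n d J)) f))"
proof -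
  interpret M_convex_set n d J using assms(1,2) by unfold_locales
  note strong = Grassmannian_structure[OF disjI1[OF refl] assms(3,4), folded Gr_eq]
    and weak = Grassmannian_structure[OF disjI2[OF refl] assms(3,4), folded Gr_weak_eq]
  show ?thesis using strong weak by blast
qed

end
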